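(* Let $m>1$ be an odd integer. Then \[ \triangle(q)^{2m^2-2}=\frac{(-1)^{m(m+1)/2}}{m!\left(\prod_{i=1}^{m-1}i!\right)^2}(1-q^m)\sum_{J\subset\{1,\dots,m\}}(-1)^{|J|}\sum_{\substack{\vec k\in\mathbb{Z}^{m-1}\\ (\vec k,-|\vec k|)\in\mathbb{Z}^m_J}}\ \sum_{\vec r\in\mathbb{Z}^m_J} q^{\sum_{j=1}^{m-1}(2k_j-1)r_j-(1+2|\vec k|)r_m-\frac{m^2-1}{4}}\prod_{1\le i<j\le m}(r_i-r_j)^2. \]
   Context: $\triangle(q)=\sum_{n\ge0}q^{n(n+1)/2}$. For $J\subset\{1,\dots,m\}$, $\mathbb{Z}^m_J=\{\vec k=(k_1,\dots,k_m)\in\mathbb{Z}^m : J=\{j: k_j\le 0\}\}$. For $\vec k=(k_1,\dots,k_{m-1})\in\mathbb{Z}^{m-1}$, $|\vec k|=k_1+\cdots+k_{m-1}$, and $(\vec k,-|\vec k|)$ denotes the vector $(k_1,\dots,k_{m-1},-|\vec k|)\in\mathbb{Z}^m$. $\vec r=(r_1,\dots,r_m)$. *)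

theory Defs
  imports "HOL-Analysis.Analysis"
begin

definition triangle_series :: "complex \<Rightarrow> complex" where
  "triangle_series q = (\<Sum>n. q ^ (n * (n + 1) div 2))"

text \<open>A vector in \<open>\<int>\<^sup>n\<close> is a function \<^typ>\<open>nat \<Rightarrow> int\<close> that is extensional on \<open>{1..n}\<close>, so that
  distinct functions are distinct vectors and sums over vectors count each of them once.\<close>

definition int_vectors :: "nat \<Rightarrow> (nat \<Rightarrow> int) set" where
  "int_vectors n = {1..n} \<rightarrow>\<^sub>E UNIV"

definition int_vectors_J :: "nat \<Rightarrow> nat set \<Rightarrow> (nat \<Rightarrow> int) set" where
  "int_vectors_J m J = {k \<in> int_vectors m. J = {j \<in> {1..m}. k j \<le> 0}}"

definition coord_sum :: "nat \<Rightarrow> (nat \<Rightarrow> int) \<Rightarrow> int" where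
  "coord_sum n k = (\<Sum>j=1..n. k j)"

text \<open>For \<open>k \<in> \<int>\<^sup>m\<^sup>-\<^sup>1\<close> this is the vector \<open>(k, -|k|) \<in> \<int>\<^sup>m\<close>.\<close>

definition append_neg_sum :: "nat \<Rightarrow> (nat \<Rightarrow> int) \<Rightarrow> (nat \<Rightarrow> int)" where
  "append_neg_sum m k = k(m := - coord_sum (m - 1) k)"

definition k_range :: "nat \<Rightarrow> nat set \<Rightarrow> (nat \<Rightarrow> int) set" where
  "k_range m J = {k \<in> int_vectors (m - 1). append_neg_sum m k \<in> int_vectors_J m J}"

text \<open>The division by \<open>4\<close> is exact for odd \<open>m\<close>.\<close>

definition q_exponent :: "nat \<Rightarrow> (nat \<Rightarrow> int) \<Rightarrow> (nat \<Rightarrow> int) \<Rightarrow> int" where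
  "q_exponent m k r =
     (\<Sum>j=1..m-1. (2 * k j - 1) * r j) - (1 + 2 * coord_sum (m - 1) k) * r m
       - ((int m)\<^sup>2 - 1) div 4"

text \<open>The exponent can be negative only where the product of the squared differences vanishes,
  so the convention \<open>0 powi n = 0\<close> for \<open>n < 0\<close> plays no role.\<close>

definition summand :: "nat \<Rightarrow> complex \<Rightarrow> (nat \<Rightarrow> int) \<Rightarrow> (nat \<Rightarrow> int) \<Rightarrow> complex" where
  "summand m q k r =
     q powi q_exponent m k r *
     (\<Prod>(i, j)\<in>{(i, j). 1 \<le> i \<and> i < j \<and> j \<le> m}. of_int ((r i - r j)\<^sup>2))"

end

theory Submission
  imports Defs "HOL-Complex_Analysis.Complex_Analysis" "Jordan_Normal_Form.Determinant"
begin

text \<open>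
  Put \<open>Q = q\<^sup>2\<close> and consider Kronecker's series \<open>\<phi>\<^sub>n(w, y) = \<Sum>r. r\<^sup>n y\<^sup>r / (1 - w Q\<^sup>r)\<close>, summed over all
  integers \<open>r\<close>. Expanding the geometric series, \<open>w \<phi>\<^sub>n(w, q)\<close> is the sum of
  \<open>\<plusminus> r\<^sup>n q\<^bsup>(2 k - 1) r\<^esup> w\<^sup>k\<close> over the pairs \<open>(k, r)\<close> of equal sign class. As the squared Vandermonde
  product is a sum over pairs of permutations, the multiple sum of the theorem is \<open>m!\<close> times the
  coefficient of \<open>w\<^sup>0\<close> in the Hankel determinant of \<open>w \<phi>\<^bsub>a+b\<^esub>(w, q)\<close> with \<open>0 \<le> a, b < m\<close>.

  The determinant \<open>\<tau>(w, y)\<close> of \<open>\<phi>\<^bsub>a+b\<^esub>(w, y)\<close> is multiplied by \<open>y\<^bsup>-m\<^esup>\<close> under \<open>w \<mapsto> Q w\<close> and has only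
  a simple pole at \<open>w = 1\<close>, so it is a multiple of \<open>\<theta>(w y\<^sup>m) / (\<theta>(w) \<theta>(y\<^sup>m))\<close>. The factor is Kiepert's
  determinant in the derivatives of the Weierstrass function; by the previous identity it vanishes where
  \<open>\<theta>(y\<^sup>m)\<close> does, so the same rigidity in the variable \<open>y\<close> identifies it as
  a multiple of \<open>y\<^bsup>m(m-1)/2\<^esup> \<theta>(y\<^sup>m) / \<theta>(y)\<^bsup>m m\<^esup>\<close>, the constant being found as \<open>y \<rightarrow> 1\<close>.
  At \<open>y = q\<close> the theta quotient is a power of Gauss's product for the triangular series, and \<open>\<tau>(w, q)\<close> is
  a multiple of \<open>w\<^bsup>-(m-1)/2\<^esup> \<phi>\<^sub>0(w, q)\<close>, each of whose Laurent coefficients is a geometric series.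
\<close>

section \<open>Hankel determinants\<close>

text \<open>Replacing \<open>w\<close> by \<open>Q w\<close> shifts the index \<open>r\<close>, so
  \<open>r^n\<close> becomes \<open>(r-1)^n\<close>. On a Hankel matrix this is a unitriangular
  congruence, invisible to the determinant; only a scalar per row survives. Near
  \<open>w = 1\<close> only the corner entry is unbounded, so the pole stays simple and its
  coefficient is a Hankel determinant of size \<open>m - 1\<close>. No continuation to the whole
  punctured plane is required: the annulus \<open>ann\<close> contains one pole and room for one
  step by \<open>Q\<close>, and that already forces a quasi-periodic holomorphic function to be a
  monomial. Oddness of \<open>m\<close> enters at the half period: for \<open>m = 2 s + 1\<close>
  one has \<open>q^m = Q^s q\<close>, so theta values at \<open>q^m\<close> are, up to sign,
  monomials times theta values at \<open>q\<close>. The coefficient of index \<open>-s\<close> that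
  remains has only terms with \<open>r \<le> 0\<close>, with sum \<open>- 1 / (1 - q^m)\<close>;
  this is the origin of the factor \<open>1 - q^m\<close>. Theta quotients need
  \<open>Q = q^2\<close> nonzero, so \<open>q = 0\<close> is reached as a limit, where negative
  exponents must be excluded by a lower bound for sums of absolute values of distinct
  integers.\<close>

definition hankel_det :: "nat \<Rightarrow> (nat \<Rightarrow> 'a::comm_ring_1) \<Rightarrow> 'a" where
  "hankel_det n f = Determinant.det (Matrix.mat n n (\<lambda>(i,j). f (i + j)))"

lemma det_mat_permutations:
  "Determinant.det (Matrix.mat n n f) =
     (\<Sum>p | p permutes {0..<n}. signof p * (\<Prod>i = 0..<n. f (i, p i)))"
proof -
  have "(\<Prod>i = 0..<n. Matrix.mat n n f $$ (i, p i)) = (\<Prod>i = 0..<n. f (i, p i))"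
    if "p permutes {0..<n}" for p
    using permutes_in_image[OF that] by (intro prod.cong refl) auto
  then show ?thesis
    by (subst det_def'[of _ n]) auto
qed

lemma tendsto_det_mat:
  fixes f :: "'b \<Rightarrow> nat \<times> nat \<Rightarrow> 'a::{real_normed_algebra_1,comm_ring_1}"
  assumes "\<And>i j. i < n \<Longrightarrow> j < n \<Longrightarrow> ((\<lambda>x. f x (i,j)) \<longlongrightarrow> g (i,j)) F"
  shows "((\<lambda>x. Determinant.det (Matrix.mat n n (f x))) \<longlongrightarrow> Determinant.det (Matrix.mat n n g)) F"
  unfolding det_mat_permutations
  by (intro tendsto_sum tendsto_mult tendsto_const tendsto_prod assms)
     (use permutes_in_image in fastforce)+

lemma holomorphic_on_hankel_det:
  assumes "\<And>k. (\<lambda>x. f x k) holomorphic_on S"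
  shows "(\<lambda>x. hankel_det n (f x)) holomorphic_on S"
  unfolding hankel_det_def det_mat_permutations prod.case
  by (intro holomorphic_intros assms)

text \<open>Take determinants in F = L G L^T. The same congruence yields translation and dilation of
  the moment variable and the Laguerre diagonalisation.\<close>

lemma det_mat_triangular_congruence:
  fixes G L :: "nat \<Rightarrow> nat \<Rightarrow> 'a::comm_ring_1"
  assumes "\<And>a b. a < n \<Longrightarrow> b < n \<Longrightarrow>
      F a b = (\<Sum>c = 0..<n. \<Sum>d = 0..<n. L a c * G c d * L b d)"
    and tri: "\<And>a c. c > a \<Longrightarrow> L a c = 0"
  shows "Determinant.det (Matrix.mat n n (\<lambda>(a,b). F a b)) =
           (\<Prod>a = 0..<n. L a a)\<^sup>2 * Determinant.det (Matrix.mat n n (\<lambda>(a,b). G a b))"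
proof -
  define Lm where "Lm = Matrix.mat n n (\<lambda>(a,b). L a b)"
  define Gm where "Gm = Matrix.mat n n (\<lambda>(a,b). G a b)"
  have c: "Lm \<in> carrier_mat n n" "Gm \<in> carrier_mat n n" "transpose_mat Lm \<in> carrier_mat n n"
    by (auto simp: Lm_def Gm_def)
  have "Matrix.mat n n (\<lambda>(a,b). F a b) = Lm * Gm * transpose_mat Lm"
    apply (rule eq_matI)
    using c apply (auto simp: Lm_def Gm_def scalar_prod_def assms(1) sum_distrib_right)
    apply (subst sum.swap) apply (rule refl)
    done
  moreover have "Determinant.det Lm = (\<Prod>a = 0..<n. L a a)"
    by (subst det_lower_triangular[of n]) (auto simp: Lm_def tri prod_list_diag_prod)
  ultimately show ?thesis
    using c by (simp add: det_mult[of _ n] det_transpose[of _ n] power2_eq_square Gm_def mult_ac)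
qed

text \<open>If \<open>f\<close> is the moment sequence of a variable r, the binomial choice of
  \<open>L\<close> gives the moments of r - 1: Hankel determinants are translation invariant, and
  \<open>z\<close> comes out of each of the \<open>n\<close> rows. The sums never reach
  \<open>L a c\<close> with \<open>c > a\<close>; \<open>L'\<close> puts zeros there.\<close>

lemma hankel_det_unitriangular:
  fixes f f' :: "nat \<Rightarrow> 'a::comm_ring_1"
  assumes "\<And>a b. f' (a + b) = z * (\<Sum>c\<le>a. \<Sum>d\<le>b. L a c * L b d * f (c + d))"
    and one: "\<And>a. L a a = 1"
  shows "hankel_det n f' = z ^ n * hankel_det n f"
proof -
  define L' where "L' = (\<lambda>a c. if c \<le> a then L a c else 0)"
  have "hankel_det n f' = (\<Prod>a = 0..<n. L' a a)\<^sup>2 * Determinant.det (Matrix.mat n n (\<lambda>(a,b). z * f (a+b)))"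
    unfolding hankel_det_def
  proof (rule det_mat_triangular_congruence[where L = L'])
    fix a b assume ab: "a < n" "b < n"
    have "(\<Sum>c = 0..<n. \<Sum>d = 0..<n. L' a c * (z * f (c+d)) * L' b d)
      = (\<Sum>c\<le>a. \<Sum>d\<le>b. L' a c * (z * f (c+d)) * L' b d)"
      apply (rule sum.mono_neutral_cong_right)
      using ab apply (auto simp: L'_def)
      apply (rule sum.mono_neutral_cong_right)
      apply auto
      done
    also have "\<dots> = f' (a + b)"
      unfolding assms(1) sum_distrib_left
      by (intro sum.cong refl) (auto simp: L'_def mult_ac)
    finally show "f' (a + b) = (\<Sum>c = 0..<n. \<Sum>d = 0..<n. L' a c * (z * f (c+d)) * L' b d)" by simp
  qed (auto simp: L'_def)
  also have "Matrix.mat n n (\<lambda>(a,b). z * f (a+b)) = z \<cdot>\<^sub>m Matrix.mat n n (\<lambda>(a,b). f (a+b))"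
    by (rule eq_matI) auto
  finally show ?thesis
    by (simp add: L'_def one hankel_det_def)
qed

lemma hankel_det_scale:
  fixes f :: "nat \<Rightarrow> 'a::comm_ring_1"
  shows "hankel_det n (\<lambda>k. x ^ k * f k) = x ^ (n * (n - 1)) * hankel_det n f"
proof -
  have "hankel_det n (\<lambda>k. x ^ k * f k) =
      (\<Prod>a = 0..<n. if a = a then x ^ a else 0)\<^sup>2 * hankel_det n f"
    unfolding hankel_det_def
  proof (rule det_mat_triangular_congruence[where L = "\<lambda>a c. if c = a then x ^ a else 0"])
    fix a b assume "a < n" "b < n"
    then show "x ^ (a + b) * f (a + b) = (\<Sum>c = 0..<n. \<Sum>d = 0..<n. (if c = a then x ^ a else 0) * f (c + d) * (if d = b then x ^ b else 0))"
      by (simp add: if_distrib[of "\<lambda>t. _ * t"] if_distrib[of "\<lambda>t. t * _"] sum.delta power_add cong: if_cong)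
  qed auto
  also have "(\<Prod>a = 0..<n. if a = a then x ^ a else 0)\<^sup>2 = x ^ (n * (n - 1))"
  proof (induction n)
    case (Suc n)
    have "n * (n - 1) + 2 * n = Suc n * n" by (cases n) auto
    then have "x ^ (Suc n * n) = x ^ (n * (n - 1)) * (x ^ n)\<^sup>2"
      by (metis mult.commute power_add power_mult)
    with Suc show ?case by (simp add: power_mult_distrib)
  qed simp
  finally show ?thesis .
qed

lemma hankel_det_cmult:
  "hankel_det n (\<lambda>k. x * f k) = x ^ n * hankel_det n f"
proof -
  have "Matrix.mat n n (\<lambda>(a,b). x * f (a+b)) = x \<cdot>\<^sub>m Matrix.mat n n (\<lambda>(a,b). f (a+b))"
    by (rule eq_matI) auto
  then show ?thesis by (simp add: hankel_det_def)
qed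

text \<open>Gram matrix of the monomials for the weight \<open>x\<^sup>2 exp (-x)\<close>, diagonalised by Laguerre polynomials.\<close>
lemma hankel_det_fact:
  "hankel_det n (\<lambda>k. of_nat (fact (k + 2)) :: complex) = (\<Prod>i<n. fact i * fact (i + 2))"
proof -
  define L :: "nat \<Rightarrow> nat \<Rightarrow> complex" where "L = (\<lambda>a c. of_nat (a choose c) * fact (a + 2) / fact (c + 2))"
  have "hankel_det n (\<lambda>k. of_nat (fact (k + 2)) :: complex) =
      (\<Prod>a = 0..<n. L a a)\<^sup>2 * Determinant.det (Matrix.mat n n (\<lambda>(c,d). if c = d then fact c * fact (c+2) else 0))"
    unfolding hankel_det_def
  proof (rule det_mat_triangular_congruence[where L = L])
    fix a b assume ab: "a < n" "b < n"
    have "(\<Sum>c = 0..<n. \<Sum>d = 0..<n. L a c * (if c = d then fact c * fact (c+2) else 0) * L b d)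
       = (\<Sum>c = 0..<n. L a c * (fact c * fact (c+2)) * L b c)"
      by (intro sum.cong refl) (simp add: if_distrib[of "\<lambda>t. _ * t"] if_distrib[of "\<lambda>t. t * _"] sum.delta cong: if_cong)
    also have "\<dots> = (\<Sum>c\<le>b. L a c * (fact c * fact (c+2)) * L b c)"
      using ab by (intro sum.mono_neutral_right) (auto simp: L_def)
    also have "\<dots> = (\<Sum>c\<le>b. fact (a+2) * fact b * of_nat ((a choose c) * ((b + 2) choose (b - c))))"
    proof (intro sum.cong refl)
      fix c assume "c \<in> {..b}"
      then have cb: "c \<le> b" by simp
      have 1: "of_nat (b choose c) = (fact b / (fact c * fact (b - c)) :: complex)"
        using cb by (simp add: binomial_fact)
      have 2: "of_nat ((b+2) choose (b - c)) = (fact (b+2) / (fact (b-c) * fact (c+2)) :: complex)"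
        using cb by (subst binomial_fact) auto
      show "L a c * (fact c * fact (c+2)) * L b c = fact (a+2) * fact b * of_nat ((a choose c) * ((b + 2) choose (b - c)))"
        unfolding L_def of_nat_mult 1 2 by (simp add: field_simps del: fact_Suc add_2_eq_Suc')
    qed
    also have "\<dots> = fact (a+2) * fact b * of_nat (\<Sum>c\<le>b. (a choose c) * ((b + 2) choose (b - c)))"
      by (simp only: sum_distrib_left of_nat_sum)
    also have "(\<Sum>c\<le>b. (a choose c) * ((b + 2) choose (b - c))) = (a + (b+2)) choose b"
      by (rule vandermonde)
    also have "of_nat (a + (b+2) choose b) = (fact (a + b + 2) / (fact b * fact (a + 2)) :: complex)"
      by (subst binomial_fact) (auto simp: add_ac)
    finally show "of_nat (fact (a + b + 2)) = (\<Sum>c = 0..<n. \<Sum>d = 0..<n. L a c * (if c = d then fact c * fact (c+2) else 0) * L b d)"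
      by (simp del: fact_Suc add_2_eq_Suc')
  qed (auto simp: L_def)
  also have "(\<Prod>a = 0..<n. L a a) = 1" by (simp add: L_def del: fact_Suc add_2_eq_Suc')
  also have "Determinant.det (Matrix.mat n n (\<lambda>(c,d). if c = d then fact c * fact (c+2) else 0)) = (\<Prod>i<n. fact i * fact (i + 2) :: complex)"
    by (subst det_lower_triangular[of n]) (auto simp: prod_list_diag_prod atLeast0LessThan)
  finally show ?thesis by simp
qed

text \<open>Only the corner entry is unbounded. Multiplying the first row by \<open>c\<close> makes
  that row tend to (1, 0, ..., 0) and leaves the other rows convergent, so the limit is the minor
  without first row and column, whose indices are raised by 2.\<close>

lemma tendsto_hankel_det_simple_pole:
  fixes f :: "complex \<Rightarrow> nat \<Rightarrow> complex"
  assumes "n > 0" and "((\<lambda>w. c w * f w 0) \<longlongrightarrow> 1) F" and c: "(c \<longlongrightarrow> 0) F"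
    and g: "\<And>k. k > 0 \<Longrightarrow> ((\<lambda>w. f w k) \<longlongrightarrow> g k) F"
  shows "((\<lambda>w. c w * hankel_det n (f w)) \<longlongrightarrow> hankel_det (n - 1) (\<lambda>k. g (k + 2))) F"
proof -
  define h where "h = (\<lambda>w (i,j). if i = 0 then c w * f w j else f w (i + j))"
  define h0 where "h0 = (\<lambda>(i,j::nat). if i = 0 then (if j = 0 then 1 else 0) else g (i + j))"
  have "c w * hankel_det n (f w) = Determinant.det (Matrix.mat n n (h w))" for w
  proof -
    have "c w * (\<Prod>i = 0..<n. f w (i + p i)) = (\<Prod>i = 0..<n. h w (i, p i))" for p
      using \<open>n > 0\<close> by (simp add: prod.atLeast_Suc_lessThan h_def mult_ac)
    then show ?thesis
      unfolding hankel_det_def det_mat_permutations prod.case sum_distrib_left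
      by (intro sum.cong refl) (metis mult.left_commute)
  qed
  moreover have "((\<lambda>w. Determinant.det (Matrix.mat n n (h w))) \<longlongrightarrow> Determinant.det (Matrix.mat n n h0)) F"
  proof (rule tendsto_det_mat)
    fix i j assume "i < n" "j < n"
    show "((\<lambda>x. h x (i, j)) \<longlongrightarrow> h0 (i, j)) F"
    proof (cases "i = 0")
      case True
      then show ?thesis
        using assms(2) tendsto_mult[OF c g[of j]] by (auto simp: h_def h0_def)
    qed (auto simp: h_def h0_def intro: g)
  qed
  moreover have "Determinant.det (Matrix.mat n n h0) = hankel_det (n - 1) (\<lambda>k. g (k + 2))"
  proof -
    let ?A = "Matrix.mat n n h0"
    have "Determinant.det ?A = (\<Sum>j<n. ?A $$ (0,j) * cofactor ?A 0 j)"
      using \<open>n > 0\<close> by (intro laplace_expansion_row) auto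
    also have "\<dots> = cofactor ?A 0 0"
      using \<open>n > 0\<close> by (simp add: h0_def if_distrib[of "\<lambda>t. t * _"] sum.delta cong: if_cong)
    also have "mat_delete ?A 0 0 = Matrix.mat (n - 1) (n - 1) (\<lambda>(i,j). g (i + j + 2))"
      by (rule eq_matI) (auto simp: mat_delete_def h0_def)
    then have "cofactor ?A 0 0 = hankel_det (n - 1) (\<lambda>k. g (k + 2))"
      by (simp add: cofactor_def hankel_det_def)
    finally show ?thesis .
  qed
  ultimately show ?thesis by simp
qed

text \<open>Multiplication on the right by the unitriangular coefficient matrix of the Newton
  polynomials \<open>p j\<close> preserves the determinant and produces the values of
  \<open>p j\<close> at \<open>x i\<close>, which are zero for \<open>i < j\<close>.\<close>

lemma vandermonde_det:
  fixes x :: "nat \<Rightarrow> 'a::idom"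
  shows "Determinant.det (Matrix.mat n n (\<lambda>(i,j). x i ^ j)) = (\<Prod>j = 0..<n. \<Prod>i = 0..<j. x j - x i)"
proof -
  define p where "p = (\<lambda>j. \<Prod>l = 0..<j. [:- x l, 1:])"
  have deg: "degree (p j) = j" for j
    by (simp add: p_def degree_prod_sum_eq)
  have lead: "coeff (p j) j = 1" for j
    using lead_coeff_prod[of "\<lambda>l. [:- x l, 1:]" "{0..<j}"] deg[of j] by (simp add: p_def)
  have ev: "poly (p j) t = (\<Prod>l = 0..<j. t - x l)" for j t
    by (simp add: p_def poly_prod)
  let ?X = "Matrix.mat n n (\<lambda>(i,j). x i ^ j)"
  let ?U = "Matrix.mat n n (\<lambda>(i,j). coeff (p j) i)"
  have prod: "?X * ?U = Matrix.mat n n (\<lambda>(i,j). poly (p j) (x i))"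
  proof (rule eq_matI)
    fix i j assume "i < dim_row (Matrix.mat n n (\<lambda>(i,j). poly (p j) (x i)))" "j < dim_col (Matrix.mat n n (\<lambda>(i,j). poly (p j) (x i)))"
    then have ij: "i < n" "j < n" by auto
    have "(\<Sum>k = 0..<n. x i ^ k * coeff (p j) k) = (\<Sum>k\<le>j. coeff (p j) k * x i ^ k)"
      using ij deg[of j] by (intro sum.mono_neutral_cong_right) (auto simp: coeff_eq_0 mult_ac)
    then show "(?X * ?U) $$ (i, j) = Matrix.mat n n (\<lambda>(i,j). poly (p j) (x i)) $$ (i, j)"
      using ij by (simp add: scalar_prod_def poly_altdef deg)
  qed auto
  have "Determinant.det ?U = 1"
    by (subst det_upper_triangular[of _ n])
       (auto simp: upper_triangular_def coeff_eq_0 deg lead prod_list_diag_prod)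
  then have "Determinant.det ?X = Determinant.det (?X * ?U)"
    by (simp add: det_mult[of _ n])
  also have "\<dots> = (\<Prod>j = 0..<n. poly (p j) (x j))"
    unfolding prod by (subst det_lower_triangular[of n]) (auto simp: ev prod_list_diag_prod prod_zero_iff)
  finally show ?thesis by (simp add: ev)
qed

section \<open>Quasi-periodic functions on an annulus\<close>

locale nome =
  fixes Q :: complex
  assumes Q_nonzero: "Q \<noteq> 0" and norm_Q_less_1: "norm Q < 1"
begin

text \<open>Two adjacent fundamental domains of \<open>w \<mapsto> Q w\<close>: the step by
  \<open>Q\<close> maps the outer half, where the norm exceeds 1, into the inner half, and 1 is the
  only power of \<open>Q\<close> inside. Functional equations are therefore stated for the outer
  half.\<close>

definition ann :: "complex set" where
  "ann = {w. norm Q < norm w \<and> norm w < 1 / norm Q}"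

lemma norm_Q_pos: "norm Q > 0"
  using Q_nonzero by simp

lemma one_less_inv_norm_Q: "1 < 1 / norm Q"
  using Q_nonzero norm_Q_less_1 by simp

lemma open_ann: "open ann"
  unfolding ann_def by (intro open_Collect_conj open_Collect_less continuous_intros)

lemma connected_ann: "connected ann"
  using connected_annulus(1)[of "norm Q" "0::complex" "1 / norm Q"] by (simp add: ann_def)

lemma one_in_ann: "1 \<in> ann"
  using norm_Q_less_1 one_less_inv_norm_Q by (simp add: ann_def)

lemma ann_nonzero: "w \<in> ann \<Longrightarrow> w \<noteq> 0"
  by (auto simp: ann_def)

lemma ann_mult_Q:
  assumes "1 < norm w" "norm w < 1 / norm Q"
  shows "w \<in> ann" "Q * w \<in> ann"
proof -
  show "w \<in> ann" using assms norm_Q_less_1 by (simp add: ann_def)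
  have "norm Q * norm w < 1" using assms norm_Q_pos by (simp add: field_simps)
  moreover have "norm Q < norm Q * norm w" using assms norm_Q_pos by simp
  ultimately show "Q * w \<in> ann"
    using one_less_inv_norm_Q by (simp add: ann_def norm_mult)
qed

text \<open>In the coordinate \<open>u = ln w\<close> the modulus of \<open>f (exp u) * exp (- \<alpha> u)\<close> is doubly periodic
  for a suitable real \<open>\<alpha>\<close>, so the maximum modulus principle applies.\<close>

lemma quasi_periodic_is_monomial:
  assumes holf: "f holomorphic_on ann" and "l \<noteq> 0"
    and qp: "\<And>w. 1 < norm w \<Longrightarrow> norm w < 1 / norm Q \<Longrightarrow> f (Q * w) = l * f w"
  obtains c and n :: int where "\<And>w. w \<in> ann \<Longrightarrow> f w = c * w powi n" "c = 0 \<or> l = Q powi n"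
proof -
  define t where "t = - ln (norm Q)"
  have t: "t > 0" using norm_Q_less_1 norm_Q_pos by (simp add: t_def)
  \<comment> \<open>Chosen so that the exponential compensates the factor \<open>norm l\<close>
    gained by \<open>f\<close> under \<open>w \<mapsto> Q w\<close>: \<open>norm Q\<close> to the
    power \<open>\<alpha>\<close> is \<open>norm l\<close>.\<close>
  define \<alpha> where "\<alpha> = ln (norm l) / ln (norm Q)"
  define h where "h = (\<lambda>u. f (exp u) * exp (- of_real \<alpha> * u))"
  define S where "S = {u::complex. -t < Re u \<and> Re u < t}"
  have expS: "exp u \<in> ann" if "u \<in> S" for u
  proof -
    have "exp (-t) = norm Q" "exp t = 1 / norm Q"
      using norm_Q_pos by (auto simp: t_def exp_minus divide_simps)
    moreover have "exp (-t) < exp (Re u)" "exp (Re u) < exp t"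
      using that unfolding exp_less_cancel_iff by (auto simp: S_def)
    ultimately show ?thesis by (simp add: ann_def)
  qed
  have S: "open S" "connected S"
  proof -
    show "open S" unfolding S_def by (intro open_Collect_conj open_Collect_less continuous_intros)
    have "S = {u. -t < Re u} \<inter> {u. Re u < t}" by (auto simp: S_def)
    then show "connected S"
      using convex_halfspace_Re_gt convex_halfspace_Re_lt by (metis convex_Int convex_connected)
  qed
  have holh: "h holomorphic_on S"
    unfolding h_def
    by (intro holomorphic_intros holomorphic_on_compose_gen[of exp S f ann, unfolded o_def] holf)
       (use expS in auto)
  have per1: "norm (h (u + of_int k * (2 * pi) * \<i>)) = norm (h u)" for u and k :: int
  proof -
    have "exp (u + of_int k * (2 * pi) * \<i>) = exp u"
      using exp_plus_2pin[of u k] by (simp add: mult_ac)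
    moreover have "Re (of_real \<alpha> * (u + of_int k * (2 * pi) * \<i>)) = Re (of_real \<alpha> * u)"
      by simp
    ultimately show ?thesis by (simp add: h_def norm_mult)
  qed
  have per2: "norm (h (u + Ln Q)) = norm (h u)" if "0 < Re u" "Re u < t" for u
  proof -
    have "exp (Re u) > 1" "exp (Re u) < 1 / norm Q"
      using that norm_Q_pos by (auto simp: t_def) (metis exp_less_cancel_iff exp_minus exp_ln inverse_eq_divide norm_Q_pos)
    then have a1: "f (Q * exp u) = l * f (exp u)" by (intro qp) auto
    have a2: "exp (u + Ln Q) = Q * exp u" using Q_nonzero by (simp add: exp_add)
    have a3: "exp (- (\<alpha> * Re (Ln Q))) * norm l = 1"
    proof -
      have "\<alpha> * Re (Ln Q) = ln (norm l)"
        using Q_nonzero t by (simp add: \<alpha>_def t_def)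
      then show ?thesis using \<open>l \<noteq> 0\<close> by (simp add: exp_minus)
    qed
    have a4: "norm (exp (- of_real \<alpha> * (u + Ln Q))) = exp (- \<alpha> * Re u) * exp (- (\<alpha> * Re (Ln Q)))"
      unfolding norm_exp_eq_Re by (simp add: exp_add [symmetric] algebra_simps)
    have "norm (h (u + Ln Q)) = norm (f (exp u)) * exp (- \<alpha> * Re u) * (exp (- (\<alpha> * Re (Ln Q))) * norm l)"
      using a1 a2 a4 by (simp only: h_def norm_mult mult_ac)
    also have "\<dots> = norm (h u)" using a3
      by (simp add: h_def norm_mult)
    finally show ?thesis .
  qed
  have ReLn: "Re (Ln Q) = -t" using Q_nonzero by (simp add: t_def)
  \<comment> \<open>A compact cell for the periods \<open>2 * pi * \<i>\<close> and
    \<open>Ln Q\<close>, the latter of real part \<open>-t\<close>. By \<open>per1\<close> and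
    \<open>per2\<close> the maximum of \<open>norm h\<close> over \<open>K\<close> bounds it on the
    open strip \<open>S\<close>, so it is an interior maximum.\<close>
  define K where "K = cbox (Complex (-t/2) 0) (Complex (t/2) (2*pi))"
  have "K \<subseteq> S" using t by (auto simp: K_def S_def in_cbox_complex_iff)
  moreover have "K \<noteq> {}" using t by (auto simp: K_def box_ne_empty(1) Basis_complex_def)
  ultimately obtain u0 where u0: "u0 \<in> K" "\<And>u. u \<in> K \<Longrightarrow> norm (h u) \<le> norm (h u0)"
    using continuous_attains_sup[of K "\<lambda>u. norm (h u)"] holomorphic_on_imp_continuous_on[OF holh]
    by (metis K_def compact_cbox continuous_on_norm continuous_on_subset)
  have max1: "norm (h u) \<le> norm (h u0)" if "-t/2 \<le> Re u" "Re u \<le> t/2" for u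
  proof -
    define k where "k = - \<lfloor>Im u / (2*pi)\<rfloor>"
    have "0 \<le> frac (Im u / (2*pi))" "frac (Im u / (2*pi)) \<le> 1" by (auto intro: less_imp_le frac_lt_1)
    then have "0 \<le> frac (Im u / (2*pi)) * (2*pi)" "frac (Im u / (2*pi)) * (2*pi) \<le> 2*pi" by auto
    moreover have "frac (Im u / (2*pi)) * (2*pi) = Im u + of_int k * (2*pi)"
      by (simp add: frac_def k_def field_simps)
    ultimately have "u + of_int k * (2 * pi) * \<i> \<in> K"
      using that by (simp add: K_def in_cbox_complex_iff)
    from u0(2)[OF this] per1[of u k] show ?thesis by simp
  qed
  have max: "norm (h u) \<le> norm (h u0)" if "u \<in> S" for u
  proof -
    consider "Re u > t/2" | "Re u < -t/2" | "-t/2 \<le> Re u" "Re u \<le> t/2" by linarith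
    then show ?thesis
    proof cases
      case 1
      then show ?thesis
        using per2[of u] max1[of "u + Ln Q"] that t ReLn by (auto simp: S_def)
    next
      case 2
      then show ?thesis
        using per2[of "u - Ln Q"] max1[of "u - Ln Q"] that t ReLn by (auto simp: S_def)
    qed (rule max1)
  qed
  have "h constant_on S"
    using maximum_modulus_principle[OF holh S S(1) order_refl _ max] u0(1) \<open>K \<subseteq> S\<close> by blast
  then obtain c where c: "\<And>u. u \<in> S \<Longrightarrow> h u = c"
    by (auto simp: constant_on_def)
  have fexp: "f (exp u) = c * exp (of_real \<alpha> * u)" if "u \<in> S" for u
    using c[OF that] by (simp add: h_def exp_minus field_simps)
  have LnS: "Ln w \<in> S" if "w \<in> ann" for w
  proof -
    have "ln (norm Q) < ln (norm w)" "ln (norm w) < ln (1 / norm Q)"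
      using that norm_Q_pos by (auto simp: ann_def intro!: ln_less_cancel_iff[THEN iffD2])
    moreover have "ln (1 / norm Q) = t" using norm_Q_pos by (simp add: t_def ln_div)
    ultimately show ?thesis
      using ann_nonzero[OF that] by (simp add: S_def t_def)
  qed
  show ?thesis
  proof (cases "c = 0")
    case True
    have "f w = 0 * w powi 0" if "w \<in> ann" for w
      using fexp[OF LnS[OF that]] ann_nonzero[OF that] True by simp
    then show ?thesis using that by blast
  next
    case False
    \<comment> \<open>Both points have the exponential 1, so a nonzero \<open>c\<close> forces
      \<open>\<alpha>\<close> to be an integer.\<close>
    have "0 \<in> S" "2 * pi * \<i> \<in> S" using t by (auto simp: S_def)
    then have "exp (of_real \<alpha> * (2 * pi * \<i>)) = 1"
      using fexp[of 0] fexp[of "2 * pi * \<i>"] False by (simp add: mult_ac)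
    then obtain n :: int where "\<alpha> * (2 * pi) = of_int (2 * n) * pi"
      unfolding exp_eq_1 by auto
    then have n: "\<alpha> = of_int n" by simp
    have expn: "exp (of_real \<alpha> * u) = exp u powi n" for u :: complex
      by (simp add: n exp_power_int)
    have eq: "f w = c * w powi n" if "w \<in> ann" for w
      using fexp[OF LnS[OF that]] ann_nonzero[OF that] by (simp add: expn)
    obtain x where x: "1 < x" "x < 1 / norm Q" using dense[OF one_less_inv_norm_Q] by blast
    define w0 where "w0 = complex_of_real x"
    have w0: "1 < norm w0" "norm w0 < 1 / norm Q" using x by (simp_all add: w0_def)
    have "c * (Q * w0) powi n = l * (c * w0 powi n)"
      using qp[OF w0] eq ann_mult_Q[OF w0] by simp
    then have "l = Q powi n"
      using False w0 by (auto simp: power_int_mult_distrib)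
    with eq that show ?thesis by blast
  qed
qed

corollary quasi_periodic_eq_0:
  assumes "f holomorphic_on ann" and "l \<noteq> 0" "\<And>n::int. l \<noteq> Q powi n" "w \<in> ann"
    and "\<And>w. 1 < norm w \<Longrightarrow> norm w < 1 / norm Q \<Longrightarrow> f (Q * w) = l * f w"
  shows "f w = 0"
proof -
  obtain c and n :: int where "\<And>w. w \<in> ann \<Longrightarrow> f w = c * w powi n" "c = 0 \<or> l = Q powi n"
    using quasi_periodic_is_monomial[of f l] assms(1,2,5) by blast
  with assms(3,4) show ?thesis by simp
qed

corollary quasi_periodic_eq_power:
  assumes "f holomorphic_on ann" "w \<in> ann"
    and "\<And>w. 1 < norm w \<Longrightarrow> norm w < 1 / norm Q \<Longrightarrow> f (Q * w) = Q ^ n * f w"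
  shows "f w = f 1 * w ^ n"
proof -
  obtain c and k :: int where c: "\<And>w. w \<in> ann \<Longrightarrow> f w = c * w powi k" "c = 0 \<or> Q ^ n = Q powi k"
    using quasi_periodic_is_monomial[of f "Q ^ n"] assms Q_nonzero by (metis power_not_zero)
  show ?thesis
  proof (cases "c = 0")
    case False
    then have "norm Q powi int n = norm Q powi k"
      using c(2) by (metis norm_power norm_power_int power_int_of_nat)
    then have "k = int n"
      using norm_Q_pos norm_Q_less_1 power_int_strict_decreasing[of k "int n" "norm Q"]
        power_int_strict_decreasing[of "int n" k "norm Q"] by (metis less_irrefl linorder_neqE)
    then show ?thesis using c(1)[OF assms(2)] c(1)[OF one_in_ann] by simp
  qed (use c(1)[OF assms(2)] c(1)[OF one_in_ann] in simp)
qed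

end

section \<open>The theta function\<close>

context nome begin

lemma Q_power_neq_1: "n > 0 \<Longrightarrow> Q ^ n \<noteq> 1"
  using norm_Q_less_1 power_less_one_iff[of "norm Q" n] by (metis norm_ge_zero norm_one norm_power less_irrefl)

text \<open>The recursion that \<open>f w = (1 - w) * f (Q * w)\<close> with \<open>f 0 = 1\<close>
  imposes on power series coefficients. Its solution is \<open>(-1)^n Q^(n(n-1)/2)\<close> divided
  by the product of \<open>1 - Q^i\<close> for \<open>1 \<le> i \<le> n\<close>.\<close>

primrec euler_coeff :: "nat \<Rightarrow> complex" where
  "euler_coeff 0 = 1"
| "euler_coeff (Suc n) = - euler_coeff n * Q ^ n / (1 - Q ^ Suc n)"

text \<open>The infinite product \<open>\<Prod>n\<ge>0. 1 - Q\<^sup>n w\<close>, through Euler's power series expansion.\<close>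
definition euler_fn :: "complex \<Rightarrow> complex" where
  "euler_fn w = (\<Sum>n. euler_coeff n * w ^ n)"

lemma summable_euler: "summable (\<lambda>n. euler_coeff n * w ^ n)"
proof -
  have "(\<lambda>n. norm Q ^ n * (norm w / (1 - norm Q))) \<longlonglongrightarrow> 0 * (norm w / (1 - norm Q))"
    by (intro tendsto_mult LIMSEQ_power_zero tendsto_const) (use norm_Q_less_1 in auto)
  then have "eventually (\<lambda>n. norm Q ^ n * (norm w / (1 - norm Q)) < 1/2) sequentially"
    by (rule order_tendstoD(2)) simp
  then obtain N where N: "\<And>n. n \<ge> N \<Longrightarrow> norm Q ^ n * (norm w / (1 - norm Q)) < 1/2"
    by (auto simp: eventually_sequentially)
  show ?thesis
  proof (rule summable_ratio_test[of "1/2" N])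
    fix n assume "n \<ge> N"
    have "1 - norm Q \<le> norm (1 - Q ^ Suc n)"
    proof -
      have "norm (Q ^ Suc n) \<le> norm Q"
        using norm_Q_less_1 by (simp add: norm_mult norm_power mult_left_le power_le_one)
      then show ?thesis using norm_triangle_ineq2[of 1 "Q ^ Suc n"] by simp
    qed
    then have "norm w / norm (1 - Q ^ Suc n) \<le> norm w / (1 - norm Q)"
      using norm_Q_less_1 by (intro divide_left_mono mult_pos_pos) auto
    moreover have "norm (euler_coeff (Suc n) * w ^ Suc n) =
        norm (euler_coeff n * w ^ n) * (norm Q ^ n * (norm w / norm (1 - Q ^ Suc n)))"
      by (simp add: norm_mult norm_divide norm_power mult_ac)
    ultimately have "norm (euler_coeff (Suc n) * w ^ Suc n) \<le>
        norm (euler_coeff n * w ^ n) * (norm Q ^ n * (norm w / (1 - norm Q)))"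
      by (simp only:) (intro mult_left_mono, auto)
    also have "\<dots> \<le> norm (euler_coeff n * w ^ n) * (1/2)"
      using N[OF \<open>n \<ge> N\<close>] by (intro mult_left_mono) auto
    finally show "norm (euler_coeff (Suc n) * w ^ Suc n) \<le> 1/2 * norm (euler_coeff n * w ^ n)" by simp
  qed simp
qed

lemma euler_fn_0: "euler_fn 0 = 1"
  by (simp add: euler_fn_def)

lemma holomorphic_euler_fn: "euler_fn holomorphic_on S"
proof -
  have "euler_fn holomorphic_on ball 0 r" for r
    by (rule power_series_holomorphic[of _ _ euler_coeff])
       (use summable_euler in \<open>auto simp: euler_fn_def summable_sums\<close>)
  then have "euler_fn field_differentiable at z" for z
    by (metis centre_in_ball dist_norm holomorphic_on_open field_differentiable_def open_ball
        mem_ball_0 gt_ex)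
  then show ?thesis
    by (simp add: holomorphic_on_def field_differentiable_at_within)
qed

lemma euler_fn_step: "euler_fn w = (1 - w) * euler_fn (Q * w)"
proof -
  have a: "(\<lambda>n. euler_coeff (Suc n) * w ^ Suc n) sums (euler_fn w - 1)" for w
    using summable_sums[OF summable_euler[of w]] sums_Suc_iff[of "\<lambda>n. euler_coeff n * w ^ n"]
    by (simp add: euler_fn_def)
  have b: "(\<lambda>n. w * (euler_coeff n * (Q * w) ^ n)) sums (w * euler_fn (Q * w))"
    using summable_sums[OF summable_euler[of "Q*w"]] by (intro sums_mult) (simp add: euler_fn_def)
  have "(\<lambda>n. euler_coeff (Suc n) * (Q * w) ^ Suc n - w * (euler_coeff n * (Q * w) ^ n))
           sums (euler_fn (Q * w) - 1 - w * euler_fn (Q * w))"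
    by (intro sums_diff a b)
  also have "(\<lambda>n. euler_coeff (Suc n) * (Q * w) ^ Suc n - w * (euler_coeff n * (Q * w) ^ n)) =
             (\<lambda>n. euler_coeff (Suc n) * w ^ Suc n)"
  proof
    fix n
    have "euler_coeff n * Q ^ n = - euler_coeff (Suc n) * (1 - Q ^ Suc n)"
      using Q_power_neq_1[of "Suc n"] by (simp del: power_Suc)
    moreover have "w * (euler_coeff n * (Q * w) ^ n) = (euler_coeff n * Q ^ n) * w ^ Suc n"
      by (simp add: power_mult_distrib mult_ac)
    ultimately have "w * (euler_coeff n * (Q * w) ^ n) = - euler_coeff (Suc n) * (1 - Q ^ Suc n) * w ^ Suc n"
      by simp
    then show "euler_coeff (Suc n) * (Q * w) ^ Suc n - w * (euler_coeff n * (Q * w) ^ n) =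
             euler_coeff (Suc n) * w ^ Suc n"
      by (simp add: power_mult_distrib algebra_simps del: euler_coeff.simps)
  qed
  finally have "euler_fn w - 1 = euler_fn (Q * w) - 1 - w * euler_fn (Q * w)"
    using a sums_unique2 by blast
  then show ?thesis by (simp add: algebra_simps)
qed

lemma euler_fn_prod: "euler_fn w = (\<Prod>k<n. 1 - Q ^ k * w) * euler_fn (Q ^ n * w)"
proof (induction n)
  case (Suc n)
  then show ?case using euler_fn_step[of "Q ^ n * w"] by (simp add: mult_ac)
qed simp

lemma euler_fn_tail: "(\<lambda>n. euler_fn (Q ^ n * w)) \<longlonglongrightarrow> 1"
proof -
  have "continuous_on UNIV euler_fn"
    using holomorphic_euler_fn holomorphic_on_imp_continuous_on by blast
  then have "isCont euler_fn (0 * w)" by (simp add: continuous_on_eq_continuous_at)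
  moreover have "(\<lambda>n. Q ^ n * w) \<longlonglongrightarrow> 0 * w"
    using norm_Q_less_1 by (intro tendsto_mult LIMSEQ_power_zero tendsto_const)
  ultimately have "(\<lambda>n. euler_fn (Q ^ n * w)) \<longlonglongrightarrow> euler_fn (0 * w)"
    by (rule isCont_tendsto_compose)
  then show ?thesis by (simp add: euler_fn_0)
qed

text \<open>A zero would propagate to every \<open>Q ^ n * w\<close>, since no factor of the finite
  product vanishes, and contradict the limit 1 along that orbit.\<close>

lemma euler_fn_nonzero:
  assumes "\<And>n. Q ^ n * w \<noteq> 1"
  shows "euler_fn w \<noteq> 0"
proof
  assume "euler_fn w = 0"
  then have "euler_fn (Q ^ n * w) = 0" for n
  proof -
    have "1 - Q ^ k * w \<noteq> 0" for k using assms[of k] by simp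
    then show ?thesis using euler_fn_prod[of w n] \<open>euler_fn w = 0\<close> by simp
  qed
  then show False using euler_fn_tail[of w] by (simp add: LIMSEQ_const_iff)
qed

lemma LIMSEQ_euler_fn: "(\<lambda>n. \<Prod>k<n. 1 - Q ^ k * w) \<longlonglongrightarrow> euler_fn w"
proof -
  have "eventually (\<lambda>n. euler_fn (Q ^ n * w) \<noteq> 0) sequentially"
    by (rule tendsto_imp_eventually_ne[OF euler_fn_tail]) simp
  then have "eventually (\<lambda>n. euler_fn w / euler_fn (Q ^ n * w) = (\<Prod>k<n. 1 - Q ^ k * w)) sequentially"
    by eventually_elim (metis euler_fn_prod nonzero_mult_div_cancel_right)
  moreover have "(\<lambda>n. euler_fn w / euler_fn (Q ^ n * w)) \<longlonglongrightarrow> euler_fn w / 1"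
    by (intro tendsto_divide euler_fn_tail tendsto_const) simp
  ultimately show ?thesis by (simp add: tendsto_cong)
qed

text \<open>Jacobi's theta function in multiplicative form: the two products of the triple product
  that depend on \<open>w\<close>, without the constant product \<open>euler_fn Q\<close>.\<close>

definition theta :: "complex \<Rightarrow> complex" where
  "theta w = euler_fn w * euler_fn (Q / w)"

lemma holomorphic_theta: "0 \<notin> S \<Longrightarrow> theta holomorphic_on S"
  unfolding theta_def
  by (intro holomorphic_intros holomorphic_euler_fn
       holomorphic_on_compose_gen[of "\<lambda>w. Q / w" S euler_fn UNIV, unfolded o_def]) auto

lemma isCont_theta:
  assumes "w \<noteq> 0" shows "isCont theta w"
  using holomorphic_on_imp_continuous_on[OF holomorphic_theta[of "-{0}"]] assms
  by (simp add: continuous_on_eq_continuous_at[OF open_Compl[OF closed_singleton]])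

lemma theta_mult_Q:
  assumes "w \<noteq> 0"
  shows "theta (Q * w) = - theta w / w"
proof -
  have "theta (Q * w) = euler_fn (Q * w) * euler_fn (1 / w)"
    using Q_nonzero by (simp add: theta_def)
  also have "euler_fn (1 / w) = (1 - 1 / w) * euler_fn (Q / w)"
    using euler_fn_step[of "1 / w"] by simp
  also have "euler_fn (Q * w) * ((1 - 1 / w) * euler_fn (Q / w)) =
      - ((1 - w) * euler_fn (Q * w) * euler_fn (Q / w)) / w"
    using assms by (simp add: field_simps)
  finally show ?thesis by (simp add: theta_def euler_fn_step[of w, symmetric])
qed

lemma theta_mult_Q_power:
  assumes "w \<noteq> 0"
  shows "theta (Q ^ n * w) = (- 1) ^ n * theta w / (w ^ n * Q ^ (n * (n - 1) div 2))"
proof (induction n)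
  case (Suc n)
  have "Suc n * n div 2 = n + n * (n - 1) div 2"
    by (cases n) auto
  with Suc show ?case
    using theta_mult_Q[of "Q ^ n * w"] assms Q_nonzero by (simp add: power_add mult_ac)
qed simp

definition theta_reg :: "complex \<Rightarrow> complex" where
  "theta_reg w = euler_fn (Q * w) * euler_fn (Q / w)"

lemma theta_eq_reg: "theta w = (1 - w) * theta_reg w"
  using euler_fn_step[of w] by (simp add: theta_def theta_reg_def)

lemma isCont_theta_reg: "isCont theta_reg 1"
proof -
  have E: "isCont euler_fn w" for w
    using holomorphic_on_imp_continuous_on[OF holomorphic_euler_fn[of UNIV]]
    by (simp add: continuous_on_eq_continuous_at)
  have "isCont (\<lambda>w. euler_fn (Q * w)) 1"
    by (rule isCont_o2[OF _ E]) (intro continuous_intros)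
  moreover have "isCont (\<lambda>w. euler_fn (Q / w)) 1"
    by (rule isCont_o2[OF _ E]) (intro continuous_intros, simp)
  ultimately show ?thesis
    unfolding theta_reg_def by (rule continuous_mult)
qed

text \<open>Minus the derivative of \<open>theta\<close> at 1, by \<open>theta_eq_reg\<close>; it
  normalises the comparisons of leading terms at 1.\<close>

definition kappa :: complex where "kappa = euler_fn Q ^ 2"

lemma theta_reg_1: "theta_reg 1 = kappa"
  by (simp add: theta_reg_def kappa_def power2_eq_square)

lemma kappa_nonzero: "kappa \<noteq> 0"
proof -
  have "Q ^ n * Q \<noteq> 1" for n using Q_power_neq_1[of "Suc n"] by (simp add: mult.commute)
  then show ?thesis using euler_fn_nonzero[of Q] by (simp add: kappa_def)
qed

lemma theta_eq_0D:
  assumes "theta w = 0" "w \<noteq> 0"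
  obtains n :: int where "w = Q powi n"
proof -
  have "euler_fn w = 0 \<or> euler_fn (Q / w) = 0" using assms(1) by (simp add: theta_def)
  then have "(\<exists>n. Q ^ n * w = 1) \<or> (\<exists>n. Q ^ n * (Q / w) = 1)"
    using euler_fn_nonzero[of w] euler_fn_nonzero[of "Q / w"] by auto
  then consider n where "Q ^ n * w = 1" | n where "Q ^ n * (Q / w) = 1" by auto
  then show ?thesis
  proof cases
    case 1
    then have "w = Q powi (- int n)"
      using Q_nonzero by (simp add: power_int_minus field_simps)
    then show ?thesis using that by blast
  next
    case 2
    then have "w = Q ^ Suc n"
      using Q_nonzero assms by (simp add: field_simps)
    then have "w = Q powi int (Suc n)" by (simp only: power_int_of_nat)
    then show ?thesis using that by blast
  qed
qed

end

section \<open>Gauss's product for the triangular series\<close>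

text \<open>Shanks' finite form; the sum telescopes through \<open>G\<close>.\<close>

lemma shanks_finite_sum:
  fixes q :: complex and P :: "nat \<Rightarrow> complex"
  assumes ne: "\<And>n. n > 0 \<Longrightarrow> q ^ n \<noteq> 1"
    and P0: "P 0 = 1" and P_Suc: "\<And>n. P (Suc n) = P n * (1 - q ^ (2 * n + 2)) / (1 - q ^ (2 * n + 1))"
  shows "(\<Sum>s<2*n. q ^ (s * (s + 1) div 2)) = (\<Sum>s<n. P n / P s * q ^ (s * (2 * n + 1)))"
proof (induction n)
  case (Suc n)
  have ne': "1 - q ^ (2 * n + 2) \<noteq> 0" "1 - q ^ (2 * n + 1) \<noteq> 0" for n
    using ne[of "2 * n + 2"] ne[of "2 * n + 1"] by auto
  have Pnz: "P n \<noteq> 0" for n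
    by (induction n) (use ne' in \<open>auto simp: P0 P_Suc simp del: power_Suc\<close>)
  define x where "x = q ^ (2 * n + 1)"
  have x1: "1 - x \<noteq> 0" using ne' by (simp add: x_def)
  \<comment> \<open>An antidifference in \<open>s\<close>: the change of the \<open>s\<close>-th
    term from \<open>n\<close> to \<open>n + 1\<close> is \<open>P n / (1 - x)\<close> times a
    difference of \<open>G\<close>. The factor \<open>1 - q ^ (2 * s)\<close> makes
    \<open>G 0\<close> vanish.\<close>
  define G where "G = (\<lambda>s. 1 / P s * (1 - q ^ (2 * s)) * x ^ s)"
  have step: "P (Suc n) / P s * q ^ (s * (2 * Suc n + 1)) - P n / P s * q ^ (s * (2 * n + 1)) =
      P n / (1 - x) * (G (Suc s) - G s)" for s
  proof -
    have G: "G (Suc s) = 1 / P s * (1 - q ^ (2 * s + 1)) * x ^ Suc s"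
      unfolding G_def P_Suc using ne'[of s] Pnz[of s] by (simp add: field_simps del: power_Suc)
    have e1: "q ^ (s * (2 * n + 1)) = x ^ s"
      unfolding x_def by (metis mult.commute power_mult)
    have e2: "q ^ (s * (2 * Suc n + 1)) = x ^ s * q ^ (2 * s)"
      unfolding e1[symmetric] by (simp add: power_add [symmetric] algebra_simps)
    have e3: "q ^ (2 * n + 2) = x * q" by (simp add: x_def mult_ac)
    have e4: "q ^ (2 * s + 1) = q ^ (2 * s) * q" by simp
    show ?thesis
      unfolding G unfolding P_Suc G_def e1 e2 e3 e4 x_def[symmetric] using x1 Pnz[of s] Pnz[of n]
      by (simp add: divide_simps) (simp add: algebra_simps)
  qed
  have "(\<Sum>s<n. P (Suc n) / P s * q ^ (s * (2 * Suc n + 1))) - (\<Sum>s<n. P n / P s * q ^ (s * (2 * n + 1)))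
       = P n / (1 - x) * (\<Sum>s<n. G (Suc s) - G s)"
    unfolding sum_subtractf[symmetric] step sum_distrib_left ..
  also have "(\<Sum>s<n. G (Suc s) - G s) = G n - G 0" by (rule sum_lessThan_telescope)
  finally have "(\<Sum>s<Suc n. P (Suc n) / P s * q ^ (s * (2 * Suc n + 1))) =
      (\<Sum>s<n. P n / P s * q ^ (s * (2 * n + 1))) + (P n / (1 - x) * (G n - G 0)
        + P (Suc n) / P n * q ^ (n * (2 * Suc n + 1)))"
    by (simp add: algebra_simps)
  \<comment> \<open>The boundary term and the new term \<open>s = n\<close> combine to the two
    missing triangular powers: \<open>n (2 n + 1)\<close> and \<open>(n + 1) (2 n + 1)\<close> are
    the triangular numbers of index \<open>2 n\<close> and \<open>2 n + 1\<close>.\<close>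
  also have "P n / (1 - x) * (G n - G 0) + P (Suc n) / P n * q ^ (n * (2 * Suc n + 1)) = x ^ n + x ^ Suc n"
  proof -
    have e2: "q ^ (n * (2 * Suc n + 1)) = x ^ n * q ^ (2 * n)"
      unfolding x_def power_mult [symmetric] power_add [symmetric] by (simp add: algebra_simps)
    have e3: "q ^ (2 * n + 2) = x * q" by (simp add: x_def mult_ac)
    have e4: "x = q ^ (2 * n) * q" by (simp add: x_def)
    have "P n / (1 - x) * (G n - G 0) = (1 - q ^ (2 * n)) * x ^ n / (1 - x)"
      using Pnz[of n] by (simp add: G_def)
    moreover have "P (Suc n) / P n * q ^ (n * (2 * Suc n + 1)) = (1 - x * q) / (1 - x) * (x ^ n * q ^ (2 * n))"
      unfolding e2 P_Suc e3 x_def[symmetric] using Pnz[of n] by simp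
    moreover have "(1 - q ^ (2 * n)) * x ^ n / (1 - x) + (1 - x * q) / (1 - x) * (x ^ n * q ^ (2 * n)) =
        x ^ n * (1 - x * x) / (1 - x)"
      using x1 by (simp add: divide_simps) (simp add: e4 algebra_simps)
    moreover have "x ^ n * (1 - x * x) / (1 - x) = x ^ n + x ^ Suc n"
      using x1 by (simp add: divide_simps) (simp add: algebra_simps)
    ultimately show ?thesis by (simp only:)
  qed
  also have "x ^ n = q ^ (2 * n * (2 * n + 1) div 2)"
  proof -
    have "2 * n * (2 * n + 1) div 2 = (2 * n + 1) * n" by simp
    then show ?thesis by (simp only: x_def power_mult)
  qed
  also have "x ^ Suc n = q ^ ((2 * n + 1) * (2 * n + 1 + 1) div 2)"
  proof -
    have "(2 * n + 1) * (2 * n + 1 + 1) = 2 * ((2 * n + 1) * Suc n)" by simp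
    then have "(2 * n + 1) * (2 * n + 1 + 1) div 2 = (2 * n + 1) * Suc n"
      by (metis nonzero_mult_div_cancel_left zero_neq_numeral)
    then show ?thesis by (simp only: x_def power_mult)
  qed
  finally show ?case using Suc by simp
qed simp

lemma summable_triangle_series:
  fixes q :: complex
  assumes q: "norm q < 1"
  shows "summable (\<lambda>n. q ^ (n * (n + 1) div 2))"
proof (rule summable_comparison_test'[of "\<lambda>n. norm q ^ n" 0])
  show "summable (\<lambda>n. norm q ^ n)" using q by simp
  fix n :: nat
  have "n \<le> n * (n + 1) div 2" by (cases n) (auto simp: algebra_simps)
  then show "norm (q ^ (n * (n + 1) div 2)) \<le> norm q ^ n"
    unfolding norm_power using q by (intro power_decreasing) auto
qed

text \<open>In the finite form the term \<open>s = 0\<close> is \<open>P n\<close>, which tends to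
  the product. The other terms carry \<open>q ^ (s * (2 * n + 1))\<close> with uniformly bounded
  coefficients \<open>P n / P s\<close>, so their sum tends to 0.\<close>

lemma (in nome) triangle_series_eq:
  assumes q: "q ^ 2 = Q"
  shows "triangle_series q = euler_fn Q / euler_fn q" "euler_fn q \<noteq> 0"
proof -
  have nq: "norm q < 1" 
    using norm_Q_less_1 q by (metis norm_ge_zero norm_power one_le_power not_le)
  have qne: "q ^ n \<noteq> 1" if "n > 0" for n
    using nq that power_less_one_iff[of "norm q" n] by (metis norm_ge_zero norm_one norm_power less_irrefl)
  have qpow: "q ^ (2 * n + 1) = Q ^ n * q" "q ^ (2 * n + 2) = Q ^ n * Q" for n
    using power_mult[of q 2 n] q[unfolded power2_eq_square] by (simp_all add: power_add q)
  define P where "P = (\<lambda>n. (\<Prod>k<n. 1 - Q ^ k * Q) / (\<Prod>k<n. 1 - Q ^ k * q))"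
  show Eq: "euler_fn q \<noteq> 0"
  proof (rule euler_fn_nonzero)
    fix n show "Q ^ n * q \<noteq> 1" using qne[of "2 * n + 1"] unfolding qpow by simp
  qed
  have EQ: "euler_fn Q \<noteq> 0" using kappa_nonzero by (auto simp: kappa_def)
  have P_lim: "P \<longlonglongrightarrow> euler_fn Q / euler_fn q"
    unfolding P_def by (intro tendsto_divide LIMSEQ_euler_fn Eq)
  have P0: "P 0 = 1" by (simp add: P_def)
  have P_Suc: "P (Suc n) = P n * (1 - q ^ (2 * n + 2)) / (1 - q ^ (2 * n + 1))" for n
    unfolding qpow by (simp add: P_def)
  have fin: "(\<Sum>s<2*n. q ^ (s * (s + 1) div 2)) = (\<Sum>s<n. P n / P s * q ^ (s * (2 * n + 1)))" for n
    by (rule shanks_finite_sum[OF qne P0 P_Suc])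
  have "Bseq P" using P_lim convergent_imp_Bseq convergentI by blast
  then obtain K1 where K1: "K1 > 0" "\<And>n. norm (P n) \<le> K1" by (auto simp: Bseq_def)
  have "(\<lambda>n. 1 / P n) \<longlonglongrightarrow> 1 / (euler_fn Q / euler_fn q)"
    using EQ Eq by (intro tendsto_divide P_lim tendsto_const) auto
  then have "Bseq (\<lambda>n. 1 / P n)" using convergent_imp_Bseq convergentI by blast
  then obtain K2 where K2: "K2 > 0" "\<And>n. norm (1 / P n) \<le> K2" by (auto simp: Bseq_def)
  have bound: "norm ((\<Sum>s<2*Suc n. q ^ (s * (s + 1) div 2)) - P (Suc n)) \<le> K1 * K2 * (1 / (1 - norm q)) * norm q ^ n" for n
  proof -
    have "(\<Sum>s<2*Suc n. q ^ (s * (s + 1) div 2)) - P (Suc n) =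
        (\<Sum>s<n. P (Suc n) / P (Suc s) * q ^ (Suc s * (2 * Suc n + 1)))"
      unfolding fin by (subst sum.lessThan_Suc_shift) (simp add: P0)
    also have "norm \<dots> \<le> (\<Sum>s<n. K1 * K2 * (norm q ^ n * norm q ^ s))"
    proof (rule sum_norm_le)
      fix s
      have "norm (P (Suc n) / P (Suc s)) \<le> K1 * K2"
        using K1(2)[of "Suc n"] K2(2)[of "Suc s"] K1(1) mult_mono[of "norm (P (Suc n))" K1 "norm (1 / P (Suc s))" K2]
        by (simp add: norm_divide)
      moreover have "norm q ^ (Suc s * (2 * Suc n + 1)) \<le> norm q ^ (n + s)"
        using nq by (intro power_decreasing) auto
      ultimately show "norm (P (Suc n) / P (Suc s) * q ^ (Suc s * (2 * Suc n + 1))) \<le> K1 * K2 * (norm q ^ n * norm q ^ s)"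
        unfolding norm_mult norm_power power_add[symmetric] using K1(1) K2(1)
        by (intro mult_mono) auto
    qed
    also have "\<dots> = K1 * K2 * norm q ^ n * (\<Sum>s<n. norm q ^ s)"
      by (simp add: sum_distrib_left mult_ac)
    also have "\<dots> \<le> K1 * K2 * norm q ^ n * (1 / (1 - norm q))"
      using sum_le_suminf[of "\<lambda>s. norm q ^ s" "{..<n}"] nq summable_geometric[of "norm q"] suminf_geometric[of "norm q"]
        K1(1) K2(1) by (intro mult_left_mono) auto
    finally show ?thesis by (simp add: mult_ac)
  qed
  have "(\<lambda>n. K1 * K2 * (1 / (1 - norm q)) * norm q ^ n) \<longlonglongrightarrow> 0"
    by (intro tendsto_mult_right_zero LIMSEQ_power_zero) (use nq in simp)
  then have "(\<lambda>n. (\<Sum>s<2*Suc n. q ^ (s * (s + 1) div 2)) - P (Suc n)) \<longlonglongrightarrow> 0"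
    by (rule Lim_null_comparison[OF always_eventually[OF allI[OF bound]]])
  from tendsto_add[OF this LIMSEQ_Suc[OF P_lim]]
  have lim1: "(\<lambda>n. \<Sum>s<2*Suc n. q ^ (s * (s + 1) div 2)) \<longlonglongrightarrow> euler_fn Q / euler_fn q"
    by simp
  have "(\<lambda>n. \<Sum>s<n. q ^ (s * (s + 1) div 2)) \<longlonglongrightarrow> triangle_series q"
    unfolding triangle_series_def by (rule summable_LIMSEQ[OF summable_triangle_series[OF nq]])
  then have "((\<lambda>n. \<Sum>s<n. q ^ (s * (s + 1) div 2)) \<circ> (\<lambda>n. 2 * Suc n)) \<longlonglongrightarrow> triangle_series q"
    by (rule LIMSEQ_subseq_LIMSEQ) (simp add: strict_mono_def)
  with lim1 show "triangle_series q = euler_fn Q / euler_fn q"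
    unfolding o_def using LIMSEQ_unique by blast
qed

section \<open>Polylogarithms of negative order\<close>

text \<open>In the variable \<open>v = 1 / (1 - t)\<close> the derivation \<open>t d/dt\<close>
  becomes \<open>(v^2 - v) d/dv\<close>; the polynomials are the iterates of this operator on
  \<open>v\<close>.\<close>

primrec eulerian_poly :: "nat \<Rightarrow> complex poly" where
  "eulerian_poly 0 = [:0, 1:]"
| "eulerian_poly (Suc n) = [:0, -1, 1:] * pderiv (eulerian_poly n)"

text \<open>The polylogarithm \<open>(t d/dt)\<^sup>n (1 / (1 - t))\<close>.\<close>
definition polylog_neg :: "nat \<Rightarrow> complex \<Rightarrow> complex" where
  "polylog_neg n t = poly (eulerian_poly n) (1 / (1 - t))"

lemma degree_eulerian_poly: "degree (eulerian_poly n) \<le> Suc n"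
proof (induction n)
  case (Suc n)
  have "degree (eulerian_poly (Suc n)) \<le> degree [:0, -1, 1::complex:] + degree (pderiv (eulerian_poly n))"
    unfolding eulerian_poly.simps by (rule degree_mult_le)
  with Suc show ?case by (simp add: degree_pderiv)
qed simp

lemma coeff_eulerian_poly: "coeff (eulerian_poly n) (Suc n) = fact n"
proof (induction n)
  case (Suc n)
  have "coeff (eulerian_poly n) (Suc (Suc n)) = 0"
    using degree_eulerian_poly[of n] by (intro coeff_eq_0) simp
  with Suc show ?case by (simp add: coeff_pderiv algebra_simps)
qed simp

text \<open>The inversion \<open>t \<mapsto> 1 / t\<close> is \<open>v \<mapsto> 1 - v\<close>. It
  fixes \<open>v^2 - v\<close> and reverses d/dv, so each step contributes one sign. The pattern
  starts at \<open>n = 1\<close>, since \<open>1 - v\<close> is not a multiple of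
  \<open>v\<close>.\<close>

lemma eulerian_poly_reflect:
  assumes "n > 0"
  shows "eulerian_poly n \<circ>\<^sub>p [:1, -1:] = Polynomial.smult ((-1) ^ Suc n) (eulerian_poly n)"
  using assms
proof (induction n rule: nat_induct_non_zero)
  case 1
  then show ?case by (simp add: pcompose_pCons pderiv_pCons)
next
  case (Suc n)
  have "pderiv (eulerian_poly n) \<circ>\<^sub>p [:1, -1:] = - pderiv (eulerian_poly n \<circ>\<^sub>p [:1, -1:])"
    by (simp add: pderiv_pcompose pderiv_pCons)
  also have "\<dots> = Polynomial.smult ((-1) ^ Suc (Suc n)) (pderiv (eulerian_poly n))"
    unfolding Suc.IH by (simp add: pderiv_smult pderiv_minus)
  finally have "pderiv (eulerian_poly n) \<circ>\<^sub>p [:1, -1:] = \<dots>" .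
  moreover have "[:0, -1, 1:] \<circ>\<^sub>p [:1, -1:] = [:0, -1, 1::complex:]"
    by (simp add: pcompose_pCons)
  ultimately show ?case
    unfolding eulerian_poly.simps pcompose_mult by (simp only: mult_smult_right)
qed

lemma polylog_neg_inverse:
  assumes "n > 0" "t \<noteq> 0" "t \<noteq> 1"
  shows "polylog_neg n (1 / t) = (-1) ^ Suc n * polylog_neg n t"
proof -
  have "1 / (1 - 1 / t) = 1 - 1 / (1 - t)"
    using assms by (simp add: divide_simps) (auto simp: algebra_simps)
  then have "polylog_neg n (1 / t) = poly (eulerian_poly n \<circ>\<^sub>p [:1, -1:]) (1 / (1 - t))"
    by (simp add: polylog_neg_def poly_pcompose)
  then show ?thesis
    unfolding eulerian_poly_reflect[OF assms(1)] by (simp add: polylog_neg_def)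
qed

lemma holomorphic_polylog_neg: "1 \<notin> S \<Longrightarrow> polylog_neg n holomorphic_on S"
  unfolding polylog_neg_def poly_altdef by (intro holomorphic_intros) auto

text \<open>Pole order and leading coefficient come from the top coefficient of
  \<open>eulerian_poly n\<close>. These factorials are the source of the product of factorials in
  the theorem.\<close>

lemma tendsto_polylog_neg_at_1:
  "((\<lambda>t. (1 - t) ^ Suc n * polylog_neg n t) \<longlongrightarrow> fact n) (at 1)"
proof -
  let ?p = "eulerian_poly n"
  have "(1 - t) ^ Suc n * polylog_neg n t = (\<Sum>i\<le>Suc n. coeff ?p i * (1 - t) ^ (Suc n - i))" if "t \<noteq> 1" for t
  proof -
    have "polylog_neg n t = (\<Sum>i\<le>Suc n. coeff ?p i * (1 / (1 - t)) ^ i)"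
      unfolding polylog_neg_def poly_altdef using degree_eulerian_poly[of n]
      by (intro sum.mono_neutral_left) (auto simp: coeff_eq_0)
    then show ?thesis
      using that by (simp only: sum_distrib_left)
        (intro sum.cong refl, simp add: power_diff power_divide del: power_Suc)
  qed
  then have "eventually (\<lambda>t. (\<Sum>i\<le>Suc n. coeff ?p i * (1 - t) ^ (Suc n - i)) = (1 - t) ^ Suc n * polylog_neg n t) (at 1)"
    by (intro eventually_at_filter[THEN iffD2] always_eventually) auto
  moreover have "((\<lambda>t. \<Sum>i\<le>Suc n. coeff ?p i * (1 - t) ^ (Suc n - i)) \<longlongrightarrow> (\<Sum>i\<le>Suc n. coeff ?p i * (1 - 1) ^ (Suc n - i))) (at 1)"
    by (intro tendsto_intros)
  moreover have "(\<Sum>i\<le>Suc n. coeff ?p i * (1 - 1) ^ (Suc n - i)) = coeff ?p (Suc n)"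
    by (subst sum.remove[of _ "Suc n"]) (auto intro!: sum.neutral simp: power_0_left)
  ultimately show ?thesis
    unfolding coeff_eulerian_poly by (simp add: tendsto_cong)
qed

lemma polylog_neg_sums:
  assumes "norm t < 1"
  shows "(\<lambda>r. of_nat r ^ n * t ^ r) sums polylog_neg n t"
  using assms
proof (induction n arbitrary: t)
  case 0
  then show ?case using geometric_sums[of t] by (simp add: polylog_neg_def)
next
  case (Suc n)
  let ?c = "\<lambda>r::nat. of_nat r ^ n :: complex"
  obtain K where K: "norm t < K" "K < 1" using dense[OF Suc.prems] by blast
  have "0 < K" using K(1) norm_ge_zero[of t] by linarith
  define k where "k = complex_of_real K"
  have k: "norm t < norm k" "norm k < 1" using K \<open>0 < K\<close> by (auto simp: k_def)
  have sm: "summable (\<lambda>r. ?c r * k ^ r)" using Suc.IH[OF k(2)] by (rule sums_summable)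
  have D: "((\<lambda>x. \<Sum>r. ?c r * x ^ r) has_field_derivative (\<Sum>r. diffs ?c r * t ^ r)) (at t)"
    by (rule termdiffs_strong[OF sm k(1)])
  have "eventually (\<lambda>x. x \<in> ball 0 1) (nhds t)"
    using Suc.prems by (intro eventually_nhds_in_open) auto
  then have "eventually (\<lambda>x. (\<Sum>r. ?c r * x ^ r) = polylog_neg n x) (nhds t)"
    by eventually_elim (use Suc.IH sums_unique in \<open>fastforce\<close>)
  then have D1: "(polylog_neg n has_field_derivative (\<Sum>r. diffs ?c r * t ^ r)) (at t)"
    using DERIV_cong_ev[OF refl _ refl, THEN iffD1, OF _ D] by blast
  have "t \<noteq> 1" using Suc.prems by auto
  then have "(polylog_neg n has_field_derivative poly (pderiv (eulerian_poly n)) (1 / (1 - t)) * (1 / (1 - t)\<^sup>2)) (at t)"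
    unfolding polylog_neg_def
    by (auto intro!: derivative_eq_intros DERIV_chain'[OF _ poly_DERIV] simp: power2_eq_square)
  from DERIV_unique[OF D1 this]
  have eq: "(\<Sum>r. diffs ?c r * t ^ r) = poly (pderiv (eulerian_poly n)) (1 / (1 - t)) * (1 / (1 - t)\<^sup>2)" .
  have "summable (\<lambda>r. diffs ?c r * t ^ r)"
    by (rule termdiff_converges[OF Suc.prems]) (rule sums_summable[OF Suc.IH])
  then have "(\<lambda>r. t * (diffs ?c r * t ^ r)) sums (t * (\<Sum>r. diffs ?c r * t ^ r))"
    by (intro sums_mult summable_sums)
  also have "(\<lambda>r. t * (diffs ?c r * t ^ r)) = (\<lambda>r. of_nat (Suc r) ^ Suc n * t ^ Suc r)"
    by (simp add: diffs_def fun_eq_iff mult_ac)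
  also have "t * (\<Sum>r. diffs ?c r * t ^ r) = polylog_neg (Suc n) t"
    unfolding eq polylog_neg_def using \<open>t \<noteq> 1\<close>
    by (simp add: power2_eq_square divide_simps) (simp add: algebra_simps)
  finally show ?case
    using sums_Suc_iff[of "\<lambda>r. of_nat r ^ Suc n * t ^ r"] by simp
qed

lemma summable_nat_power_mult_power:
  fixes c :: real
  assumes "\<bar>c\<bar> < 1"
  shows "summable (\<lambda>r. of_nat r ^ n * c ^ r)"
proof -
  have "summable (\<lambda>r. of_nat r ^ n * complex_of_real c ^ r)"
    using polylog_neg_sums[of "complex_of_real c" n] assms by (auto dest: sums_summable)
  then have "summable (\<lambda>r. complex_of_real (of_nat r ^ n * c ^ r))" by simp
  then show ?thesis using summable_of_real_iff by blast
qed

section \<open>Normal convergence of the regular part of the Kronecker series\<close>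

context nome begin

lemma norm_Q_mult_less_1: "norm w < 1 / norm Q \<Longrightarrow> norm Q * norm w < 1"
  using norm_Q_pos by (simp add: field_simps)

lemma holomorphic_on_suminf_ann:
  assumes f: "\<And>s. f s holomorphic_on ann"
    and M: "\<And>a b. norm Q < a \<Longrightarrow> b < 1 / norm Q \<Longrightarrow>
             \<exists>M. summable M \<and> (\<forall>s w. a \<le> norm w \<longrightarrow> norm w \<le> b \<longrightarrow> norm (f s w) \<le> M s)"
  shows "(\<lambda>w. \<Sum>s. f s w) holomorphic_on ann"
proof (rule holomorphic_uniform_sequence[OF open_ann])
  show "(\<lambda>w. \<Sum>s<n. f s w) holomorphic_on ann" for n
    by (intro holomorphic_intros f)
  fix x assume x: "x \<in> ann"
  then obtain a b where ab: "norm Q < a" "a < norm x" "norm x < b" "b < 1 / norm Q"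
    unfolding ann_def by (metis (mono_tags, lifting) dense mem_Collect_eq)
  define d where "d = min (norm x - a) (b - norm x)"
  have sub: "a \<le> norm w \<and> norm w \<le> b" if "w \<in> cball x d" for w
  proof -
    have "norm (x - w) \<le> norm x - a" "norm (x - w) \<le> b - norm x"
      using that by (auto simp: d_def dist_norm)
    then show ?thesis using norm_triangle_ineq2[of x w] norm_triangle_ineq2[of w x]
      by (simp add: norm_minus_commute)
  qed
  obtain M where "summable M" "\<forall>s w. a \<le> norm w \<longrightarrow> norm w \<le> b \<longrightarrow> norm (f s w) \<le> M s"
    using M[OF ab(1,4)] by blast
  then have "uniform_limit (cball x d) (\<lambda>n w. \<Sum>s<n. f s w) (\<lambda>w. \<Sum>s. f s w) sequentially"
    using sub by (intro Weierstrass_m_test) auto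
  moreover have "cball x d \<subseteq> ann" using sub ab by (fastforce simp: ann_def)
  ultimately show "\<exists>d>0. cball x d \<subseteq> ann \<and> uniform_limit (cball x d) (\<lambda>n w. \<Sum>s<n. f s w) (\<lambda>w. \<Sum>s. f s w) sequentially"
    using ab by (intro exI[of _ d]) (auto simp: d_def)
qed

text \<open>The terms \<open>r = s\<close> and \<open>r = -s\<close> of the Kronecker series, minus
  \<open>s^n y^s\<close>. Since \<open>1 / (1 - w Q^s) - 1 = w Q^s / (1 - w Q^s)\<close>, the
  subtraction gains a factor \<open>Q^s\<close>, which extends convergence in \<open>y\<close> from
  \<open>norm y < 1\<close> to the whole annulus.\<close>

definition psi_term :: "nat \<Rightarrow> complex \<Rightarrow> complex \<Rightarrow> nat \<Rightarrow> complex" where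
  "psi_term n w y s = of_nat s ^ n * (w * (Q * y) ^ s / (1 - w * Q ^ s) + (-1) ^ n * (Q / y) ^ s / (Q ^ s - w))"

definition psi :: "nat \<Rightarrow> complex \<Rightarrow> complex \<Rightarrow> complex" where
  "psi n w y = (\<Sum>s. psi_term n w y (Suc s))"

text \<open>The majorant is made of \<open>s^n\<close> times powers of \<open>norm Q * b\<close> and
  \<open>norm Q / a\<close>. One pair \<open>a\<close>, \<open>b\<close> confines both variables, so
  the same bound gives holomorphy in \<open>w\<close> and in \<open>y\<close>.\<close>

lemma psi_term_bound:
  assumes ab: "norm Q < a" "b < 1 / norm Q"
  obtains M where "summable M"
    "\<And>s w y. a \<le> norm w \<Longrightarrow> norm w \<le> b \<Longrightarrow> a \<le> norm y \<Longrightarrow> norm y \<le> b \<Longrightarrow>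
       norm (psi_term n w y (Suc s)) \<le> M s"
proof (cases "a \<le> b")
  case True
  define c where "c = norm Q"
  have c: "0 < c" "c < 1" using norm_Q_pos norm_Q_less_1 by (auto simp: c_def)
  have pos: "0 < a" "0 < b" using True ab c unfolding c_def by linarith+
  have cb: "c * b < 1" using ab(2) c(1) by (simp add: c_def field_simps)
  have ca: "c / a < 1" using ab(1) pos by (simp add: c_def)
  define M where "M = (\<lambda>s. b / (1 - c * b) * (of_nat s ^ n * (c * b) ^ s) + 1 / (a - c) * (of_nat s ^ n * (c / a) ^ s))"
  have "summable M" unfolding M_def
    by (intro summable_add summable_mult summable_nat_power_mult_power) (use c cb ca pos in auto)
  moreover have "norm (psi_term n w y (Suc s)) \<le> M (Suc s)"
    if w: "a \<le> norm w" "norm w \<le> b" and y: "a \<le> norm y" "norm y \<le> b" for s w y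
  proof -
    let ?s = "Suc s"
    have Qs: "c ^ ?s \<le> c" using c by (simp add: mult_left_le power_le_one)
    have "norm (w * Q ^ ?s) \<le> b * c"
      unfolding norm_mult norm_power c_def[symmetric] using Qs w c pos by (intro mult_mono) auto
    then have d1: "1 - c * b \<le> norm (1 - w * Q ^ ?s)"
      using norm_triangle_ineq2[of 1 "w * Q ^ ?s"] by (simp add: mult.commute)
    have d2: "a - c \<le> norm (Q ^ ?s - w)"
      using norm_triangle_ineq3[of "Q ^ ?s" w] Qs w(1) by (simp add: c_def norm_mult norm_power)
    have "norm (w * (Q * y) ^ ?s / (1 - w * Q ^ ?s)) \<le> b * (c * b) ^ ?s / (1 - c * b)"
      unfolding norm_mult norm_divide norm_power c_def[symmetric]
      by (intro frac_le mult_mono power_mono d1) (use w y c pos cb in auto)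
    moreover have "norm ((-1) ^ n * (Q / y) ^ ?s / (Q ^ ?s - w)) \<le> (c / a) ^ ?s / (a - c)"
      unfolding norm_mult norm_divide norm_power c_def[symmetric] norm_minus_cancel norm_one power_one mult_1
      by (intro frac_le power_mono d2) (use w y c pos ab in \<open>auto simp: c_def\<close>)
    ultimately have "norm (psi_term n w y ?s) \<le> of_nat ?s ^ n * (b * (c * b) ^ ?s / (1 - c * b) + (c / a) ^ ?s / (a - c))"
      unfolding psi_term_def norm_mult[of "of_nat _ ^ _"] norm_power norm_of_nat
      by (intro mult_left_mono order_trans[OF norm_triangle_ineq] add_mono) auto
    also have "\<dots> = M ?s" by (simp add: M_def algebra_simps)
    finally show ?thesis .
  qed
  moreover have "summable (\<lambda>s. M (Suc s))" using \<open>summable M\<close> by (simp add: summable_Suc_iff)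
  ultimately show ?thesis using that[of "\<lambda>s. M (Suc s)"] by blast
next
  case False
  then show ?thesis using that[of "\<lambda>_. 0"] by fastforce
qed

lemma ann_denominators_nonzero:
  assumes "w \<in> ann"
  shows "1 - w * Q ^ Suc s \<noteq> 0" "Q ^ Suc s - w \<noteq> 0"
proof -
  have "norm (Q ^ Suc s) \<le> norm Q"
    using norm_Q_less_1 by (simp add: norm_mult norm_power mult_left_le power_le_one)
  moreover have "norm w * norm (Q ^ Suc s) \<le> norm w * norm Q"
    using calculation by (intro mult_left_mono) auto
  ultimately have "norm (w * Q ^ Suc s) < 1" "norm (Q ^ Suc s) < norm w"
    using assms norm_Q_mult_less_1[of w] by (auto simp: ann_def norm_mult mult.commute)
  then show "1 - w * Q ^ Suc s \<noteq> 0" "Q ^ Suc s - w \<noteq> 0" by (metis eq_iff_diff_eq_0 norm_one less_irrefl)+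
qed

lemma ann_interval_mono:
  assumes "norm Q < a" "b < 1 / norm Q" "w \<in> ann"
  shows "norm Q < min a (norm w)" "max b (norm w) < 1 / norm Q"
  using assms by (auto simp: ann_def)

lemma holomorphic_psi_1: 
  assumes y: "y \<in> ann"
  shows "(\<lambda>w. psi n w y) holomorphic_on ann"
  unfolding psi_def
proof (rule holomorphic_on_suminf_ann)
  show "(\<lambda>w. psi_term n w y (Suc s)) holomorphic_on ann" for s
    unfolding psi_term_def using ann_denominators_nonzero by (intro holomorphic_intros) auto
  fix a b assume "norm Q < a" "b < 1 / norm Q"
  from psi_term_bound[OF ann_interval_mono[OF this y]]
  show "\<exists>M. summable M \<and> (\<forall>s w. a \<le> norm w \<longrightarrow> norm w \<le> b \<longrightarrow> norm (psi_term n w y (Suc s)) \<le> M s)"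
    by (metis max.coboundedI1 max.cobounded2 min.coboundedI1 min.cobounded2)
qed

lemma holomorphic_psi_2: 
  assumes w: "w \<in> ann"
  shows "psi n w holomorphic_on ann"
  unfolding psi_def
proof (rule holomorphic_on_suminf_ann)
  show "(\<lambda>y. psi_term n w y (Suc s)) holomorphic_on ann" for s
    unfolding psi_term_def using ann_denominators_nonzero[OF w] ann_nonzero by (intro holomorphic_intros) auto
  fix a b assume "norm Q < a" "b < 1 / norm Q"
  from psi_term_bound[OF ann_interval_mono[OF this w]]
  show "\<exists>M. summable M \<and> (\<forall>s y. a \<le> norm y \<longrightarrow> norm y \<le> b \<longrightarrow> norm (psi_term n w y (Suc s)) \<le> M s)"
    by (metis max.coboundedI1 max.cobounded2 min.coboundedI1 min.cobounded2)
qed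

lemma summable_psi_term:
  assumes "w \<in> ann" "y \<in> ann"
  shows "summable (\<lambda>s. psi_term n w y (Suc s))"
proof -
  have "norm Q < min (norm w) (norm y)" "max (norm w) (norm y) < 1 / norm Q"
    using assms by (auto simp: ann_def)
  from psi_term_bound[OF this, of n] obtain M
    where "summable M" "\<And>s. norm (psi_term n w y (Suc s)) \<le> M s"
    by (metis max.cobounded1 max.cobounded2 min.cobounded1 min.cobounded2)
  then show ?thesis by (rule summable_comparison_test'[of M 0])
qed

end

section \<open>The Kronecker series and its derivatives\<close>

lemma has_sum_finite_sum:
  fixes f :: "'i \<Rightarrow> 'a \<Rightarrow> 'b::topological_comm_monoid_add"
  assumes "\<And>i. i \<in> I \<Longrightarrow> (f i has_sum s i) A"
  shows "((\<lambda>x. \<Sum>i\<in>I. f i x) has_sum (\<Sum>i\<in>I. s i)) A"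
  using assms by (induction I rule: infinite_finite_induct) (auto intro: has_sum_add)

context nome begin

text \<open>For \<open>n = 0\<close> the polylogarithm already contains 1 at \<open>r = 0\<close>,
  and \<open>w / (1 - w)\<close> completes it to the Kronecker term \<open>1 / (1 - w)\<close>. For
  \<open>n > 0\<close> the term at \<open>r = 0\<close> is zero.\<close>

definition phi :: "nat \<Rightarrow> complex \<Rightarrow> complex \<Rightarrow> complex" where
  "phi n w y = polylog_neg n y + (if n = 0 then w / (1 - w) else 0) + psi n w y"

text \<open>In the coordinate \<open>ln y\<close>, \<open>wp n\<close> is, for \<open>n \<ge> 2\<close>, the derivative of order \<open>n - 1\<close> of the
  Weierstrass function.\<close>

definition wp :: "nat \<Rightarrow> complex \<Rightarrow> complex" where
  "wp n y = polylog_neg n y + psi n 1 y"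

text \<open>The bilateral series converges absolutely only for \<open>norm Q < norm y < 1\<close>; the definition of
  \<open>phi\<close> continues it to the whole annulus.\<close>

lemma phi_has_sum:
  assumes w: "w \<in> ann" "w \<noteq> 1" and y: "norm Q < norm y" "norm y < 1"
  shows "((\<lambda>r::int. of_int r ^ n * y powi r / (1 - w * Q powi r)) has_sum phi n w y) UNIV"
proof -
  define f where "f = (\<lambda>r::int. of_int r ^ n * y powi r / (1 - w * Q powi r))"
  define c where "c = norm Q"
  have c: "0 < c" "c < 1" using norm_Q_pos norm_Q_less_1 by (auto simp: c_def)
  have yann: "y \<in> ann" using y one_less_inv_norm_Q by (simp add: ann_def)
  have y0: "y \<noteq> 0" "0 < norm y" using ann_nonzero[OF yann] by auto
  have cw: "c * norm w < 1" "c < norm w" using w norm_Q_mult_less_1[of w] by (auto simp: ann_def c_def)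
  have Qs: "c ^ Suc s \<le> c" for s using c by (simp add: mult_left_le power_le_one)
  have d1: "1 - c * norm w \<le> norm (1 - w * Q ^ Suc s)" for s
  proof -
    have "norm (w * Q ^ Suc s) \<le> norm w * c"
      unfolding norm_mult[of w] norm_power c_def[symmetric] using Qs by (intro mult_left_mono) auto
    then show ?thesis
      using norm_triangle_ineq2[of 1 "w * Q ^ Suc s"] by (simp add: mult.commute)
  qed
  have d2: "norm w - c \<le> norm (Q ^ Suc s - w)" for s
    using norm_triangle_ineq3[of "Q ^ Suc s" w] Qs[of s] by (simp add: c_def norm_mult norm_power)
  have fpos: "f (int s) = of_nat s ^ n * y ^ s / (1 - w * Q ^ s)" for s
    by (simp add: f_def)
  have fneg: "f (- int (Suc s)) = of_nat (Suc s) ^ n * ((-1) ^ n * (Q / y) ^ Suc s / (Q ^ Suc s - w))" for s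
  proof -
    have "(1 - w * Q powi (- int (Suc s))) = (Q ^ Suc s - w) / Q ^ Suc s"
      using Q_nonzero by (simp add: power_int_minus field_simps del: power_Suc of_nat_Suc)
    moreover have "y powi (- int (Suc s)) = 1 / y ^ Suc s"
      by (simp add: power_int_minus field_simps del: power_Suc of_nat_Suc)
    moreover have "of_int (- int (Suc s)) ^ n = ((-1) ^ n * of_nat (Suc s) ^ n :: complex)"
      by (metis mult_minus1 of_int_minus of_int_of_nat_eq power_mult_distrib)
    ultimately show ?thesis
      by (simp only: f_def power_divide) (simp add: field_simps del: power_Suc of_nat_Suc)
  qed
  have sneg: "summable (\<lambda>s. norm (f (- int (Suc s))))"
  proof (rule summable_comparison_test'[of _ 0])
    have "summable (\<lambda>s. of_nat (Suc s) ^ n * (c / norm y) ^ Suc s)"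
      by (rule summable_Suc_iff[of "\<lambda>s. of_nat s ^ n * (c / norm y) ^ s", THEN iffD2])
         (rule summable_nat_power_mult_power, use y c y0 in \<open>auto simp: c_def\<close>)
    then show "summable (\<lambda>s. of_nat (Suc s) ^ n * (c / norm y) ^ Suc s / (norm w - c))"
      by (rule summable_divide)
    fix s
    have "norm (f (- int (Suc s))) = of_nat (Suc s) ^ n * (c / norm y) ^ Suc s / norm (Q ^ Suc s - w)"
      unfolding fneg by (simp add: norm_mult norm_divide norm_power c_def del: power_Suc of_nat_Suc)
    also have "\<dots> \<le> of_nat (Suc s) ^ n * (c / norm y) ^ Suc s / (norm w - c)"
      using d2 cw c y0 by (intro divide_left_mono mult_nonneg_nonneg mult_pos_pos) (use less_le_trans[OF _ d2[of s], of 0] in auto)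
    finally show "norm (norm (f (- int (Suc s)))) \<le> of_nat (Suc s) ^ n * (c / norm y) ^ Suc s / (norm w - c)" by simp
  qed
  have spos: "summable (\<lambda>s. norm (f (int s)))"
  proof (rule summable_Suc_iff[THEN iffD1], rule summable_comparison_test'[of _ 0])
    have "summable (\<lambda>s. of_nat (Suc s) ^ n * norm y ^ Suc s)"
      by (rule summable_Suc_iff[of "\<lambda>s. of_nat s ^ n * norm y ^ s", THEN iffD2])
         (rule summable_nat_power_mult_power, use y in auto)
    then show "summable (\<lambda>s. of_nat (Suc s) ^ n * norm y ^ Suc s / (1 - c * norm w))"
      by (rule summable_divide)
    fix s
    have "norm (f (int (Suc s))) = of_nat (Suc s) ^ n * norm y ^ Suc s / norm (1 - w * Q ^ Suc s)"
      unfolding fpos by (simp add: norm_mult norm_divide norm_power c_def del: power_Suc of_nat_Suc)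
    also have "\<dots> \<le> of_nat (Suc s) ^ n * norm y ^ Suc s / (1 - c * norm w)"
      using d1 cw c y0 by (intro divide_left_mono mult_nonneg_nonneg mult_pos_pos) (use less_le_trans[OF _ d1[of s], of 0] in auto)
    finally show "norm (norm (f (int (Suc s)))) \<le> of_nat (Suc s) ^ n * norm y ^ Suc s / (1 - c * norm w)" by simp
  qed
  have s1: "(\<lambda>s. f (int s)) sums (\<Sum>s. f (int s))"
    by (rule summable_sums[OF summable_norm_cancel[OF spos]])
  have s2: "(\<lambda>s. f (- int (Suc s))) sums (\<Sum>s. f (- int (Suc s)))"
    by (rule summable_sums[OF summable_norm_cancel[OF sneg]])
  have bij1: "bij_betw int UNIV {0..}"
    by (rule bij_betwI[of _ _ _ nat]) auto
  have hpos: "(f has_sum (\<Sum>s. f (int s))) {0..}"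
    by (rule has_sum_reindex_bij_betw[OF bij1, THEN iffD1, OF norm_summable_imp_has_sum[OF spos s1]])
  have bij2: "bij_betw (\<lambda>s. - int (Suc s)) UNIV {..<0}"
    by (rule bij_betwI[of _ _ _ "\<lambda>i. nat (- i - 1)"]) auto
  have hneg: "(f has_sum (\<Sum>s. f (- int (Suc s)))) {..<0}"
    by (rule has_sum_reindex_bij_betw[OF bij2, THEN iffD1, OF norm_summable_imp_has_sum[OF sneg s2]])
  have "{0..} \<union> {..<0} = (UNIV :: int set)" "{0..} \<inter> {..<0} = ({} :: int set)" by auto
  with has_sum_Un_disjoint[OF hpos hneg]
  have "(f has_sum ((\<Sum>s. f (int s)) + (\<Sum>s. f (- int (Suc s))))) UNIV" by simp
  moreover have "(\<Sum>s. f (int s)) + (\<Sum>s. f (- int (Suc s))) = phi n w y"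
  proof -
    have e: "f (int (Suc s)) - of_nat (Suc s) ^ n * y ^ Suc s + f (- int (Suc s)) = psi_term n w y (Suc s)" for s
      unfolding fpos fneg psi_term_def power_mult_distrib
      using ann_denominators_nonzero[OF w(1), of s] by (simp add: divide_simps del: power_Suc of_nat_Suc) (simp add: algebra_simps)
    define F where "F = (\<lambda>s. f (int s) - of_nat s ^ n * y ^ s)"
    have "F sums ((\<Sum>s. f (int s)) - polylog_neg n y)"
      unfolding F_def by (intro sums_diff s1 polylog_neg_sums y)
    then have "(\<lambda>s. F (Suc s)) sums ((\<Sum>s. f (int s)) - polylog_neg n y - F 0)"
      using sums_Suc_iff[of F "(\<Sum>s. f (int s)) - polylog_neg n y - F 0"] by simp
    then have "(\<lambda>s. f (int (Suc s)) - of_nat (Suc s) ^ n * y ^ Suc s) sums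
        ((\<Sum>s. f (int s)) - polylog_neg n y - (f 0 - of_nat 0 ^ n * y ^ 0))"
      by (simp only: F_def int_ops(1))
    from sums_add[OF this s2]
    have "psi n w y = (\<Sum>s. f (int s)) - polylog_neg n y - (f 0 - of_nat 0 ^ n * y ^ 0) + (\<Sum>s. f (- int (Suc s)))"
      unfolding e psi_def by (rule sums_unique[symmetric])
    moreover have "f 0 - of_nat 0 ^ n * y ^ 0 = (if n = 0 then w / (1 - w) else 0)"
      using w by (auto simp: f_def field_simps)
    ultimately show ?thesis by (simp add: phi_def)
  qed
  ultimately show ?thesis by (simp add: f_def)
qed

text \<open>Replace \<open>r\<close> by \<open>r - 1\<close>: then
  \<open>(Q * w) * Q powi (r - 1)\<close> is \<open>w * Q powi r\<close>, and
  \<open>y powi (r - 1)\<close> gives the factor \<open>1 / y\<close>. The powers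
  \<open>(r - 1)^a\<close> and \<open>(r - 1)^b\<close> are expanded separately to match
  \<open>hankel_det_unitriangular\<close>.\<close>

lemma phi_mult_Q:
  assumes w: "1 < norm w" "norm w < 1 / norm Q" and y: "norm Q < norm y" "norm y < 1"
  shows "phi (a + b) (Q * w) y = 1 / y * (\<Sum>c\<le>a. \<Sum>d\<le>b.
      (of_nat (a choose c) * (-1) ^ (a - c)) * (of_nat (b choose d) * (-1) ^ (b - d)) * phi (c + d) w y)"
proof -
  have wa: "w \<in> ann" "Q * w \<in> ann" using ann_mult_Q[OF w] by auto
  have "norm (Q * w) < 1" using norm_Q_mult_less_1[OF w(2)] by (simp add: norm_mult)
  then have w1: "w \<noteq> 1" "Q * w \<noteq> 1" using w by auto
  have y0: "y \<noteq> 0" using y by auto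
  let ?t = "\<lambda>n r::int. of_int r ^ n * y powi r / (1 - w * Q powi r)"
  have "((\<lambda>r::int. of_int r ^ (a+b) * y powi r / (1 - (Q * w) * Q powi r)) has_sum phi (a+b) (Q*w) y) UNIV"
    by (rule phi_has_sum[OF wa(2) w1(2) y])
  then have "((\<lambda>r::int. of_int (r - 1) ^ (a+b) * y powi (r - 1) / (1 - (Q * w) * Q powi (r - 1))) has_sum phi (a+b) (Q*w) y) UNIV"
    by (subst (asm) has_sum_reindex_bij_betw[symmetric, of "\<lambda>r. r - 1" UNIV])
       (auto intro: bij_betwI[of _ _ _ "\<lambda>r. r + 1"])
  moreover have "of_int (r - 1) ^ (a+b) * y powi (r - 1) / (1 - (Q * w) * Q powi (r - 1)) =
      1 / y * (\<Sum>c\<le>a. \<Sum>d\<le>b. (of_nat (a choose c) * (-1) ^ (a - c)) * (of_nat (b choose d) * (-1) ^ (b - d)) * ?t (c + d) r)" for r :: int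
  proof -
    have bin: "of_int (r - 1) ^ a = (\<Sum>c\<le>a. of_nat (a choose c) * (-1) ^ (a - c) * of_int r ^ c :: complex)" for a
      using binomial_ring[of "of_int r :: complex" "-1" a] by (simp add: mult_ac)
    have "(Q * w) * Q powi (r - 1) = w * Q powi r"
      using Q_nonzero by (simp add: power_int_diff)
    moreover have "y powi (r - 1) = 1 / y * y powi r" using y0 by (simp add: power_int_diff)
    ultimately have "of_int (r - 1) ^ (a+b) * y powi (r - 1) / (1 - (Q * w) * Q powi (r - 1)) =
      1 / y * (of_int (r - 1) ^ a * of_int (r - 1) ^ b * (y powi r / (1 - w * Q powi r)))"
      by (simp only: power_add) simp
    also have "of_int (r - 1) ^ a * of_int (r - 1) ^ b * (y powi r / (1 - w * Q powi r)) =
      (\<Sum>c\<le>a. \<Sum>d\<le>b. (of_nat (a choose c) * (-1) ^ (a - c)) * (of_nat (b choose d) * (-1) ^ (b - d)) * ?t (c + d) r)"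
      unfolding bin unfolding sum_product unfolding sum_distrib_right
      by (intro sum.cong refl) (simp add: power_add)
    finally show ?thesis .
  qed
  ultimately have A: "((\<lambda>r::int. 1 / y * (\<Sum>c\<le>a. \<Sum>d\<le>b. (of_nat (a choose c) * (-1) ^ (a - c)) * (of_nat (b choose d) * (-1) ^ (b - d)) * ?t (c + d) r))
      has_sum phi (a+b) (Q*w) y) UNIV"
    by simp
  have "((\<lambda>r::int. 1 / y * (\<Sum>c\<le>a. \<Sum>d\<le>b. (of_nat (a choose c) * (-1) ^ (a - c)) * (of_nat (b choose d) * (-1) ^ (b - d)) * ?t (c + d) r))
      has_sum (1 / y * (\<Sum>c\<le>a. \<Sum>d\<le>b.
      (of_nat (a choose c) * (-1) ^ (a - c)) * (of_nat (b choose d) * (-1) ^ (b - d)) * phi (c + d) w y))) UNIV"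
    by (intro has_sum_cmult_right has_sum_finite_sum phi_has_sum wa w1 y)
  with A show ?thesis using has_sum_unique by blast
qed

text \<open>The change of the \<open>psi\<close> part consists of polylogarithm series at
  \<open>Q * y\<close> and \<open>1 / y\<close>, both in the unit disc for \<open>y\<close> in the
  outer half. The reflection \<open>polylog_neg_inverse\<close> turns the second into
  \<open>polylog_neg n y\<close>, which cancels the change of the polylogarithm part.\<close>

lemma wp_mult_Q:
  assumes y: "1 < norm y" "norm y < 1 / norm Q" and "n > 0"
  shows "wp n (Q * y) = wp n y"
proof -
  have ya: "y \<in> ann" "Q * y \<in> ann" using ann_mult_Q[OF y] by auto
  have y0: "y \<noteq> 0" "y \<noteq> 1" using y by auto
  have Qy: "norm (Q * y) < 1" using norm_Q_mult_less_1[OF y(2)] by (simp add: norm_mult)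
  have iy: "norm (1 / y) < 1" using y by (simp add: norm_divide divide_less_eq)
  have t: "psi_term n 1 (Q * y) (Suc s) - psi_term n 1 y (Suc s) =
      - (of_nat (Suc s) ^ n * (Q * y) ^ Suc s) - (-1) ^ n * (of_nat (Suc s) ^ n * (1 / y) ^ Suc s)" for s
  proof -
    have nz: "1 - Q ^ Suc s \<noteq> 0" using Q_power_neq_1[of "Suc s"] by simp
    have e: "psi_term n 1 y (Suc s) = of_nat (Suc s) ^ n * ((Q * y) ^ Suc s - (-1) ^ n * (Q / y) ^ Suc s) / (1 - Q ^ Suc s)" for y
    proof -
      have "Q ^ Suc s - 1 = - (1 - Q ^ Suc s)" by simp
      moreover have "c * (A / D + e * B / (- D)) = c * (A - e * B) / D" if "D \<noteq> 0" for c A B D e :: complex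
        using that by (simp add: field_simps)
      ultimately show ?thesis unfolding psi_term_def using nz
        by (simp only: mult_1)
    qed
    have p1: "(Q * (Q * y)) ^ Suc s = Q ^ Suc s * (Q * y) ^ Suc s" by (rule power_mult_distrib)
    have p2: "(Q / (Q * y)) ^ Suc s = (1 / y) ^ Suc s" using Q_nonzero by simp
    have p3: "(Q / y) ^ Suc s = Q ^ Suc s * (1 / y) ^ Suc s" by (simp add: power_divide)
    show ?thesis unfolding e p1 p2 p3 using nz
      by (simp add: divide_simps del: power_Suc of_nat_Suc power_divide) (simp add: algebra_simps del: power_Suc of_nat_Suc)
  qed
  have li: "(\<lambda>s. of_nat (Suc s) ^ n * t ^ Suc s) sums polylog_neg n t" if "norm t < 1" for t
    by (rule sums_Suc_iff[of "\<lambda>s. of_nat s ^ n * t ^ s", THEN iffD2])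
       (use polylog_neg_sums[OF that, of n] \<open>n > 0\<close> in \<open>simp add: power_0_left\<close>)
  have "(\<lambda>s. - (of_nat (Suc s) ^ n * (Q * y) ^ Suc s) - (-1) ^ n * (of_nat (Suc s) ^ n * (1 / y) ^ Suc s))
          sums (- polylog_neg n (Q * y) - (-1) ^ n * polylog_neg n (1 / y))"
    by (intro sums_diff sums_minus sums_mult li Qy iy)
  moreover have "(\<lambda>s. psi_term n 1 (Q * y) (Suc s) - psi_term n 1 y (Suc s)) sums (psi n 1 (Q * y) - psi n 1 y)"
    unfolding psi_def by (intro sums_diff summable_sums summable_psi_term one_in_ann ya)
  ultimately have "psi n 1 (Q * y) - psi n 1 y = - polylog_neg n (Q * y) - (-1) ^ n * polylog_neg n (1 / y)"
    unfolding t using sums_unique2 by blast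
  moreover have "(-1) ^ n * polylog_neg n (1 / y) = - polylog_neg n y"
    using polylog_neg_inverse[OF \<open>n > 0\<close> y0] by (simp flip: power_add)
  ultimately show ?thesis by (simp add: wp_def algebra_simps)
qed

end

lemma holomorphic_extend_finite:
  assumes "finite K" "open U" "K \<subseteq> U" "f holomorphic_on (U - K)"
    and "\<And>z. z \<in> K \<Longrightarrow> ((\<lambda>y. (y - z) * f y) \<longlongrightarrow> 0) (at z)"
  shows "\<exists>g. g holomorphic_on U \<and> (\<forall>y\<in>U - K. g y = f y)"
  using assms
proof (induction K arbitrary: U rule: finite_induct)
  case empty
  then show ?case by auto
next
  case (insert x K)
  have "U - insert x K = U - {x} - K" by auto
  then have "\<exists>g. g holomorphic_on (U - {x}) \<and> (\<forall>y\<in>U - {x} - K. g y = f y)"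
    using insert.prems insert.hyps by (intro insert.IH) (auto simp: open_delete)
  then obtain g where g: "g holomorphic_on U - {x}" "\<And>y. y \<in> U - {x} - K \<Longrightarrow> g y = f y" by blast
  have "open (U - K)" using insert.prems(1) insert.hyps(1) by (simp add: finite_imp_closed open_Diff)
  then have "eventually (\<lambda>y. y \<in> U - K - {x}) (at x)"
    using insert.prems(2) insert.hyps by (intro eventually_at_in_open) auto
  then have "eventually (\<lambda>y. (y - x) * f y = (y - x) * g y) (at x)"
    by eventually_elim (use g(2) in auto)
  then have "((\<lambda>y. (y - x) * g y) \<longlongrightarrow> 0) (at x)"
    by (rule Lim_transform_eventually[OF insert.prems(4), rotated]) simp
  moreover have "x \<in> interior U" using insert.prems by (simp add: interior_open)
  ultimately obtain h where h: "h holomorphic_on U" "\<forall>z\<in>U - {x}. h z = g z"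
    using holomorphic_on_extend_lim[OF g(1)] by blast
  then have "\<forall>y\<in>U - insert x K. h y = f y" using g(2) by auto
  with h(1) show ?case by blast
qed

section \<open>The Hankel determinant as a theta quotient\<close>

context nome begin

lemma Q_powi_in_ann:
  assumes "Q powi n \<in> ann"
  shows "n = 0"
proof (rule ccontr)
  assume "n \<noteq> 0"
  then consider "n \<ge> 1" | "n \<le> -1" by linarith
  then show False
  proof cases
    case 1
    then have "norm Q powi n \<le> norm Q powi 1"
      using norm_Q_pos norm_Q_less_1 by (intro power_int_decreasing) auto
    then show False using assms by (simp add: ann_def norm_power_int)
  next
    case 2
    then have "norm Q powi (-1) \<le> norm Q powi n"
      using norm_Q_pos norm_Q_less_1 by (intro power_int_decreasing) auto
    then show False using assms by (simp add: ann_def norm_power_int power_int_minus inverse_eq_divide)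
  qed
qed

lemma theta_nonzero_ann:
  assumes "w \<in> ann" "w \<noteq> 1"
  shows "theta w \<noteq> 0"
proof
  assume "theta w = 0"
  then obtain n :: int where "w = Q powi n" using theta_eq_0D ann_nonzero[OF assms(1)] by blast
  then show False using assms Q_powi_in_ann[of n] by auto
qed

definition tau :: "nat \<Rightarrow> complex \<Rightarrow> complex \<Rightarrow> complex" where
  "tau m w y = hankel_det m (\<lambda>n. phi n w y)"

text \<open>The limit of \<open>(1 - w) * tau m w y\<close> at \<open>w = 1\<close>: deleting the
  first row and column of the Hankel matrix explains the size \<open>m - 1\<close> and the shift by
  2. For \<open>m = 1\<close> it is the empty determinant 1.\<close>

definition kiepert :: "nat \<Rightarrow> complex \<Rightarrow> complex" where
  "kiepert m y = hankel_det (m - 1) (\<lambda>k. wp (k + 2) y)"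

lemma holomorphic_tau_1:
  assumes "y \<in> ann"
  shows "(\<lambda>w. tau m w y) holomorphic_on ann - {1}"
  unfolding tau_def
proof (rule holomorphic_on_hankel_det)
  fix k
  have "(\<lambda>w. psi k w y) holomorphic_on ann - {1}"
    using holomorphic_psi_1[OF assms] by (rule holomorphic_on_subset) auto
  moreover have "(\<lambda>w. if k = 0 then w / (1 - w) else 0) holomorphic_on ann - {1}"
    by (cases "k = 0") (auto intro!: holomorphic_intros)
  ultimately show "(\<lambda>w. phi k w y) holomorphic_on ann - {1}"
    unfolding phi_def by (intro holomorphic_intros)
qed

lemma holomorphic_tau_2:
  assumes "w \<in> ann"
  shows "tau m w holomorphic_on ann - {1}"
  unfolding tau_def
proof (rule holomorphic_on_hankel_det)
  fix k
  have "psi k w holomorphic_on ann - {1}"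
    using holomorphic_psi_2[OF assms] by (rule holomorphic_on_subset) auto
  then show "phi k w holomorphic_on ann - {1}"
    unfolding phi_def by (intro holomorphic_intros holomorphic_polylog_neg) auto
qed

lemma holomorphic_kiepert: "kiepert m holomorphic_on ann - {1}"
  unfolding kiepert_def
proof (rule holomorphic_on_hankel_det)
  fix k
  have "psi (k + 2) 1 holomorphic_on ann - {1}"
    using holomorphic_psi_2[OF one_in_ann] by (rule holomorphic_on_subset) auto
  then show "wp (k + 2) holomorphic_on ann - {1}"
    unfolding wp_def by (intro holomorphic_intros holomorphic_polylog_neg) auto
qed

lemma tau_mult_Q:
  assumes "1 < norm w" "norm w < 1 / norm Q" "norm Q < norm y" "norm y < 1"
  shows "tau m (Q * w) y = tau m w y / y ^ m"
proof -
  have "tau m (Q * w) y = (1 / y) ^ m * tau m w y"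
    unfolding tau_def
    by (rule hankel_det_unitriangular[where L = "\<lambda>a c. of_nat (a choose c) * (-1) ^ (a - c)"],
        rule phi_mult_Q[OF assms]) simp
  then show ?thesis by (simp add: power_divide)
qed

lemma tendsto_tau_at_1:
  assumes "y \<in> ann" "m > 0"
  shows "((\<lambda>w. (1 - w) * tau m w y) \<longlongrightarrow> kiepert m y) (at 1)"
  unfolding tau_def kiepert_def
proof (rule tendsto_hankel_det_simple_pole[OF \<open>m > 0\<close>])
  have psi: "((\<lambda>w. psi k w y) \<longlongrightarrow> psi k 1 y) (at 1)" for k
    using holomorphic_on_imp_continuous_on[OF holomorphic_psi_1[OF assms(1)]] open_ann one_in_ann
    by (simp add: continuous_on_eq_continuous_at isCont_def)
  show "((\<lambda>w. 1 - w) \<longlongrightarrow> (0::complex)) (at 1)"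
    by (auto intro!: tendsto_eq_intros)
  have "((\<lambda>w. (1 - w) * (polylog_neg 0 y + psi 0 w y) + w) \<longlongrightarrow> (1 - 1) * (polylog_neg 0 y + psi 0 1 y) + 1) (at 1)"
    by (intro tendsto_intros psi)
  moreover have "eventually (\<lambda>w. (1 - w) * (polylog_neg 0 y + psi 0 w y) + w = (1 - w) * phi 0 w y) (at 1)"
    by (auto simp: eventually_at_filter phi_def algebra_simps intro!: always_eventually)
       (simp add: divide_simps, simp add: algebra_simps)
  ultimately show "((\<lambda>w. (1 - w) * phi 0 w y) \<longlongrightarrow> 1) (at 1)"
    by (simp add: tendsto_cong)
  show "((\<lambda>w. phi k w y) \<longlongrightarrow> wp k y) (at 1)" if "k > 0" for k
    using that unfolding phi_def wp_def by (auto intro!: tendsto_eq_intros psi)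
qed

text \<open>Both sides have the same multiplier under \<open>w \<mapsto> Q w\<close> and the same simple pole at \<open>w = 1\<close>.\<close>

lemma tau_theta_aux:
  assumes m: "m > 0" and y: "norm Q < norm y ^ m" "norm y < 1" and w: "w \<in> ann" "w \<noteq> 1"
  shows "kiepert m y * kappa * theta (w * y ^ m) = tau m w y * theta w * theta (y ^ m)"
proof -
  define a where "a = y ^ m"
  have y0: "y \<noteq> 0" using y norm_Q_pos m by (auto simp: power_0_left)
  have "norm y ^ m \<le> norm y ^ 1" using m y by (intro power_decreasing) auto
  with y have Qy: "norm Q < norm y" by simp
  have yann: "y \<in> ann" using Qy y one_less_inv_norm_Q by (simp add: ann_def)
  have a: "a \<noteq> 0" "norm Q < norm a" "norm a < 1"
    using y y0 m by (auto simp: a_def norm_power power_less_one_iff)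
  define G where "G = (\<lambda>w. theta a * tau m w y - kiepert m y * kappa * (theta (w * a) / theta w))"
  have "(\<lambda>w. theta (w * a)) holomorphic_on ann - {1}"
    by (rule holomorphic_on_compose_gen[of "\<lambda>w. w * a" _ theta "-{0}", unfolded o_def])
       (use a ann_nonzero in \<open>auto intro!: holomorphic_intros holomorphic_theta\<close>)
  then have holG: "G holomorphic_on ann - {1}"
    unfolding G_def
    by (intro holomorphic_intros holomorphic_tau_1[OF yann] holomorphic_theta)
       (use theta_nonzero_ann ann_nonzero in auto)
  have lim1: "((\<lambda>w. theta (w * a) / theta_reg w) \<longlongrightarrow> theta a / kappa) (at 1)"
  proof (rule tendsto_divide)
    have "isCont (\<lambda>w. theta (w * a)) 1"
      by (rule isCont_o2[where g = theta]) (use a isCont_theta in \<open>auto intro!: continuous_intros\<close>)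
    then show "((\<lambda>w. theta (w * a)) \<longlongrightarrow> theta a) (at 1)" by (simp add: isCont_def)
    show "(theta_reg \<longlongrightarrow> kappa) (at 1)" using isCont_theta_reg theta_reg_1 by (simp add: isCont_def)
  qed (rule kappa_nonzero)
  have "((\<lambda>w. theta a * ((1 - w) * tau m w y) - kiepert m y * kappa * (theta (w * a) / theta_reg w)) \<longlongrightarrow>
      theta a * kiepert m y - kiepert m y * kappa * (theta a / kappa)) (at 1)"
    by (rule tendsto_diff[OF tendsto_mult[OF tendsto_const tendsto_tau_at_1[OF yann m]] tendsto_mult[OF tendsto_const lim1]])
  then have "((\<lambda>w. theta a * ((1 - w) * tau m w y) - kiepert m y * kappa * (theta (w * a) / theta_reg w)) \<longlongrightarrow> 0) (at 1)"
    using kappa_nonzero by simp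
  moreover have "eventually (\<lambda>w. theta a * ((1 - w) * tau m w y) - kiepert m y * kappa * (theta (w * a) / theta_reg w) = - ((w - 1) * G w)) (at 1)"
    unfolding eventually_at_filter
  proof (rule always_eventually, intro allI impI)
    fix w :: complex assume "w \<noteq> 1"
    define t where "t = theta (w * a) / theta w"
    have "theta (w * a) / theta_reg w = (1 - w) * t"
      using \<open>w \<noteq> 1\<close> by (simp add: theta_eq_reg[of w] t_def)
    moreover have "theta a * ((1 - w) * tau m w y) - kiepert m y * kappa * ((1 - w) * t) = - ((w - 1) * G w)"
      unfolding G_def t_def[symmetric] by (simp add: algebra_simps)
    ultimately show "theta a * ((1 - w) * tau m w y) - kiepert m y * kappa * (theta (w * a) / theta_reg w) = - ((w - 1) * G w)"
      by (simp only:)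
  qed
  ultimately have "((\<lambda>w. - ((w - 1) * G w)) \<longlongrightarrow> 0) (at 1)"
    by (rule Lim_transform_eventually)
  then have "((\<lambda>w. (w - 1) * G w) \<longlongrightarrow> 0) (at 1)"
    using tendsto_minus_cancel_left[of "\<lambda>w. (w - 1) * G w" 0] by simp
  then obtain g where g: "g holomorphic_on ann" "\<And>w. w \<in> ann - {1} \<Longrightarrow> g w = G w"
    using holomorphic_on_extend_lim[OF holG] open_ann one_in_ann by (auto simp: interior_open)
  have "g w = 0"
  proof (rule quasi_periodic_eq_0[OF g(1), of "1 / a"])
    \<comment> \<open>By the bound on \<open>norm y ^ m\<close>, the point \<open>1 / a\<close> lies
      in the outer half of \<open>ann\<close>, which contains no power of \<open>Q\<close>. So this
      multiplier excludes all nonzero monomials.\<close>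
    show "1 / a \<noteq> Q powi n" for n
    proof
      assume "1 / a = Q powi n"
      moreover have "1 / a \<in> ann"
      proof -
        have "1 < 1 / norm a" "1 / norm a < 1 / norm Q"
          using a norm_Q_pos by (auto simp: divide_simps)
        then show ?thesis using norm_Q_less_1 by (simp add: ann_def norm_divide)
      qed
      ultimately have "a = 1" using Q_powi_in_ann[of n] by auto
      then show False using a by simp
    qed
    fix w :: complex assume w: "1 < norm w" "norm w < 1 / norm Q"
    have "norm (Q * w) < 1" using norm_Q_mult_less_1[OF w(2)] by (simp add: norm_mult)
    then have "Q * w \<noteq> 1" by auto
    then have wn: "w \<in> ann - {1}" "Q * w \<in> ann - {1}" "w \<noteq> 0"
      using ann_mult_Q[OF w] w by auto
    have e1: "theta (Q * w * a) / theta (Q * w) = 1 / a * (theta (w * a) / theta w)"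
      using theta_mult_Q[of w] theta_mult_Q[of "w * a"] wn(3) a(1) by (simp add: mult.assoc)
    have e2: "tau m (Q * w) y = 1 / a * tau m w y"
      using tau_mult_Q[OF w Qy y(2)] by (simp add: a_def)
    have "G (Q * w) = 1 / a * G w"
      unfolding G_def e1 e2 right_diff_distrib by (simp only: mult_ac)
    then show "g (Q * w) = 1 / a * g w"
      using wn g(2) by simp
  qed (use a w in auto)
  then have "G w = 0" using g(2)[of w] w by simp
  then have "theta a * tau m w y = kiepert m y * kappa * (theta (w * a) / theta w)"
    by (simp add: G_def)
  then have "theta a * tau m w y * theta w = kiepert m y * kappa * theta (w * a)"
    using theta_nonzero_ann[OF w] by simp
  then show ?thesis by (simp add: a_def mult_ac)
qed

text \<open>In this form, free of division by \<open>theta (y ^ m)\<close>, both sides are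
  holomorphic in \<open>y\<close> on the annulus punctured at 1, so analytic continuation lifts the
  restriction on \<open>norm y ^ m\<close>. Zeros of \<open>theta (y ^ m)\<close> are thereby
  included; \<open>kiepert_ratio_removable\<close> depends on them.\<close>

lemma tau_theta:
  assumes m: "m > 0" and w: "w \<in> ann" "w \<noteq> 1" and y: "y \<in> ann" "y \<noteq> 1"
  shows "kiepert m y * kappa * theta (w * y ^ m) = tau m w y * theta w * theta (y ^ m)"
proof (rule analytic_continuation_open[where f = "\<lambda>y. kiepert m y * kappa * theta (w * y ^ m)"])
  let ?U = "{y::complex. norm Q < norm y ^ m \<and> norm y < 1}"
  show "open ?U" by (intro open_Collect_conj open_Collect_less continuous_intros)
  show "open (ann - {1})" using open_ann by (simp add: open_delete)
  show "?U \<noteq> {}"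
  proof -
    obtain x where x: "norm Q < x" "x < 1" using dense[OF norm_Q_less_1] by blast
    then have "0 < x" using norm_Q_pos by linarith
    then have "complex_of_real (root m x) \<in> ?U"
      using x m real_root_lt_1_iff[of m x] by (simp add: real_root_pow_pos2 real_root_ge_zero)
    then show ?thesis by blast
  qed
  show "connected (ann - {1})" using connected_open_delete[OF open_ann connected_ann] by simp
  show "?U \<subseteq> ann - {1}"
  proof
    fix y assume "y \<in> ?U"
    then have y: "norm Q < norm y ^ m" "norm y < 1" by auto
    have "norm y ^ m \<le> norm y ^ 1" using m y by (intro power_decreasing) auto
    with y show "y \<in> ann - {1}" using one_less_inv_norm_Q by (auto simp: ann_def)
  qed
  have 1: "(\<lambda>y. theta (c * y ^ m)) holomorphic_on ann - {1}" if "c \<noteq> 0" for c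
    by (rule holomorphic_on_compose_gen[of "\<lambda>y. c * y ^ m" _ theta "-{0}", unfolded o_def])
       (use that ann_nonzero in \<open>auto intro!: holomorphic_intros holomorphic_theta\<close>)
  show "(\<lambda>y. kiepert m y * kappa * theta (w * y ^ m)) holomorphic_on ann - {1}"
    by (intro holomorphic_intros holomorphic_kiepert 1 ann_nonzero w)
  show "(\<lambda>y. tau m w y * theta w * theta (y ^ m)) holomorphic_on ann - {1}"
    using 1[of 1] by (intro holomorphic_intros holomorphic_tau_2 w) simp_all
qed (use y tau_theta_aux[OF m _ _ w] in auto)

end

section \<open>Kiepert's determinant formula\<close>

lemma prod_fact_shift:
  "(\<Prod>i<n. fact i * fact (i + 2)) = (of_nat (Suc n) * (\<Prod>i=1..n. fact i)\<^sup>2 :: complex)"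
proof (induction n)
  case (Suc n)
  have "fact (n + 2) = (of_nat (Suc (Suc n)) * fact (Suc n) :: complex)" by simp
  moreover have "fact (Suc n) = (of_nat (Suc n) * fact n :: complex)" by simp
  ultimately show ?case using Suc
    by (simp add: power_mult_distrib power2_eq_square del: fact_Suc of_nat_Suc add_2_eq_Suc')
qed simp

context nome begin

lemma finite_theta_power_zeros:
  assumes "m > 0"
  shows "finite {y \<in> ann. theta (y ^ m) = 0}"
proof -
  have "{y \<in> ann. theta (y ^ m) = 0} \<subseteq> (\<Union>n\<in>{- int m..int m}. {y. y ^ m = Q powi n})"
  proof
    fix y assume "y \<in> {y \<in> ann. theta (y ^ m) = 0}"
    then have y: "y \<in> ann" "theta (y ^ m) = 0" by auto
    then obtain n :: int where n: "y ^ m = Q powi n"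
      using theta_eq_0D[of "y ^ m"] ann_nonzero by auto
    have "norm Q ^ m < norm y ^ m" "norm y ^ m < (1 / norm Q) ^ m"
      using y(1) assms by (auto simp: ann_def intro!: power_strict_mono)
    then have "norm Q powi int m < norm Q powi n" "norm Q powi n < norm Q powi (- int m)"
      using arg_cong[OF n, of norm] by (auto simp: norm_power norm_power_int power_int_minus power_divide inverse_eq_divide)
    then have "\<not> n \<ge> int m" "\<not> n \<le> - int m"
      using power_int_decreasing[of "int m" n "norm Q"] power_int_decreasing[of n "- int m" "norm Q"]
        norm_Q_pos norm_Q_less_1 by auto
    then show "y \<in> (\<Union>n\<in>{- int m..int m}. {y. y ^ m = Q powi n})"
      using n by auto
  qed
  moreover have "finite (\<Union>n\<in>{- int m..int m}. {y. y ^ m = Q powi n})"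
    using assms by (intro finite_UN_I finite_nth_roots) auto
  ultimately show ?thesis using finite_subset by blast
qed

text \<open>The power \<open>m\<^sup>2\<close> is the one for which the powers of \<open>y\<close>
  in the multipliers of the two theta factors cancel, leaving
  \<open>Q ^ (m * (m - 1) div 2)\<close>. The zero of that order at \<open>y = 1\<close> also
  balances the pole of \<open>kiepert m\<close> and the zero of
  \<open>theta (y ^ m)\<close>.\<close>

definition kiepert_ratio :: "nat \<Rightarrow> complex \<Rightarrow> complex" where
  "kiepert_ratio m y = kiepert m y * theta y ^ (m\<^sup>2) / theta (y ^ m)"

lemma kiepert_ratio_mult_Q:
  assumes y: "1 < norm y" "norm y < 1 / norm Q"
  shows "kiepert_ratio m (Q * y) = Q ^ (m * (m - 1) div 2) * kiepert_ratio m y"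
proof -
  have y0: "y \<noteq> 0" using y by auto
  have k: "kiepert m (Q * y) = kiepert m y"
    unfolding kiepert_def by (simp add: wp_mult_Q[OF y])
  have t: "theta (Q * y) ^ (m\<^sup>2) = (-1) ^ (m\<^sup>2) * theta y ^ (m\<^sup>2) / y ^ (m\<^sup>2)"
  proof -
    have "theta (Q * y) = (-1) * theta y / y" using theta_mult_Q[OF y0] by simp
    then show ?thesis by (simp only: power_divide power_mult_distrib)
  qed
  have e: "theta ((Q * y) ^ m) = (- 1) ^ m * theta (y ^ m) / (y ^ (m\<^sup>2) * Q ^ (m * (m - 1) div 2))"
    unfolding power_mult_distrib using theta_mult_Q_power[of "y ^ m" m] y0
    by (simp add: power_mult[symmetric] power2_eq_square)
  have sgn: "(-1) ^ (m\<^sup>2) = ((-1) ^ m :: complex)"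
    by (cases "even m") (auto simp: power2_eq_square)
  show ?thesis
    unfolding kiepert_ratio_def k t e sgn using y0 Q_nonzero by simp
qed

text \<open>The entry of index \<open>k\<close> has a pole of order \<open>k + 3\<close> with
  leading coefficient \<open>(k + 2)!\<close>. Orders linear in the index factor out of a Hankel
  determinant and add up to \<open>(m - 1)(m - 2) + 3 (m - 1) = m^2 - 1\<close>;
  \<open>hankel_det_fact\<close> evaluates what is left.\<close>

lemma tendsto_kiepert_at_1:
  assumes "m > 0"
  shows "((\<lambda>y. (1 - y) ^ (m\<^sup>2 - 1) * kiepert m y) \<longlongrightarrow> of_nat m * (\<Prod>i=1..m-1. fact i)\<^sup>2) (at 1)"
proof -
  have wp: "((\<lambda>y. (1 - y) ^ (k + 3) * wp (k + 2) y) \<longlongrightarrow> fact (k + 2)) (at 1)" for k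
  proof -
    have "isCont (psi (k + 2) 1) 1"
      using holomorphic_on_imp_continuous_on[OF holomorphic_psi_2[OF one_in_ann]] open_ann one_in_ann
      by (simp add: continuous_on_eq_continuous_at)
    then have "((\<lambda>y. (1 - y) ^ Suc (k + 2) * polylog_neg (k + 2) y + (1 - y) ^ Suc (k + 2) * psi (k + 2) 1 y)
        \<longlongrightarrow> fact (k + 2) + (1 - 1) ^ Suc (k + 2) * psi (k + 2) 1 1) (at 1)"
      unfolding isCont_def by (intro tendsto_add tendsto_polylog_neg_at_1 tendsto_mult tendsto_intros)
    then show ?thesis by (simp add: wp_def distrib_left numeral_3_eq_3)
  qed
  have "hankel_det (m - 1) (\<lambda>k. (1 - y) ^ (k + 3) * wp (k + 2) y) = (1 - y) ^ (m\<^sup>2 - 1) * kiepert m y" for y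
  proof -
    have "hankel_det (m - 1) (\<lambda>k. (1 - y) ^ (k + 3) * wp (k + 2) y) =
       hankel_det (m - 1) (\<lambda>k. (1 - y) ^ k * ((1 - y) ^ 3 * wp (k + 2) y))"
      by (simp add: power_add mult_ac)
    also have "\<dots> = (1 - y) ^ ((m - 1) * (m - 1 - 1)) * ((1 - y) ^ 3) ^ (m - 1) * kiepert m y"
      unfolding hankel_det_scale hankel_det_cmult kiepert_def by simp
    also have "(1 - y) ^ ((m - 1) * (m - 1 - 1)) * ((1 - y) ^ 3) ^ (m - 1) = (1 - y) ^ ((m - 1) * (m - 1 - 1) + 3 * (m - 1))"
      by (simp add: power_add power_mult)
    also have "(m - 1) * (m - 1 - 1) + 3 * (m - 1) = m\<^sup>2 - 1"
    proof (cases "m = 1")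
      case False
      then obtain k where "m = k + 2" using assms by (metis add_2_eq_Suc' not0_implies_Suc One_nat_def gr0_conv_Suc)
      then show ?thesis by (simp add: power2_eq_square)
    qed simp
    finally show ?thesis .
  qed
  moreover have "((\<lambda>y. hankel_det (m - 1) (\<lambda>k. (1 - y) ^ (k + 3) * wp (k + 2) y)) \<longlongrightarrow>
      hankel_det (m - 1) (\<lambda>k. of_nat (fact (k + 2)))) (at 1)"
    unfolding hankel_det_def by (rule tendsto_det_mat) (simp only: prod.case of_nat_fact, rule wp)
  moreover have "hankel_det (m - 1) (\<lambda>k. of_nat (fact (k + 2))) = (of_nat m * (\<Prod>i=1..m-1. fact i)\<^sup>2 :: complex)"
    unfolding hankel_det_fact prod_fact_shift using assms by simp
  ultimately show ?thesis by simp
qed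

text \<open>The leading coefficient of \<open>theta (y ^ m)\<close> at 1 contains the value
  \<open>m\<close> of \<open>1 + y + ... + y^(m-1)\<close>, which cancels the \<open>m\<close> in
  the limit of \<open>kiepert m\<close>.\<close>

lemma tendsto_kiepert_ratio_at_1:
  assumes "m > 0"
  shows "(kiepert_ratio m \<longlongrightarrow> kappa ^ (m\<^sup>2 - 1) * (\<Prod>i=1..m-1. fact i)\<^sup>2) (at 1)"
proof -
  have reg: "(theta_reg \<longlongrightarrow> kappa) (at 1)"
    using isCont_theta_reg theta_reg_1 by (simp add: isCont_def)
  have "isCont (\<lambda>y. theta_reg (y ^ m)) 1"
    by (rule isCont_o2[where g = theta_reg]) (auto intro!: continuous_intros isCont_theta_reg)
  then have regm: "((\<lambda>y. theta_reg (y ^ m)) \<longlongrightarrow> kappa) (at 1)"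
    using theta_reg_1 by (simp add: isCont_def)
  have "((\<lambda>y. \<Sum>i<m. y ^ i) \<longlongrightarrow> (\<Sum>i<m. 1 ^ i)) (at (1::complex))"
    by (intro tendsto_intros)
  then have geo: "((\<lambda>y. \<Sum>i<m. y ^ i) \<longlongrightarrow> of_nat m) (at (1::complex))" by simp
  have "((\<lambda>y. (1 - y) ^ (m\<^sup>2 - 1) * kiepert m y * (theta_reg y ^ (m\<^sup>2) / ((\<Sum>i<m. y ^ i) * theta_reg (y ^ m)))) \<longlongrightarrow>
      of_nat m * (\<Prod>i=1..m-1. fact i)\<^sup>2 * (kappa ^ (m\<^sup>2) / (of_nat m * kappa))) (at 1)"
    using kappa_nonzero assms by (intro tendsto_mult tendsto_kiepert_at_1 tendsto_divide tendsto_power reg regm geo) auto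
  moreover have "of_nat m * (\<Prod>i=1..m-1. fact i)\<^sup>2 * (kappa ^ (m\<^sup>2) / (of_nat m * kappa)) = kappa ^ (m\<^sup>2 - 1) * (\<Prod>i=1..m-1. fact i)\<^sup>2"
  proof -
    have "m\<^sup>2 = Suc (m\<^sup>2 - 1)" using assms by simp
    then have "kappa ^ (m\<^sup>2) = kappa * kappa ^ (m\<^sup>2 - 1)" by (metis power_Suc)
    then show ?thesis using assms kappa_nonzero by simp
  qed
  moreover have "eventually (\<lambda>y. (1 - y) ^ (m\<^sup>2 - 1) * kiepert m y * (theta_reg y ^ (m\<^sup>2) / ((\<Sum>i<m. y ^ i) * theta_reg (y ^ m))) = kiepert_ratio m y) (at 1)"
    unfolding eventually_at_filter
  proof (rule always_eventually, intro allI impI)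
    fix y :: complex assume y: "y \<noteq> 1"
    have a: "1 - y ^ m = (1 - y) * (\<Sum>i<m. y ^ i)"
      using y one_diff_power_eq by blast
    have b: "theta (y ^ m) = (1 - y) * ((\<Sum>i<m. y ^ i) * theta_reg (y ^ m))"
      unfolding theta_eq_reg[of "y ^ m"] a by (simp only: mult.assoc)
    have "m\<^sup>2 = Suc (m\<^sup>2 - 1)" using assms by simp
    then have c: "theta y ^ (m\<^sup>2) = (1 - y) * ((1 - y) ^ (m\<^sup>2 - 1) * theta_reg y ^ (m\<^sup>2))"
      unfolding theta_eq_reg[of y] power_mult_distrib by (metis mult.assoc power_Suc)
    show "(1 - y) ^ (m\<^sup>2 - 1) * kiepert m y * (theta_reg y ^ (m\<^sup>2) / ((\<Sum>i<m. y ^ i) * theta_reg (y ^ m))) = kiepert_ratio m y"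
      unfolding kiepert_ratio_def b c using y by (simp add: mult_ac)
  qed
  ultimately show ?thesis using Lim_transform_eventually by force
qed

text \<open>Through \<open>tau_theta\<close> the ratio near \<open>y\<close> is expressed by
  \<open>tau m w\<close>, with denominator \<open>theta (w * z ^ m)\<close> in place of
  \<open>theta (z ^ m)\<close>. A choice of \<open>w\<close> with \<open>theta (w * y ^ m)\<close>
  nonzero makes this expression continuous at \<open>y\<close>.\<close>

lemma kiepert_ratio_removable:
  assumes m: "m > 0" and y: "y \<in> ann" "y \<noteq> 1"
  shows "((\<lambda>z. (z - y) * kiepert_ratio m z) \<longlongrightarrow> 0) (at y)"
proof -
  have y0: "y \<noteq> 0" using ann_nonzero y by blast
  obtain w where w: "w \<in> ann" "w \<noteq> 1" "theta (w * y ^ m) \<noteq> 0"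
  proof -
    \<comment> \<open>If both candidates \<open>x1\<close> and \<open>x2\<close> failed, their
      quotient \<open>x2 / x1\<close>, which lies strictly between 1 and \<open>1 / norm Q\<close>,
      would be a power of \<open>Q\<close>.\<close>
    obtain x1 where x1: "1 < x1" "x1 < 1 / norm Q" using dense[OF one_less_inv_norm_Q] by blast
    obtain x2 where x2: "x1 < x2" "x2 < 1 / norm Q" using dense[OF x1(2)] by blast
    let ?w1 = "complex_of_real x1" and ?w2 = "complex_of_real x2"
    have ann: "?w1 \<in> ann" "?w2 \<in> ann" "?w1 \<noteq> 1" "?w2 \<noteq> 1"
      using x1 x2 norm_Q_less_1 by (auto simp: ann_def)
    show ?thesis
    proof (cases "theta (?w1 * y ^ m) = 0 \<and> theta (?w2 * y ^ m) = 0")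
      case True
      then obtain a b :: int where "?w1 * y ^ m = Q powi a" "?w2 * y ^ m = Q powi b"
        using theta_eq_0D[of "?w1 * y ^ m"] theta_eq_0D[of "?w2 * y ^ m"] ann_nonzero[OF ann(1)] ann_nonzero[OF ann(2)] y0
        by (metis mult_eq_0_iff power_not_zero)
      then have "?w2 / ?w1 = Q powi (b - a)"
        using y0 Q_nonzero x1 by (simp add: power_int_diff field_simps)
          (metis mult.assoc mult.commute)
      moreover have "?w2 / ?w1 \<in> ann"
      proof -
        have "1 < x2 / x1" using x1 x2 by simp
        moreover have "x2 / x1 < 1 / norm Q"
          using x1 x2 by (smt (verit) divide_less_eq_1 frac_less2 div_by_1)
        moreover have "norm (?w2 / ?w1) = x2 / x1" using x1 x2 by (simp add: norm_divide)
        ultimately show ?thesis using norm_Q_less_1 unfolding ann_def mem_Collect_eq by linarith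
      qed
      ultimately have "b - a = 0" using Q_powi_in_ann by metis
      then have "?w2 / ?w1 = 1" using \<open>?w2 / ?w1 = Q powi (b - a)\<close> by simp
      then show ?thesis using x1 x2 by simp
    next
      case False
      then show ?thesis using ann that by blast
    qed
  qed
  let ?h = "\<lambda>z. tau m w z * theta w * theta z ^ (m\<^sup>2) / (kappa * theta (w * z ^ m))"
  have open1: "open (ann - {1})" using open_ann by (simp add: open_delete)
  have "isCont (tau m w) y"
    using holomorphic_on_imp_continuous_on[OF holomorphic_tau_2[OF w(1)]] open1 y
    by (simp add: continuous_on_eq_continuous_at)
  moreover have ct: "isCont (\<lambda>z. theta (c * z ^ m)) y" if "c \<noteq> 0" for c
    by (rule isCont_o2[where g = theta]) (use that y0 isCont_theta in \<open>auto intro!: continuous_intros\<close>)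
  have w0: "w \<noteq> 0" using ann_nonzero w by blast
  ultimately have "isCont ?h y"
    using w kappa_nonzero isCont_theta[OF y0] by (intro continuous_intros ct) auto
  then have "(?h \<longlongrightarrow> ?h y) (at y)" unfolding isCont_def .
  from tendsto_mult[OF tendsto_diff[OF tendsto_ident_at tendsto_const] this]
  have "((\<lambda>z. (z - y) * ?h z) \<longlongrightarrow> (y - y) * ?h y) (at y)" .
  then have "((\<lambda>z. (z - y) * ?h z) \<longlongrightarrow> 0) (at y)" by simp
  moreover have "eventually (\<lambda>z. (z - y) * ?h z = (z - y) * kiepert_ratio m z) (at y)"
  proof -
    have "eventually (\<lambda>z. z \<in> ann - {1} - {y}) (at y)"
      using open1 y by (intro eventually_at_in_open) auto
    moreover have "eventually (\<lambda>z. theta (w * z ^ m) \<noteq> 0) (at y)"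
      using ct[OF w0] w(3) unfolding isCont_def by (rule tendsto_imp_eventually_ne)
    moreover have "eventually (\<lambda>z. z \<in> - ({z \<in> ann. theta (z ^ m) = 0} - {y}) - {y}) (at y)"
      using finite_theta_power_zeros[OF m] by (intro eventually_at_in_open open_Compl finite_imp_closed) auto
    ultimately show ?thesis
    proof eventually_elim
      case (elim z)
      then have nz: "theta (z ^ m) \<noteq> 0" by auto
      have "tau m w z * theta w = kiepert m z * kappa * theta (w * z ^ m) / theta (z ^ m)"
        using tau_theta[OF m w(1,2), of z] elim nz by (simp add: field_simps)
      then have "?h z = kiepert_ratio m z"
        using elim(2) kappa_nonzero by (simp add: kiepert_ratio_def)
      then show ?case by simp
    qed
  qed
  ultimately show ?thesis by (rule Lim_transform_eventually)
qed

theorem kiepert_formula: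
  assumes m: "m > 0" and y: "y \<in> ann" "theta (y ^ m) \<noteq> 0"
  shows "kiepert m y * theta y ^ (m\<^sup>2) =
    kappa ^ (m\<^sup>2 - 1) * (\<Prod>i=1..m-1. fact i)\<^sup>2 * y ^ (m * (m - 1) div 2) * theta (y ^ m)"
proof -
  define K where "K = {y \<in> ann. theta (y ^ m) = 0}"
  define L where "L = kappa ^ (m\<^sup>2 - 1) * (\<Prod>i=1..m-1. fact i :: complex)\<^sup>2"
  have finK: "finite K" unfolding K_def by (rule finite_theta_power_zeros[OF m])
  have "theta 1 = 0" by (simp add: theta_eq_reg)
  then have 1: "1 \<in> K" using one_in_ann by (simp add: K_def)
  have lim1: "(kiepert_ratio m \<longlongrightarrow> L) (at 1)"
    unfolding L_def by (rule tendsto_kiepert_ratio_at_1[OF m])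
  have "\<exists>g. g holomorphic_on ann \<and> (\<forall>y\<in>ann - K. g y = kiepert_ratio m y)"
  proof (rule holomorphic_extend_finite[OF finK open_ann])
    show "K \<subseteq> ann" by (auto simp: K_def)
    have "(\<lambda>y. theta (y ^ m)) holomorphic_on ann - K"
      by (rule holomorphic_on_compose_gen[of "\<lambda>y. y ^ m" _ theta "-{0}", unfolded o_def])
         (use ann_nonzero in \<open>auto intro!: holomorphic_intros holomorphic_theta\<close>)
    moreover have "theta holomorphic_on ann - K"
      by (rule holomorphic_theta) (use ann_nonzero in auto)
    moreover have "kiepert m holomorphic_on ann - K"
      using holomorphic_kiepert by (rule holomorphic_on_subset) (use 1 in auto)
    ultimately show "kiepert_ratio m holomorphic_on ann - K"
      unfolding kiepert_ratio_def by (intro holomorphic_intros) (auto simp: K_def)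
    fix z assume "z \<in> K"
    show "((\<lambda>y. (y - z) * kiepert_ratio m y) \<longlongrightarrow> 0) (at z)"
    proof (cases "z = 1")
      case True
      have "((\<lambda>y. (y - 1) * kiepert_ratio m y) \<longlongrightarrow> (1 - 1) * L) (at 1)"
        by (intro tendsto_mult lim1 tendsto_intros)
      then show ?thesis using True by simp
    next
      case False
      then show ?thesis using kiepert_ratio_removable[OF m] \<open>z \<in> K\<close> by (auto simp: K_def)
    qed
  qed
  then obtain g where g: "g holomorphic_on ann" "\<And>y. y \<in> ann - K \<Longrightarrow> g y = kiepert_ratio m y" by blast
  have cg: "isCont g z" if "z \<in> ann" for z
    using holomorphic_on_imp_continuous_on[OF g(1)] open_ann that by (simp add: continuous_on_eq_continuous_at)
  have opK: "open (ann - (K - {z}))" for z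
    using finK open_ann by (simp add: finite_imp_closed open_Diff)
  have ev: "eventually (\<lambda>x. x \<in> ann - K) (at z)" if "z \<in> ann" for z
  proof -
    have "eventually (\<lambda>x. x \<in> ann - (K - {z}) - {z}) (at z)"
      using that opK[of z] by (intro eventually_at_in_open) auto
    then show ?thesis by eventually_elim auto
  qed
  have "g 1 = L"
  proof -
    have "(kiepert_ratio m \<longlongrightarrow> g 1) (at 1)"
      using cg[OF one_in_ann] unfolding isCont_def
      by (rule Lim_transform_eventually) (use ev[OF one_in_ann] g(2) in \<open>auto elim: eventually_mono\<close>)
    with lim1 show ?thesis using tendsto_unique by (metis at_neq_bot)
  qed
  have "g y = g 1 * y ^ (m * (m - 1) div 2)"
  proof (rule quasi_periodic_eq_power[OF g(1) y(1)])
    fix z :: complex assume z: "1 < norm z" "norm z < 1 / norm Q"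
    have za: "z \<in> ann" "Q * z \<in> ann" using ann_mult_Q[OF z] by auto
    let ?B = "{z::complex. 1 < norm z \<and> norm z < 1 / norm Q}"
    have "open ?B" by (intro open_Collect_conj open_Collect_less continuous_intros)
    then have e1: "eventually (\<lambda>x. x \<in> ?B - {z}) (at z)" using z by (intro eventually_at_in_open) auto
    have "filterlim (\<lambda>x. Q * x) (at (Q * z)) (at z)"
      unfolding filterlim_at using Q_nonzero
      by (auto intro!: tendsto_intros simp: eventually_at_filter)
    then have e2: "eventually (\<lambda>x. Q * x \<in> ann - K) (at z)"
      by (rule eventually_compose_filterlim[OF ev[OF za(2)]])
    \<comment> \<open>The functional equation of \<open>kiepert_ratio m\<close> passes to
      \<open>g\<close> where neither \<open>x\<close> nor \<open>Q * x\<close> lies in the finite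
      set \<open>K\<close>. Such \<open>x\<close> fill a punctured neighbourhood of
      \<open>z\<close>, and continuity of \<open>g\<close> does the rest.\<close>
    have "isCont (\<lambda>x. g (Q * x) - Q ^ (m * (m - 1) div 2) * g x) z"
      by (intro continuous_intros isCont_o2[of z "\<lambda>x. Q * x" g] cg za)
    then have "((\<lambda>x. g (Q * x) - Q ^ (m * (m - 1) div 2) * g x) \<longlongrightarrow>
        g (Q * z) - Q ^ (m * (m - 1) div 2) * g z) (at z)"
      by (simp add: isCont_def)
    moreover have "eventually (\<lambda>x. g (Q * x) - Q ^ (m * (m - 1) div 2) * g x = 0) (at z)"
      using e1 e2 ev[OF za(1)]
    proof eventually_elim
      case (elim x)
      then show ?case using g(2)[of x] g(2)[of "Q * x"] kiepert_ratio_mult_Q[of x m] by simp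
    qed
    ultimately have "((\<lambda>x. 0) \<longlongrightarrow> g (Q * z) - Q ^ (m * (m - 1) div 2) * g z) (at z)"
      by (rule Lim_transform_eventually)
    then have "g (Q * z) - Q ^ (m * (m - 1) div 2) * g z = 0"
      using tendsto_unique[OF _ tendsto_const] by (metis at_neq_bot)
    then show "g (Q * z) = Q ^ (m * (m - 1) div 2) * g z" by simp
  qed
  moreover have "g y = kiepert_ratio m y" using g(2) y by (auto simp: K_def)
  ultimately have "kiepert_ratio m y = L * y ^ (m * (m - 1) div 2)" using \<open>g 1 = L\<close> by simp
  then show ?thesis using y(2) by (simp add: kiepert_ratio_def L_def field_simps)
qed

end

section \<open>Specialisation to the half period\<close>

lemma summable_on_int_nat_abs:
  fixes f :: "nat \<Rightarrow> real"
  assumes "summable f" "\<And>n. f n \<ge> 0"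
  shows "(\<lambda>r::int. f (nat \<bar>r\<bar>)) summable_on UNIV"
proof -
  have f: "f summable_on UNIV" using assms by (simp add: summable_on_UNIV_nonneg_real_iff)
  have 1: "bij_betw int UNIV {0..}" by (rule bij_betwI[of _ _ _ nat]) auto
  have "(\<lambda>r::int. f (nat \<bar>r\<bar>)) summable_on {0..}"
    by (rule summable_on_reindex_bij_betw[OF 1, THEN iffD1]) (simp add: f)
  moreover have 2: "bij_betw (\<lambda>n. - int n) UNIV {..0}" by (rule bij_betwI[of _ _ _ "\<lambda>r. nat (- r)"]) auto
  have "(\<lambda>r::int. f (nat \<bar>r\<bar>)) summable_on {..0}"
    by (rule summable_on_reindex_bij_betw[OF 2, THEN iffD1]) (simp add: f)
  ultimately have "(\<lambda>r::int. f (nat \<bar>r\<bar>)) summable_on {0..} \<union> {..0}"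
    by (rule summable_on_union)
  moreover have "{0..} \<union> {..0} = (UNIV :: int set)" by auto
  ultimately show ?thesis by simp
qed

text \<open>The signs in the two expansions of \<open>v / (1 - v)\<close>: the powers
  \<open>v^k\<close> with \<open>k > 0\<close> for \<open>norm v < 1\<close>, and minus those with
  \<open>k \<le> 0\<close> for \<open>norm v > 1\<close>. With \<open>v = w Q^r\<close> and
  \<open>1 < norm w < 1 / norm Q\<close> the first case is \<open>r > 0\<close>, the second
  \<open>r \<le> 0\<close>.\<close>

definition quadrant_sign :: "int \<Rightarrow> int \<Rightarrow> complex" where
  "quadrant_sign r k = (if r > 0 \<and> k > 0 then 1 else if r \<le> 0 \<and> k \<le> 0 then -1 else 0)"

definition kr_term :: "complex \<Rightarrow> int \<times> int \<Rightarrow> complex" where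
  "kr_term q = (\<lambda>(r, k). quadrant_sign r k * q powi ((2 * k - 1) * r))"

text \<open>The exponent is a product of both indices, but the bound must separate them. For
  positive indices \<open>k = a + 1\<close>, \<open>r = b + 1\<close> this is
  \<open>(2 a + 1)(b + 1) \<ge> 2 a + b + 1\<close>; for nonpositive ones the decay in
  \<open>k\<close> is taken from \<open>w powi k\<close>, where \<open>norm w > 1\<close>
  enters.\<close>

lemma kr_term_bound:
  assumes q: "q \<noteq> 0" "norm q < 1" and w: "1 < norm w" "norm w < 1 / norm q ^ 2"
  defines "c \<equiv> max (norm q ^ 2 * norm w) (1 / norm w)"
  shows "0 < c" "c < 1" "norm (kr_term q (r, k) * w powi k) \<le> norm w / c * norm q ^ nat \<bar>r\<bar> * c ^ nat \<bar>k\<bar>"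
proof -
  have qp: "0 < norm q" using q by simp
  have wp: "0 < norm w" using w by linarith
  show c0: "0 < c" using wp by (simp add: c_def less_max_iff_disj)
  show c1: "c < 1" using w qp wp by (simp add: c_def field_simps)
  have K: "1 \<le> norm w / c" using c0 c1 w by (simp add: field_simps)
  have pd: "norm q ^ b \<le> norm q ^ a" if "a \<le> b" for a b using q that by (intro power_decreasing) auto
  consider "r > 0" "k > 0" | "r \<le> 0" "k \<le> 0" | "quadrant_sign r k = 0"
    by (cases "r > 0 \<and> k > 0"; cases "r \<le> 0 \<and> k \<le> 0") (auto simp: quadrant_sign_def)
  then show "norm (kr_term q (r, k) * w powi k) \<le> norm w / c * norm q ^ nat \<bar>r\<bar> * c ^ nat \<bar>k\<bar>"
  proof cases
    case 1
    define a b where "a = nat (k - 1)" and "b = nat (r - 1)"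
    have rk: "k = int (Suc a)" "r = int (Suc b)" using 1 by (auto simp: a_def b_def)
    have e: "(2 * k - 1) * r = int ((2 * a + 1) * Suc b)" unfolding rk by (simp add: algebra_simps)
    have "norm (kr_term q (r, k) * w powi k) = norm q ^ ((2 * a + 1) * Suc b) * norm w ^ Suc a"
      unfolding kr_term_def prod.case e using 1
      by (simp only: quadrant_sign_def rk power_int_of_nat norm_mult norm_power) simp
    also have "\<dots> \<le> norm q ^ (2 * a + Suc b) * norm w ^ Suc a"
      by (intro mult_right_mono pd) auto
    also have "\<dots> = norm w * norm q ^ Suc b * (norm q ^ 2 * norm w) ^ a"
      by (simp add: power_add power_mult[symmetric] power_mult_distrib mult_ac)
    also have "\<dots> \<le> norm w * norm q ^ Suc b * c ^ a"
      by (intro mult_left_mono power_mono) (auto simp: c_def)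
    also have "\<dots> = norm w / c * norm q ^ Suc b * c ^ Suc a" using c0 by simp
    also have "Suc b = nat \<bar>r\<bar>" by (simp add: rk)
    also have "Suc a = nat \<bar>k\<bar>" by (simp add: rk)
    finally show ?thesis .
  next
    case 2
    define a b where "a = nat (- k)" and "b = nat (- r)"
    have rk: "k = - int a" "r = - int b" using 2 by (auto simp: a_def b_def)
    have e: "(2 * k - 1) * r = int ((2 * a + 1) * b)" unfolding rk by (simp add: algebra_simps)
    have "norm (kr_term q (r, k) * w powi k) = norm q ^ ((2 * a + 1) * b) * (1 / norm w) ^ a"
      unfolding kr_term_def prod.case e using 2
      by (simp only: quadrant_sign_def rk power_int_of_nat norm_mult norm_power norm_power_int power_int_minus)
         (simp add: power_divide inverse_eq_divide norm_divide norm_power)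
    also have "\<dots> \<le> norm q ^ b * c ^ a"
      using wp by (intro mult_mono pd power_mono) (auto simp: c_def)
    also have "\<dots> \<le> norm w / c * (norm q ^ b * c ^ a)"
      using K c0 mult_right_mono[OF K, of "norm q ^ b * c ^ a"] by simp
    finally show ?thesis unfolding rk by (simp add: mult_ac)
  next
    case 3
    then show ?thesis using c0 wp by (simp add: kr_term_def)
  qed
qed

lemma kr_term_abs_summable:
  assumes q: "q \<noteq> 0" "norm q < 1" and w: "1 < norm w" "norm w < 1 / norm q ^ 2"
  shows "(\<lambda>p. norm (of_int (fst p) ^ n * (kr_term q p * w powi snd p))) summable_on (UNIV \<times> UNIV)"
proof -
  define c where "c = max (norm q ^ 2 * norm w) (1 / norm w)"
  note b = kr_term_bound[OF q w, folded c_def]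
  define A where "A = (\<lambda>r::nat. of_nat r ^ n * norm q ^ r)"
  have A: "(\<lambda>r::int. A (nat \<bar>r\<bar>)) summable_on UNIV"
    by (rule summable_on_int_nat_abs) (use q in \<open>auto simp: A_def intro!: summable_nat_power_mult_power\<close>)
  have B: "(\<lambda>k::int. c ^ nat \<bar>k\<bar>) summable_on UNIV"
    by (rule summable_on_int_nat_abs) (use b in auto)
  have "(\<lambda>(r::int, k::int). A (nat \<bar>r\<bar>) * c ^ nat \<bar>k\<bar>) summable_on (UNIV \<times> UNIV)"
  proof (rule summable_on_SigmaI)
    show "((\<lambda>k. (case (r, k) of (r, k) \<Rightarrow> A (nat \<bar>r\<bar>) * c ^ nat \<bar>k\<bar>)) has_sum
        (A (nat \<bar>r\<bar>) * (\<Sum>\<^sub>\<infinity>k::int. c ^ nat \<bar>k\<bar>))) UNIV" for r :: int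
      using has_sum_cmult_right[OF has_sum_infsum[OF B]] by simp
    show "(\<lambda>r::int. A (nat \<bar>r\<bar>) * (\<Sum>\<^sub>\<infinity>k::int. c ^ nat \<bar>k\<bar>)) summable_on UNIV"
      by (rule summable_on_cmult_left[OF A])
  qed (use b(1) in \<open>auto simp: A_def\<close>)
  then have "(\<lambda>p. norm w / c * (case p of (r, k) \<Rightarrow> A (nat \<bar>r\<bar>) * c ^ nat \<bar>k\<bar>)) summable_on (UNIV \<times> UNIV)"
    by (rule summable_on_cmult_right)
  then show ?thesis
  proof (rule Infinite_Sum.abs_summable_on_comparison_test')
    fix p :: "int \<times> int"
    obtain r k where p: "p = (r, k)" by (cases p)
    have "norm (of_int r ^ n * (kr_term q (r, k) * w powi k)) \<le> of_nat (nat \<bar>r\<bar>) ^ n * (norm w / c * norm q ^ nat \<bar>r\<bar> * c ^ nat \<bar>k\<bar>)"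
      unfolding norm_mult[of "of_int r ^ n"] norm_power norm_of_int
      using b(3)[of r k] by (intro mult_mono) auto
    then show "norm (of_int (fst p) ^ n * (kr_term q p * w powi snd p)) \<le>
       norm w / c * (case p of (r, k) \<Rightarrow> A (nat \<bar>r\<bar>) * c ^ nat \<bar>k\<bar>)"
      by (simp add: p A_def mult_ac)
  qed
qed

lemma quadrant_geometric_has_sum:
  fixes u v :: complex
  assumes "v \<noteq> 0" and "r > 0 \<Longrightarrow> norm v < 1" and "r \<le> 0 \<Longrightarrow> norm v > 1"
  shows "((\<lambda>k. quadrant_sign r k * v powi k) has_sum (v / (1 - v))) UNIV"
proof (cases "r > 0")
  case True
  then have v: "norm v < 1" using assms by simp
  have "((\<lambda>n. v ^ Suc n) has_sum (v / (1 - v))) UNIV"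
  proof (rule norm_summable_imp_has_sum)
    have "summable (\<lambda>n. norm v * norm v ^ n)" using v by (intro summable_mult) simp
    then show "summable (\<lambda>n. norm (v ^ Suc n))" by (simp add: norm_mult norm_power)
    show "(\<lambda>n. v ^ Suc n) sums (v / (1 - v))" using sums_mult[OF geometric_sums[OF v], of v] by simp
  qed
  moreover have bij: "bij_betw (\<lambda>n. int (Suc n)) UNIV {0<..}"
    by (rule bij_betwI[of _ _ _ "\<lambda>k. nat (k - 1)"]) auto
  ultimately have "((\<lambda>k. v powi k) has_sum (v / (1 - v))) {0<..}"
    by (subst has_sum_reindex_bij_betw[OF bij, symmetric]) (simp only: power_int_of_nat)
  then show ?thesis
    by (rule has_sum_cong_neutral[THEN iffD1, rotated 3]) (use True in \<open>auto simp: quadrant_sign_def\<close>)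
next
  case False
  then have v: "norm (1 / v) < 1" using assms by (auto simp: norm_divide divide_less_eq)
  have eq: "- (1 / (1 - 1 / v)) = v / (1 - v)"
  proof -
    have "v \<noteq> 1" using False assms(3) by auto
    then have "1 / (1 - 1 / v) = v / (v - 1)" using assms(1) by (simp add: field_simps)
    then show ?thesis by (metis minus_diff_eq minus_divide_right)
  qed
  have "((\<lambda>n. - ((1 / v) ^ n)) has_sum (- (1 / (1 - 1 / v)))) UNIV"
  proof (rule norm_summable_imp_has_sum)
    show "summable (\<lambda>n. norm (- ((1 / v) ^ n)))"
      using summable_geometric[of "norm (1 / v)"] v by (simp only: norm_minus_cancel norm_power) simp
    show "(\<lambda>n. - ((1 / v) ^ n)) sums (- (1 / (1 - 1 / v)))" by (intro sums_minus geometric_sums v)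
  qed
  moreover have bij: "bij_betw (\<lambda>n. - int n) UNIV {..0}"
    by (rule bij_betwI[of _ _ _ "\<lambda>k. nat (- k)"]) auto
  ultimately have "((\<lambda>k. - (v powi k)) has_sum (v / (1 - v))) {..0}"
    unfolding eq by (subst has_sum_reindex_bij_betw[OF bij, symmetric]) (simp add: power_int_minus power_divide inverse_eq_divide)
  then show ?thesis
    by (rule has_sum_cong_neutral[THEN iffD1, rotated 3]) (use False in \<open>auto simp: quadrant_sign_def\<close>)
qed

context nome begin

text \<open>Row \<open>r\<close> is \<open>q^(-r)\<close> times the geometric expansion of
  \<open>w Q^r / (1 - w Q^r)\<close>. As \<open>Q = q^2\<close>, \<open>q^(-r) Q^r = q^r\<close>;
  hence the half period \<open>y = q\<close> and the factor \<open>w\<close>.\<close>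

lemma kr_term_has_sum:
  assumes q: "q ^ 2 = Q" and w: "1 < norm w" "norm w < 1 / norm Q"
  shows "((\<lambda>p. of_int (fst p) ^ n * (kr_term q p * w powi snd p)) has_sum (w * phi n w q)) (UNIV \<times> UNIV)"
proof -
  have q0: "q \<noteq> 0" using q Q_nonzero by auto
  have nQ: "norm Q = norm q ^ 2" using q by (metis norm_power)
  have nq: "norm q < 1" using norm_Q_less_1 unfolding nQ by (simp add: power_less_one_iff)
  have qQ: "norm Q < norm q" unfolding nQ using nq q0 by (simp add: power2_eq_square)
  let ?f = "\<lambda>p. of_int (fst p) ^ n * (kr_term q p * w powi snd p)"
  have w1: "w \<in> ann" "w \<noteq> 1" using ann_mult_Q[OF w] w by auto
  have w0: "w \<noteq> 0" using w by auto
  have "(\<lambda>p. norm (?f p)) summable_on (UNIV \<times> UNIV)"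
    using kr_term_abs_summable[OF q0 nq w(1)] w(2) by (simp add: nQ)
  then have S: "(?f has_sum infsum ?f (UNIV \<times> UNIV)) (UNIV \<times> UNIV)"
    by (rule has_sum_infsum[OF abs_summable_summable])
  have row: "((\<lambda>k. ?f (r, k)) has_sum (w * (of_int r ^ n * q powi r / (1 - w * Q powi r)))) UNIV" for r
  proof -
    let ?v = "w * Q powi r"
    have v0: "?v \<noteq> 0" using w0 Q_nonzero by simp
    have small: "norm ?v < 1" if "r > 0"
    proof -
      have "norm Q powi r \<le> norm Q powi 1"
        using that norm_Q_pos norm_Q_less_1 by (intro power_int_decreasing) auto
      then have "norm ?v \<le> norm w * norm Q"
        by (simp add: norm_mult norm_power_int mult_left_mono)
      then show ?thesis using norm_Q_mult_less_1[OF w(2)] by (simp add: mult.commute)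
    qed
    have large: "norm ?v > 1" if "r \<le> 0"
    proof -
      have "norm Q powi 0 \<le> norm Q powi r"
        using that norm_Q_pos norm_Q_less_1 by (intro power_int_decreasing) auto
      then have "norm w * 1 \<le> norm w * norm Q powi r" by (intro mult_left_mono) auto
      then show ?thesis using w(1) by (simp add: norm_mult norm_power_int)
    qed
    have "((\<lambda>k. quadrant_sign r k * ?v powi k) has_sum (?v / (1 - ?v))) UNIV"
      by (rule quadrant_geometric_has_sum[OF v0 small large])
    from has_sum_cmult_right[OF this, of "of_int r ^ n * q powi (- r)"]
    have H: "((\<lambda>k. of_int r ^ n * q powi (- r) * (quadrant_sign r k * ?v powi k)) has_sum
        (of_int r ^ n * q powi (- r) * (?v / (1 - ?v)))) UNIV" .
    have Qr: "Q powi r = q powi (2 * r)"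
      unfolding q[symmetric] by (simp add: power_int_mult)
    have T: "of_int r ^ n * q powi (- r) * (quadrant_sign r k * ?v powi k) = ?f (r, k)" for k
    proof -
      have "q powi (- r) * (q powi (2 * r)) powi k = q powi ((2 * k - 1) * r)"
        using q0 by (simp add: power_int_mult[symmetric] power_int_add[symmetric] algebra_simps)
      then show ?thesis
        unfolding kr_term_def Qr prod.case power_int_mult_distrib by (simp add: mult_ac)
    qed
    have "of_int r ^ n * q powi (- r) * (?v / (1 - ?v)) = w * (of_int r ^ n * q powi r / (1 - ?v))"
    proof -
      have "q powi (- r) * Q powi r = q powi r"
        unfolding Qr using q0 by (simp add: power_int_add[symmetric])
      then have "q powi (- r) * ?v = w * q powi r" by (metis mult.left_commute)
      moreover have "of_int r ^ n * q powi (- r) * (?v / (1 - ?v)) = of_int r ^ n * (q powi (- r) * ?v) / (1 - ?v)"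
        by (simp only: times_divide_eq_right mult.assoc)
      ultimately show ?thesis by (simp only: times_divide_eq_right mult_ac)
    qed
    with H T show ?thesis by (simp only:)
  qed
  have "((\<lambda>r. w * (of_int r ^ n * q powi r / (1 - w * Q powi r))) has_sum infsum ?f (UNIV \<times> UNIV)) UNIV"
    by (rule has_sum_SigmaD[OF S row])
  moreover have "((\<lambda>r. w * (of_int r ^ n * q powi r / (1 - w * Q powi r))) has_sum (w * phi n w q)) UNIV"
    by (intro has_sum_cmult_right phi_has_sum w1 qQ nq)
  ultimately have "infsum ?f (UNIV \<times> UNIV) = w * phi n w q" using has_sum_unique by blast
  with S show ?thesis by simp
qed

text \<open>Since \<open>q ^ m = Q ^ s * q\<close>, \<open>theta_mult_Q_power\<close> reduces
  \<open>theta (q ^ m)\<close> and \<open>theta (w * q ^ m)\<close> to \<open>theta\<close> at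
  \<open>q\<close> and \<open>w * q\<close>. The first reduction evaluates the determinant; the
  quotient of the two produces the shift by \<open>w ^ s\<close>.\<close>

lemma kiepert_at_q:
  assumes q: "q ^ 2 = Q" and m: "m = 2 * s + 1"
  shows "kiepert m q = (-1) ^ s * q ^ (s * (s + 1)) * (\<Prod>i=1..m-1. fact i)\<^sup>2 * triangle_series q ^ (2 * m\<^sup>2 - 2)"
    and "w \<in> ann \<Longrightarrow> w \<noteq> 1 \<Longrightarrow> tau m w q * w ^ s = kiepert m q * phi 0 w q"
proof -
  have q0: "q \<noteq> 0" using q Q_nonzero by auto
  have nQ: "norm Q = norm q ^ 2" using q by (metis norm_power)
  have nq: "norm q < 1" using norm_Q_less_1 unfolding nQ by (simp add: power_less_one_iff)
  have qQ: "norm Q < norm q" unfolding nQ using nq q0 by (simp add: power2_eq_square)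
  have qann: "q \<in> ann" using qQ nq one_less_inv_norm_Q by (simp add: ann_def)
  have q1: "q \<noteq> 1" using nq by auto
  have Eq: "euler_fn q \<noteq> 0" by (rule triangle_series_eq(2)[OF q])
  have "Q / q = q" using q q0 by (simp add: power2_eq_square field_simps)
  then have thq: "theta q = euler_fn q ^ 2" by (simp add: theta_def power2_eq_square)
  have qm: "q ^ m = Q ^ s * q" unfolding m q[symmetric] by (simp add: power_mult)
  define D where "D = Q ^ (s * (s - 1) div 2)"
  have D0: "D \<noteq> 0" using Q_nonzero by (simp add: D_def)
  have thqm: "theta (q ^ m) = (-1) ^ s * theta q / (q ^ s * D)"
    unfolding qm D_def by (rule theta_mult_Q_power[OF q0])
  have thq0: "theta q \<noteq> 0" using thq Eq by simp
  have thqm0: "theta (q ^ m) \<noteq> 0" unfolding thqm using thq0 q0 D0 by simp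
  have m0: "m > 0" using m by simp
  have tri: "kappa / theta q = triangle_series q ^ 2"
    unfolding triangle_series_eq(1)[OF q] thq kappa_def by (simp add: power_divide)
  have DD: "q ^ s * D = q ^ (s * s)"
  proof -
    have "even (s * (s - 1))" by (cases s) auto
    then have "D = q ^ (s * (s - 1))"
      unfolding D_def q[symmetric] power_mult[symmetric] by simp
    then show ?thesis by (simp add: power_add[symmetric]) (cases s; simp)
  qed
  have "kiepert m q * theta q ^ (m\<^sup>2) =
    kappa ^ (m\<^sup>2 - 1) * (\<Prod>i=1..m-1. fact i)\<^sup>2 * q ^ (m * (m - 1) div 2) * theta (q ^ m)"
    by (rule kiepert_formula[OF m0 qann thqm0])
  \<comment> \<open>The part \<open>s * s\<close> of the exponent cancels the power of
    \<open>q\<close> in \<open>theta (q ^ m)\<close>; \<open>s * (s + 1)\<close>, which is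
    \<open>(m^2 - 1) / 4\<close>, remains.\<close>
  also have "m * (m - 1) div 2 = s * (s + 1) + s * s" by (simp add: m algebra_simps)
  also have "q ^ (s * (s + 1) + s * s) = q ^ (s * (s + 1)) * q ^ (s * s)" by (rule power_add)
  finally have "kiepert m q * theta q ^ (m\<^sup>2) =
     (-1) ^ s * q ^ (s * (s + 1)) * (\<Prod>i=1..m-1. fact i)\<^sup>2 * kappa ^ (m\<^sup>2 - 1) * theta q"
    unfolding thqm DD using q0 by (simp add: mult_ac)
  moreover have "theta q ^ (m\<^sup>2) = theta q ^ (m\<^sup>2 - 1) * theta q"
  proof -
    have "m\<^sup>2 = Suc (m\<^sup>2 - 1)" using m0 by simp
    then show ?thesis by (metis power_Suc2)
  qed
  ultimately have "kiepert m q * theta q ^ (m\<^sup>2 - 1) =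
     (-1) ^ s * q ^ (s * (s + 1)) * (\<Prod>i=1..m-1. fact i)\<^sup>2 * kappa ^ (m\<^sup>2 - 1)"
    using thq0 by (simp add: mult.assoc[symmetric])
  then have "kiepert m q = (-1) ^ s * q ^ (s * (s + 1)) * (\<Prod>i=1..m-1. fact i)\<^sup>2 * (kappa / theta q) ^ (m\<^sup>2 - 1)"
    using thq0 by (simp add: power_divide field_simps)
  also have "(kappa / theta q) ^ (m\<^sup>2 - 1) = triangle_series q ^ (2 * m\<^sup>2 - 2)"
    unfolding tri power_mult[symmetric] by (simp add: diff_mult_distrib2)
  finally show "kiepert m q = (-1) ^ s * q ^ (s * (s + 1)) * (\<Prod>i=1..m-1. fact i)\<^sup>2 * triangle_series q ^ (2 * m\<^sup>2 - 2)" .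
  assume w: "w \<in> ann" "w \<noteq> 1"
  have w0: "w \<noteq> 0" using ann_nonzero w by blast
  have thw: "theta w \<noteq> 0" by (rule theta_nonzero_ann[OF w])
  have wqm: "w * q ^ m = Q ^ s * (w * q)" unfolding qm by simp
  have thwqm: "theta (w * q ^ m) = (-1) ^ s * theta (w * q) / ((w * q) ^ s * D)"
    unfolding wqm D_def by (rule theta_mult_Q_power) (use w0 q0 in simp)
  \<comment> \<open>The case of size 1 is Kronecker's formula; it converts the theta quotient back
    to \<open>phi 0\<close>.\<close>
  have "kiepert 1 q = 1" "tau 1 w q = phi 0 w q"
    by (simp_all add: kiepert_def tau_def hankel_det_def det_single)
  with tau_theta[of 1, OF _ w qann q1]
  have one: "kappa * theta (w * q) = phi 0 w q * theta w * theta q" by simp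
  have "kiepert m q * kappa * theta (w * q ^ m) = tau m w q * theta w * theta (q ^ m)"
    by (rule tau_theta[OF m0 w qann q1])
  then have "kiepert m q * (kappa * theta (w * q)) = tau m w q * w ^ s * theta w * theta q"
    unfolding thwqm thqm using q0 w0 D0 by (simp add: power_mult_distrib field_simps)
  then have "(kiepert m q * phi 0 w q) * (theta w * theta q) = (tau m w q * w ^ s) * (theta w * theta q)"
    unfolding one by (simp add: mult_ac)
  then show "tau m w q * w ^ s = kiepert m q * phi 0 w q" using thw thq0 by simp
qed

end

section \<open>Constant terms and sums over vectors\<close>

text \<open>By orthogonality of the \<open>N\<close>-th roots of unity the average is exact as soon
  as \<open>N > \<bar>e\<bar>\<close>.\<close>

lemma root_of_unity_average:
  fixes e :: int
  defines "d \<equiv> \<lambda>N. (\<Sum>j<N. cis (2 * pi * of_nat j / of_nat N) powi e) / of_nat N"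
  shows "norm (d N) \<le> 1" and "(d \<longlongrightarrow> (if e = 0 then 1 else 0)) sequentially"
proof -
  have "norm (\<Sum>j<N. cis (2 * pi * of_nat j / of_nat N) powi e) \<le> (\<Sum>j<N. 1)"
    by (rule sum_norm_le) (simp add: norm_power_int)
  then show "norm (d N) \<le> 1" by (cases "N = 0") (auto simp: d_def norm_divide divide_simps)
  have "eventually (\<lambda>N. d N = (if e = 0 then 1 else 0)) sequentially"
    using eventually_gt_at_top[of "nat \<bar>e\<bar>"]
  proof eventually_elim
    case (elim N)
    then have N: "N > 0" "\<bar>e\<bar> < int N" by auto
    show ?case
    proof (cases "e = 0")
      case True
      then show ?thesis using N by (simp add: d_def)
    next
      case False
      define x where "x = cis (2 * pi * of_int e / of_nat N)"
      have "cis (2 * pi * of_nat j / of_nat N) powi e = x ^ j" for j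
      proof -
        have "cis (2 * pi * of_nat j / of_nat N) powi e = cis (of_int e * (2 * pi * of_nat j / of_nat N))"
          by (rule cis_power_int)
        also have "of_int e * (2 * pi * of_nat j / of_nat N) = of_nat j * (2 * pi * of_int e / of_nat N)"
          by simp
        also have "cis \<dots> = x ^ j" unfolding x_def by (rule Complex.DeMoivre[symmetric])
        finally show ?thesis .
      qed
      then have "d N = (\<Sum>j<N. x ^ j) / of_nat N" by (simp add: d_def)
      moreover have "x ^ N = 1"
        using N by (simp add: x_def Complex.DeMoivre)
      moreover have "x \<noteq> 1"
      proof
        assume "x = 1"
        then obtain k :: int where "2 * pi * of_int e / of_nat N = 2 * pi * of_int k"
          unfolding x_def cis_conv_exp exp_eq_1 by (auto simp: mult_ac)
        then have "of_int e = (of_int k * of_nat N :: real)" using N by (simp add: field_simps)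
        then have "e = k * int N" by (metis of_int_eq_iff of_int_mult of_int_of_nat_eq)
        then have "int N dvd e" by simp
        then show False using N False zdvd_not_zless[of "\<bar>e\<bar>" "int N"] by auto
      qed
      ultimately show ?thesis using False by (simp add: geometric_sum)
    qed
  qed
  then show "(d \<longlongrightarrow> (if e = 0 then 1 else 0)) sequentially"
    by (rule tendsto_eventually)
qed

text \<open>Averages over roots of unity take the place of a contour integral. Each term converges
  and all are dominated by \<open>norm (c i)\<close>, so limit and sum may be exchanged.\<close>

lemma constant_term_limit:
  fixes c :: "'i \<Rightarrow> complex" and e :: "'i \<Rightarrow> int"
  assumes c: "(\<lambda>i. norm (c i)) summable_on I"
  shows "(\<lambda>N. (\<Sum>j<N. \<Sum>\<^sub>\<infinity>i\<in>I. c i * cis (2 * pi * of_nat j / of_nat N) powi e i) / of_nat N)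
           \<longlonglongrightarrow> (\<Sum>\<^sub>\<infinity>i\<in>{i\<in>I. e i = 0}. c i)"
proof -
  define d where "d = (\<lambda>N i. (\<Sum>j<N. cis (2 * pi * of_nat j / of_nat N) powi e i) / of_nat N)"
  have d1: "norm (d N i) \<le> 1" for N i unfolding d_def by (rule root_of_unity_average(1))
  have d2: "(\<lambda>N. d N i) \<longlonglongrightarrow> (if e i = 0 then 1 else 0)" for i
    unfolding d_def by (rule root_of_unity_average(2))
  have sm: "(\<lambda>i. c i * z i) summable_on I" if "\<And>i. norm (z i) \<le> 1" for z
  proof (rule abs_summable_summable, rule Infinite_Sum.abs_summable_on_comparison_test'[OF c])
    show "norm (c i * z i) \<le> norm (c i)" for i
      using that[of i] by (simp add: norm_mult mult_left_le)
  qed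
  have "(\<Sum>j<N. \<Sum>\<^sub>\<infinity>i\<in>I. c i * cis (2 * pi * of_nat j / of_nat N) powi e i) / of_nat N = (\<Sum>\<^sub>\<infinity>i\<in>I. c i * d N i)" for N
  proof -
    have "((\<lambda>i. \<Sum>j<N. c i * cis (2 * pi * of_nat j / of_nat N) powi e i) has_sum
        (\<Sum>j<N. \<Sum>\<^sub>\<infinity>i\<in>I. c i * cis (2 * pi * of_nat j / of_nat N) powi e i)) I"
      by (intro has_sum_finite_sum has_sum_infsum sm) (simp add: norm_power_int)
    from has_sum_cmult_left[OF this, of "1 / of_nat N"]
    have "((\<lambda>i. c i * d N i) has_sum
        (\<Sum>j<N. \<Sum>\<^sub>\<infinity>i\<in>I. c i * cis (2 * pi * of_nat j / of_nat N) powi e i) / of_nat N) I"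
      by (simp add: d_def sum_distrib_left)
    then show ?thesis by (simp add: infsumI)
  qed
  moreover have "(\<lambda>N. \<Sum>\<^sub>\<infinity>i\<in>I. c i * d N i) \<longlonglongrightarrow> (\<Sum>\<^sub>\<infinity>i\<in>I. c i * (if e i = 0 then 1 else 0))"
  proof (rule swap_uniform_limit')
    show "\<forall>\<^sub>F X in finite_subsets_at_top I. (\<lambda>N. \<Sum>i\<in>X. c i * d N i) \<longlonglongrightarrow> (\<Sum>i\<in>X. c i * (if e i = 0 then 1 else 0))"
      by (intro always_eventually allI tendsto_sum tendsto_mult tendsto_const d2)
    show "((\<lambda>X. \<Sum>i\<in>X. c i * (if e i = 0 then 1 else 0)) \<longlongrightarrow> (\<Sum>\<^sub>\<infinity>i\<in>I. c i * (if e i = 0 then 1 else 0))) (finite_subsets_at_top I)"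
      by (rule infsum_tendsto, rule sm) auto
    show "uniform_limit UNIV (\<lambda>X N. \<Sum>i\<in>X. c i * d N i) (\<lambda>N. \<Sum>\<^sub>\<infinity>i\<in>I. c i * d N i) (finite_subsets_at_top I)"
      by (rule Weierstrass_m_test_general[OF _ c]) (use d1 in \<open>simp add: norm_mult mult_left_le\<close>)
  qed auto
  moreover have "(\<Sum>\<^sub>\<infinity>i\<in>I. c i * (if e i = 0 then 1 else 0)) = (\<Sum>\<^sub>\<infinity>i\<in>{i\<in>I. e i = 0}. c i)"
    by (rule infsum_cong_neutral) auto
  ultimately show ?thesis by simp
qed

lemma constant_terms_eq:
  fixes c :: "'i \<Rightarrow> complex" and c' :: "'k \<Rightarrow> complex" and e :: "'i \<Rightarrow> int" and e' :: "'k \<Rightarrow> int"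
  assumes "(\<lambda>i. norm (c i)) summable_on I" "(\<lambda>i. norm (c' i)) summable_on I'"
    and "\<And>z. norm z = 1 \<Longrightarrow> (\<Sum>\<^sub>\<infinity>i\<in>I. c i * z powi e i) = (\<Sum>\<^sub>\<infinity>i\<in>I'. c' i * z powi e' i)"
  shows "(\<Sum>\<^sub>\<infinity>i\<in>{i\<in>I. e i = 0}. c i) = (\<Sum>\<^sub>\<infinity>i\<in>{i\<in>I'. e' i = 0}. c' i)"
  using constant_term_limit[OF assms(1), of e] constant_term_limit[OF assms(2), of e'] assms(3)
  by (simp add: LIMSEQ_unique)

section \<open>Heine's formula for Hankel determinants of moments\<close>

lemma prod_sq_diff_eq_vandermonde:
  fixes r :: "nat \<Rightarrow> int"
  shows "(\<Prod>(i, j)\<in>{(i, j). 1 \<le> i \<and> i < j \<and> j \<le> m}. of_int ((r i - r j)\<^sup>2)) =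
    (Determinant.det (Matrix.mat m m (\<lambda>(i, j). complex_of_int (r (Suc i)) ^ j)))\<^sup>2"
proof -
  have "(Determinant.det (Matrix.mat m m (\<lambda>(i, j). complex_of_int (r (Suc i)) ^ j)))\<^sup>2 =
      (\<Prod>j = 0..<m. \<Prod>i = 0..<j. (complex_of_int (r (Suc j)) - of_int (r (Suc i)))\<^sup>2)"
    unfolding vandermonde_det by (simp add: prod_power_distrib)
  also have "\<dots> = (\<Prod>(j, i)\<in>Sigma {0..<m} (\<lambda>j. {0..<j}). (complex_of_int (r (Suc j)) - of_int (r (Suc i)))\<^sup>2)"
    by (rule prod.Sigma) auto
  also have "\<dots> = (\<Prod>(i, j)\<in>{(i, j). 1 \<le> i \<and> i < j \<and> j \<le> m}. of_int ((r i - r j)\<^sup>2))"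
    by (rule prod.reindex_bij_witness[of _ "\<lambda>(i, j). (j - 1, i - 1)" "\<lambda>(j, i). (Suc i, Suc j)"])
       (auto simp: power2_commute)
  finally show ?thesis by simp
qed

text \<open>For fixed \<open>\<sigma>\<close> the inner sum is a determinant with rows permuted by
  \<open>\<sigma>\<close>, whose sign is cancelled by \<open>signof \<sigma>\<close>; all
  \<open>m!\<close> choices contribute equally.\<close>

lemma sum_sum_permutations_hankel:
  fixes F :: "nat \<Rightarrow> complex"
  shows "(\<Sum>\<sigma> | \<sigma> permutes {0..<m}. \<Sum>\<tau> | \<tau> permutes {0..<m}.
      signof \<sigma> * signof \<tau> * (\<Prod>i = 0..<m. F (\<sigma> i + \<tau> i))) = fact m * hankel_det m F"
proof -
  have "(\<Sum>\<tau> | \<tau> permutes {0..<m}. signof \<sigma> * signof \<tau> * (\<Prod>i = 0..<m. F (\<sigma> i + \<tau> i))) = hankel_det m F"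
    if "\<sigma> permutes {0..<m}" for \<sigma>
  proof -
    let ?A = "Matrix.mat m m (\<lambda>(i, j). F (i + j))"
    have "(\<Sum>\<tau> | \<tau> permutes {0..<m}. signof \<sigma> * signof \<tau> * (\<Prod>i = 0..<m. F (\<sigma> i + \<tau> i))) =
        signof \<sigma> * Determinant.det (Matrix.mat m m (\<lambda>(i, j). F (\<sigma> i + j)))"
      unfolding det_mat_permutations by (simp add: sum_distrib_left mult.assoc)
    also have "Matrix.mat m m (\<lambda>(i, j). F (\<sigma> i + j)) = Matrix.mat m m (\<lambda>(i, j). ?A $$ (\<sigma> i, j))"
      using permutes_in_image[OF that] by (intro eq_matI) auto
    also have "Determinant.det \<dots> = signof \<sigma> * Determinant.det ?A"
      by (rule det_permute_rows[OF _ that]) auto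
    also have "signof \<sigma> * (signof \<sigma> * Determinant.det ?A) = hankel_det m F"
      by (simp add: hankel_det_def sign_def)
    finally show ?thesis .
  qed
  then show ?thesis by (simp add: card_permutations[of "{0..<m}" m])
qed

text \<open>Heine's formula with a double series as moment functional: the squared Vandermonde
  product is a double sum over permutations, and for each pair of them the sum over vectors factors
  into one moment per coordinate.\<close>

lemma vector_sum_hankel:
  fixes v :: "int \<times> int \<Rightarrow> complex" and m :: nat
  assumes v: "\<And>n. (\<lambda>p. norm (of_int (fst p) ^ n * v p)) summable_on UNIV"
  defines "V \<equiv> \<lambda>P. (\<Prod>(i, j)\<in>{(i, j). 1 \<le> i \<and> i < j \<and> j \<le> m}. of_int ((fst (P i) - fst (P j))\<^sup>2)) * (\<Prod>j = 1..m. v (P j))"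
  shows "(\<lambda>P. norm (V P)) summable_on PiE {1..m} (\<lambda>_. UNIV)"
    and "infsum V (PiE {1..m} (\<lambda>_. UNIV)) = fact m * hankel_det m (\<lambda>n. \<Sum>\<^sub>\<infinity>p. of_int (fst p) ^ n * v p)"
proof -
  let ?W = "PiE {1..m} (\<lambda>_. UNIV :: (int \<times> int) set)"
  let ?S = "{\<sigma>. \<sigma> permutes {0..<m}}"
  define F where "F = (\<lambda>n. \<Sum>\<^sub>\<infinity>p. of_int (fst p) ^ n * v p)"
  define T where "T = (\<lambda>\<sigma> \<tau> P. \<Prod>j = 1..m. of_int (fst (P j)) ^ (\<sigma> (j - 1) + \<tau> (j - 1)) * v (P j))"
  have V: "V P = (\<Sum>\<sigma>\<in>?S. \<Sum>\<tau>\<in>?S. signof \<sigma> * signof \<tau> * T \<sigma> \<tau> P)" for P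
  proof -
    let ?X = "\<Sum>\<sigma>\<in>?S. \<Sum>\<tau>\<in>?S. (signof \<sigma> * (\<Prod>i = 0..<m. complex_of_int (fst (P (Suc i))) ^ \<sigma> i)) *
         (signof \<tau> * (\<Prod>i = 0..<m. complex_of_int (fst (P (Suc i))) ^ \<tau> i))"
    have e1: "(\<Prod>(i, j)\<in>{(i, j). 1 \<le> i \<and> i < j \<and> j \<le> m}. of_int ((fst (P i) - fst (P j))\<^sup>2)) = ?X"
      unfolding prod_sq_diff_eq_vandermonde[of "\<lambda>i. fst (P i)"] det_mat_permutations prod.case
      unfolding sum_product[symmetric] by (rule power2_eq_square)
    have "(\<Prod>i = 0..<m. complex_of_int (fst (P (Suc i))) ^ \<sigma> i) = (\<Prod>j = 1..m. complex_of_int (fst (P j)) ^ \<sigma> (j - 1))" for \<sigma>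
      by (rule prod.reindex_bij_witness[of _ "\<lambda>j. j - 1" Suc]) auto
    then have "?X * (\<Prod>j = 1..m. v (P j)) = (\<Sum>\<sigma>\<in>?S. \<Sum>\<tau>\<in>?S. signof \<sigma> * signof \<tau> * T \<sigma> \<tau> P)"
      unfolding sum_distrib_right by (intro sum.cong refl) (simp add: T_def prod.distrib power_add mult_ac)
    then show ?thesis unfolding V_def e1 .
  qed
  have Tsum: "(\<lambda>P. norm (T \<sigma> \<tau> P)) summable_on ?W" for \<sigma> \<tau>
    unfolding T_def
    by (rule abs_summable_equivalent[THEN iffD2], rule abs_summable_on_prod_PiE)
       (simp, simp, rule abs_summable_equivalent[THEN iffD1, OF v])
  have Tval: "infsum (T \<sigma> \<tau>) ?W = (\<Prod>i = 0..<m. F (\<sigma> i + \<tau> i))" for \<sigma> \<tau>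
  proof -
    have "infsum (T \<sigma> \<tau>) ?W = (\<Prod>j = 1..m. F (\<sigma> (j - 1) + \<tau> (j - 1)))"
      unfolding T_def F_def by (rule infsum_prod_PiE_abs) (simp, rule v)
    also have "\<dots> = (\<Prod>i = 0..<m. F (\<sigma> i + \<tau> i))"
      by (rule prod.reindex_bij_witness[of _ Suc "\<lambda>j. j - 1"]) auto
    finally show ?thesis .
  qed
  have "((\<lambda>P. \<Sum>\<sigma>\<in>?S. \<Sum>\<tau>\<in>?S. norm (T \<sigma> \<tau> P)) has_sum (\<Sum>\<sigma>\<in>?S. \<Sum>\<tau>\<in>?S. infsum (\<lambda>P. norm (T \<sigma> \<tau> P)) ?W)) ?W"
    by (intro has_sum_finite_sum has_sum_infsum Tsum)
  then have "(\<lambda>P. \<Sum>\<sigma>\<in>?S. \<Sum>\<tau>\<in>?S. norm (T \<sigma> \<tau> P)) summable_on ?W" by (rule has_sum_imp_summable)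
  then show "(\<lambda>P. norm (V P)) summable_on ?W"
  proof (rule Infinite_Sum.abs_summable_on_comparison_test')
    fix P
    have "norm (signof \<sigma> :: complex) = 1" for \<sigma> :: "nat \<Rightarrow> nat" by (simp add: sign_def)
    then show "norm (V P) \<le> (\<Sum>\<sigma>\<in>?S. \<Sum>\<tau>\<in>?S. norm (T \<sigma> \<tau> P))"
      unfolding V by (intro sum_norm_le) (simp add: norm_mult)
  qed
  have "((\<lambda>P. \<Sum>\<sigma>\<in>?S. \<Sum>\<tau>\<in>?S. signof \<sigma> * signof \<tau> * T \<sigma> \<tau> P) has_sum
      (\<Sum>\<sigma>\<in>?S. \<Sum>\<tau>\<in>?S. signof \<sigma> * signof \<tau> * infsum (T \<sigma> \<tau>) ?W)) ?W"
    by (intro has_sum_finite_sum has_sum_cmult_right has_sum_infsum) (rule abs_summable_summable[OF Tsum])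
  then show "infsum V ?W = fact m * hankel_det m (\<lambda>n. \<Sum>\<^sub>\<infinity>p. of_int (fst p) ^ n * v p)"
    unfolding V Tval sum_sum_permutations_hankel unfolding F_def by (rule infsumI)
qed

definition vec_coeff :: "nat \<Rightarrow> complex \<Rightarrow> (nat \<Rightarrow> int \<times> int) \<Rightarrow> complex" where
  "vec_coeff m q P = (\<Prod>(i, j)\<in>{(i, j). 1 \<le> i \<and> i < j \<and> j \<le> m}. of_int ((fst (P i) - fst (P j))\<^sup>2)) *
     (\<Prod>j = 1..m. kr_term q (P j))"

definition zero_sum_vecs :: "nat \<Rightarrow> (nat \<Rightarrow> int \<times> int) set" where
  "zero_sum_vecs m = {P \<in> PiE {1..m} (\<lambda>_. UNIV). (\<Sum>j = 1..m. snd (P j)) = 0}"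

lemma power_int_sum:
  fixes w :: complex
  assumes "w \<noteq> 0" "finite A"
  shows "(\<Prod>j\<in>A. w powi f j) = w powi (\<Sum>j\<in>A. f j)"
  using assms(2) by (induction A rule: finite_induct) (simp_all add: power_int_add assms(1))

text \<open>The vector series at \<open>w\<close> is \<open>m!\<close> times
  \<open>w ^ m * tau m w q\<close>, which \<open>kiepert_at_q\<close> turns into
  \<open>m! * C * w ^ s * (w * phi 0 w q)\<close>. Comparing constant terms on one circle leaves the
  coefficient of index \<open>-s\<close> of the one-dimensional series.\<close>

lemma vec_coeff_infsum:
  assumes q: "q \<noteq> 0" "norm q < 1" and m: "m = 2 * s + 1"
  shows "(\<lambda>P. norm (vec_coeff m q P)) summable_on zero_sum_vecs m"
    and "(\<Sum>\<^sub>\<infinity>P\<in>zero_sum_vecs m. vec_coeff m q P) =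
      - (fact m * ((-1) ^ s * q ^ (s * (s + 1)) * (\<Prod>i=1..m-1. fact i)\<^sup>2 * triangle_series q ^ (2 * m\<^sup>2 - 2)) / (1 - q ^ m))"
proof -
  interpret nome "q ^ 2"
    by standard (use q in \<open>auto simp: norm_power power_less_one_iff\<close>)
  define C where "C = kiepert m q"
  let ?W = "PiE {1..m} (\<lambda>_. UNIV :: (int \<times> int) set)"
  let ?e = "\<lambda>P :: nat \<Rightarrow> int \<times> int. \<Sum>j = 1..m. snd (P j)"
  \<comment> \<open>A radius at which all the double series converge absolutely. The powers of
    \<open>\<rho>\<close> disappear from the constant terms, where the exponent is 0.\<close>
  obtain \<rho> where \<rho>: "1 < \<rho>" "\<rho> < 1 / norm (q ^ 2)" using dense[OF one_less_inv_norm_Q] by blast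
  define c where "c = (\<lambda>P. vec_coeff m q P * of_real \<rho> powi ?e P)"
  define c' where "c' = (\<lambda>p. fact m * C * kr_term q p * of_real \<rho> powi (snd p + int s))"
  have w: "1 < norm (of_real \<rho> * z)" "norm (of_real \<rho> * z) < 1 / norm (q ^ 2)" "of_real \<rho> * z \<noteq> 0"
    if "norm z = 1" for z :: complex
    using \<rho> that by (auto simp: norm_mult)
  have v: "(\<lambda>p. norm (of_int (fst p) ^ n * (kr_term q p * w powi snd p))) summable_on UNIV"
    if "1 < norm w" "norm w < 1 / norm (q ^ 2)" for n w
    using kr_term_abs_summable[OF q that(1), of n] that(2) by (simp add: norm_power)
  have prodw: "(\<Prod>(i, j)\<in>{(i, j). 1 \<le> i \<and> i < j \<and> j \<le> m}. of_int ((fst (P i) - fst (P j))\<^sup>2)) *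
      (\<Prod>j = 1..m. kr_term q (P j) * w powi snd (P j)) = vec_coeff m q P * w powi ?e P" if "w \<noteq> 0" for w P
    using power_int_sum[OF that, of "{1..m}" "\<lambda>j. snd (P j)"] by (simp add: vec_coeff_def prod.distrib)
  have c_eq: "vec_coeff m q P * (of_real \<rho> * z) powi ?e P = c P * z powi ?e P" for P z
    by (simp add: c_def power_int_mult_distrib)
  have sum1: "(\<lambda>P. norm (c P)) summable_on ?W"
  proof -
    have "(\<lambda>P. norm (vec_coeff m q P * (of_real \<rho> * 1) powi ?e P)) summable_on ?W"
      using vector_sum_hankel(1)[OF v[OF w(1,2)[OF norm_one]], of m] unfolding prodw[OF w(3)[OF norm_one]] .
    then show ?thesis unfolding c_eq by simp
  qed
  have val1: "(\<Sum>\<^sub>\<infinity>P\<in>?W. c P * z powi ?e P) = fact m * C * (of_real \<rho> * z) ^ s * (of_real \<rho> * z * phi 0 (of_real \<rho> * z) q)"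
    if z: "norm z = 1" for z
  proof -
    let ?w = "of_real \<rho> * z"
    have wa: "?w \<in> ann" "?w \<noteq> 1" using ann_mult_Q[OF w(1,2)[OF z]] w(1)[OF z] by auto
    have ph: "(\<Sum>\<^sub>\<infinity>p. of_int (fst p) ^ n * (kr_term q p * ?w powi snd p)) = ?w * phi n ?w q" for n
      using kr_term_has_sum[OF refl w(1,2)[OF z], of n] by (simp add: infsumI)
    have "(\<Sum>\<^sub>\<infinity>P\<in>?W. c P * z powi ?e P) = fact m * hankel_det m (\<lambda>n. ?w * phi n ?w q)"
      using vector_sum_hankel(2)[OF v[OF w(1,2)[OF z]], of m]
      unfolding prodw[OF w(3)[OF z]] c_eq ph .
    also have "hankel_det m (\<lambda>n. ?w * phi n ?w q) = ?w ^ m * tau m ?w q"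
      unfolding hankel_det_cmult tau_def ..
    also have "?w ^ m * tau m ?w q = ?w ^ (s + 1) * (tau m ?w q * ?w ^ s)"
    proof -
      have "m = (s + 1) + s" using m by simp
      then have "?w ^ m = ?w ^ (s + 1) * ?w ^ s" by (simp only: power_add)
      then show ?thesis by (simp only: mult_ac)
    qed
    also have "tau m ?w q * ?w ^ s = C * phi 0 ?w q"
      unfolding C_def by (rule kiepert_at_q(2)[OF refl m wa])
    finally show ?thesis by (simp add: mult_ac)
  qed
  have c'_eq: "c' p * z powi (snd p + int s) = (fact m * C * (of_real \<rho> * z) ^ s) * (of_int (fst p) ^ 0 * (kr_term q p * (of_real \<rho> * z) powi snd p))"
    if z: "norm z = 1" for p z
  proof -
    have "of_real \<rho> powi (snd p + int s) * z powi (snd p + int s) = (of_real \<rho> * z) powi (snd p + int s)"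
      by (simp add: power_int_mult_distrib)
    also have "\<dots> = (of_real \<rho> * z) powi snd p * (of_real \<rho> * z) ^ s"
      using w(3)[OF z] by (simp add: power_int_add)
    finally have "of_real \<rho> powi (snd p + int s) * z powi (snd p + int s) = (of_real \<rho> * z) powi snd p * (of_real \<rho> * z) ^ s" .
    moreover have "c' p * z powi (snd p + int s) = fact m * C * kr_term q p * (of_real \<rho> powi (snd p + int s) * z powi (snd p + int s))"
      by (simp only: c'_def mult.assoc)
    ultimately show ?thesis by (simp only: mult_ac power_0 mult_1)
  qed
  have val2: "(\<Sum>\<^sub>\<infinity>p. c' p * z powi (snd p + int s)) = fact m * C * (of_real \<rho> * z) ^ s * (of_real \<rho> * z * phi 0 (of_real \<rho> * z) q)"
    if z: "norm z = 1" for z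
    unfolding c'_eq[OF z]
    using has_sum_cmult_right[OF kr_term_has_sum[OF refl w(1,2)[OF z], of 0]] by (intro infsumI) simp
  have sum2: "(\<lambda>p. norm (c' p)) summable_on UNIV"
  proof -
    have "(\<lambda>p. norm (fact m * C * (of_real \<rho> * 1) ^ s) * norm (of_int (fst p) ^ 0 * (kr_term q p * (of_real \<rho> * 1) powi snd p))) summable_on UNIV"
      by (rule summable_on_cmult_right[OF v[OF w(1,2)]]) auto
    then have "(\<lambda>p. norm (c' p * 1 powi (snd p + int s))) summable_on UNIV"
      unfolding c'_eq[OF norm_one] norm_mult[of "fact m * C * (of_real \<rho> * 1) ^ s"] .
    then show ?thesis by simp
  qed
  have zero: "zero_sum_vecs m = {P \<in> ?W. ?e P = 0}" by (simp add: zero_sum_vecs_def)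
  have "(\<lambda>P. norm (c P)) summable_on zero_sum_vecs m"
    using sum1 by (rule summable_on_subset_banach) (auto simp: zero)
  moreover have "c P = vec_coeff m q P" if "P \<in> zero_sum_vecs m" for P
    using that by (simp add: c_def zero)
  ultimately show "(\<lambda>P. norm (vec_coeff m q P)) summable_on zero_sum_vecs m"
    by (metis (mono_tags, lifting) summable_on_cong)
  have "(\<Sum>\<^sub>\<infinity>P\<in>zero_sum_vecs m. vec_coeff m q P) = (\<Sum>\<^sub>\<infinity>P\<in>{P \<in> ?W. ?e P = 0}. c P)"
    unfolding zero by (rule infsum_cong) (simp add: c_def)
  also have "\<dots> = (\<Sum>\<^sub>\<infinity>p\<in>{p \<in> UNIV. snd p + int s = 0}. c' p)"
    by (rule constant_terms_eq[OF sum1 sum2]) (simp only: val1 val2)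
  also have "\<dots> = - (fact m * C / (1 - q ^ m))"
  proof -
    have "m > 0" using m by simp
    then have qm: "norm (q ^ m) < 1" using q by (simp add: norm_power power_less_one_iff)
    have "((\<lambda>n. - (fact m * C) * (q ^ m) ^ n) has_sum (- (fact m * C) * (1 / (1 - q ^ m)))) UNIV"
    proof (rule has_sum_cmult_right, rule norm_summable_imp_has_sum)
      show "summable (\<lambda>n. norm ((q ^ m) ^ n))"
        unfolding norm_power[of "q ^ m"] using qm by (intro summable_geometric) simp
      show "(\<lambda>n. (q ^ m) ^ n) sums (1 / (1 - q ^ m))" by (rule geometric_sums[OF qm])
    qed
    \<comment> \<open>At \<open>k = -s\<close> only \<open>r = -n \<le> 0\<close> has a nonzero
      sign, namely -1, and the exponent \<open>(-2 s - 1)(-n)\<close> is \<open>m n\<close>: a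
      geometric series in \<open>q ^ m\<close>.\<close>
    moreover have "c' (- int n, - int s) = - (fact m * C) * (q ^ m) ^ n" for n
    proof -
      have "(2 * (- int s) - 1) * (- int n) = int (m * n)" by (simp add: m algebra_simps)
      then show ?thesis
        by (simp only: c'_def kr_term_def prod.case quadrant_sign_def power_int_of_nat snd_conv power_mult) simp
    qed
    moreover have bij: "bij_betw (\<lambda>n. (- int n, - int s)) UNIV {p. snd p + int s = 0 \<and> fst p \<le> 0}"
      by (rule bij_betwI[of _ _ _ "\<lambda>p. nat (- fst p)"]) auto
    ultimately have "(c' has_sum (- (fact m * C) * (1 / (1 - q ^ m)))) {p. snd p + int s = 0 \<and> fst p \<le> 0}"
      by (subst has_sum_reindex_bij_betw[OF bij, symmetric]) simp
    then have "(\<Sum>\<^sub>\<infinity>p\<in>{p. snd p + int s = 0 \<and> fst p \<le> 0}. c' p) = - (fact m * C / (1 - q ^ m))"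
      by (simp add: infsumI)
    moreover have "(\<Sum>\<^sub>\<infinity>p\<in>{p \<in> UNIV. snd p + int s = 0}. c' p) = (\<Sum>\<^sub>\<infinity>p\<in>{p. snd p + int s = 0 \<and> fst p \<le> 0}. c' p)"
      by (rule infsum_cong_neutral) (auto simp: c'_def kr_term_def quadrant_sign_def split: prod.splits)
    ultimately show ?thesis by simp
  qed
  finally show "(\<Sum>\<^sub>\<infinity>P\<in>zero_sum_vecs m. vec_coeff m q P) =
      - (fact m * ((-1) ^ s * q ^ (s * (s + 1)) * (\<Prod>i=1..m-1. fact i)\<^sup>2 * triangle_series q ^ (2 * m\<^sup>2 - 2)) / (1 - q ^ m))"
    unfolding C_def kiepert_at_q(1)[OF refl m] .
qed

section \<open>The summands of the theorem\<close>

text \<open>Exchange against the block \<open>{- int s..int s}\<close>: elements of \<open>R\<close>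
  outside it have absolute value above \<open>s\<close>, elements of the block missing from
  \<open>R\<close> at most \<open>s\<close>, and there are equally many of both.\<close>

lemma sum_abs_distinct_ge:
  fixes R :: "int set"
  assumes "finite R" "card R = 2 * s + 1"
  shows "int (s * (s + 1)) \<le> (\<Sum>x\<in>R. \<bar>x\<bar>)"
proof -
  define B where "B = {- int s..int s}"
  have cB: "card B = 2 * s + 1" and fB: "finite B" by (simp_all add: B_def)
  have sB: "(\<Sum>x\<in>B. \<bar>x\<bar>) = int (s * (s + 1))"
    unfolding B_def
  proof (induction s)
    case (Suc s)
    have "{- int (Suc s)..int (Suc s)} = insert (int (Suc s)) (insert (- int (Suc s)) {- int s..int s})" by auto
    with Suc show ?case by (simp add: algebra_simps)
  qed simp
  have "card (R - B) = card (B - R)"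
    using assms cB fB by (simp add: card_Diff_subset_Int Int_commute)
  moreover have "(\<Sum>x\<in>B - R. \<bar>x\<bar>) \<le> of_nat (card (B - R)) * int s"
    by (rule sum_bounded_above) (auto simp: B_def)
  moreover have "of_nat (card (R - B)) * int s \<le> (\<Sum>x\<in>R - B. \<bar>x\<bar>)"
    by (rule sum_bounded_below) (auto simp: B_def)
  moreover have "(\<Sum>x\<in>R. \<bar>x\<bar>) = (\<Sum>x\<in>R - B. \<bar>x\<bar>) + (\<Sum>x\<in>R \<inter> B. \<bar>x\<bar>)"
    using assms(1) by (subst sum.union_disjoint[symmetric]) (auto intro: sum.cong)
  moreover have "(\<Sum>x\<in>B. \<bar>x\<bar>) = (\<Sum>x\<in>B - R. \<bar>x\<bar>) + (\<Sum>x\<in>R \<inter> B. \<bar>x\<bar>)"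
    using fB by (subst sum.union_disjoint[symmetric]) (auto intro: sum.cong)
  ultimately show ?thesis using sB by simp
qed

definition pair_vec :: "nat \<Rightarrow> (nat \<Rightarrow> int) \<Rightarrow> (nat \<Rightarrow> int) \<Rightarrow> nat \<Rightarrow> int \<times> int" where
  "pair_vec m k r = (\<lambda>j\<in>{1..m}. (r j, append_neg_sum m k j))"

lemma append_neg_sum_less: "j \<in> {1..m-1} \<Longrightarrow> append_neg_sum m k j = k j"
  by (auto simp: append_neg_sum_def)

lemma sum_append_neg_sum:
  assumes "m > 0"
  shows "(\<Sum>j = 1..m. append_neg_sum m k j) = 0"
proof -
  have "{1..m} = insert m {1..m-1}" using assms by auto
  then have "(\<Sum>j = 1..m. append_neg_sum m k j) = append_neg_sum m k m + (\<Sum>j = 1..m-1. append_neg_sum m k j)"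
    using assms by simp
  also have "(\<Sum>j = 1..m-1. append_neg_sum m k j) = coord_sum (m - 1) k"
    unfolding coord_sum_def by (intro sum.cong refl append_neg_sum_less)
  finally show ?thesis by (simp add: append_neg_sum_def)
qed

lemma append_neg_sum_snd:
  assumes "m > 0" "P \<in> zero_sum_vecs m" "j \<in> {1..m}"
  shows "append_neg_sum m (\<lambda>j\<in>{1..m-1}. snd (P j)) j = snd (P j)"
proof (cases "j = m")
  case True
  have "{1..m} = insert m {1..m-1}" using assms(1) by auto
  then have "(\<Sum>j = 1..m. snd (P j)) = snd (P m) + (\<Sum>j = 1..m-1. snd (P j))" using assms(1) by simp
  then show ?thesis using assms(2) True by (simp add: append_neg_sum_def coord_sum_def zero_sum_vecs_def)
next
  case False
  then show ?thesis using assms(3) by (auto simp: append_neg_sum_def)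
qed

lemma q_exponent_eq:
  assumes m: "m = 2 * s + 1"
  shows "q_exponent m k r = (\<Sum>j = 1..m. (2 * append_neg_sum m k j - 1) * r j) - int (s * (s + 1))"
proof -
  have "{1..m} = insert m {1..m-1}" using m by auto
  then have "(\<Sum>j = 1..m. (2 * append_neg_sum m k j - 1) * r j) =
      (2 * append_neg_sum m k m - 1) * r m + (\<Sum>j = 1..m-1. (2 * append_neg_sum m k j - 1) * r j)"
    using m by simp
  also have "(\<Sum>j = 1..m-1. (2 * append_neg_sum m k j - 1) * r j) = (\<Sum>j = 1..m-1. (2 * k j - 1) * r j)"
    by (intro sum.cong refl) (simp add: append_neg_sum_less)
  also have "2 * append_neg_sum m k m - 1 = - (1 + 2 * coord_sum (m - 1) k)"
    by (simp add: append_neg_sum_def)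
  finally have "(\<Sum>j = 1..m. (2 * append_neg_sum m k j - 1) * r j) =
      - ((1 + 2 * coord_sum (m - 1) k) * r m) + (\<Sum>j = 1..m-1. (2 * k j - 1) * r j)"
    by (simp only: mult_minus_left)
  moreover have "((int m)\<^sup>2 - 1) div 4 = int (s * (s + 1))"
  proof -
    have "(int m)\<^sup>2 - 1 = 4 * int (s * (s + 1))" by (simp add: m power2_eq_square algebra_simps)
    then show ?thesis by simp
  qed
  ultimately show ?thesis unfolding q_exponent_def by simp
qed

context
  fixes m s :: nat and J :: "nat set" and k r :: "nat \<Rightarrow> int"
  assumes m: "m = 2 * s + 1" and J: "J \<subseteq> {1..m}"
    and k: "k \<in> k_range m J" and r: "r \<in> int_vectors_J m J"
begin

lemma sign_classes:
  assumes "j \<in> {1..m}"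
  shows "append_neg_sum m k j \<le> 0 \<longleftrightarrow> j \<in> J" "r j \<le> 0 \<longleftrightarrow> j \<in> J"
  using k r assms by (auto simp: k_range_def int_vectors_J_def)

text \<open>A nonzero Vandermonde factor makes the \<open>r j\<close> distinct, and equal sign
  classes give \<open>(2 k_j - 1) r_j \<ge> \<bar>r_j\<bar>\<close>. The subtracted constant is
  exactly the least sum of absolute values of \<open>m\<close> distinct integers. The passage to
  \<open>q = 0\<close> depends on this.\<close>

lemma q_exponent_nonneg:
  assumes "summand m q k r \<noteq> 0"
  shows "q_exponent m k r \<ge> 0"
proof -
  have fin: "finite {(i, j). 1 \<le> i \<and> i < j \<and> j \<le> m}"
    by (rule finite_subset[of _ "{1..m} \<times> {1..m}"]) auto
  have "r i \<noteq> r j" if "1 \<le> i" "i < j" "j \<le> m" for i j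
    using assms that prod_zero[OF fin, of "\<lambda>(i, j). complex_of_int ((r i - r j)\<^sup>2)"]
    unfolding summand_def by (fastforce simp: fin)
  then have inj: "inj_on r {1..m}"
    by (intro linorder_inj_onI) auto
  have "int (s * (s + 1)) \<le> (\<Sum>x\<in>r ` {1..m}. \<bar>x\<bar>)"
    using inj m by (intro sum_abs_distinct_ge) (auto simp: card_image)
  also have "\<dots> = (\<Sum>j = 1..m. \<bar>r j\<bar>)" using inj by (simp add: sum.reindex)
  also have "\<dots> \<le> (\<Sum>j = 1..m. (2 * append_neg_sum m k j - 1) * r j)"
  proof (rule sum_mono)
    fix j assume j: "j \<in> {1..m}"
    let ?a = "append_neg_sum m k j"
    show "\<bar>r j\<bar> \<le> (2 * ?a - 1) * r j"
    proof (cases "j \<in> J")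
      case True
      then have "?a \<le> 0" "r j \<le> 0" using sign_classes[OF j] by auto
      then have "1 * (- r j) \<le> (1 - 2 * ?a) * (- r j)" by (intro mult_right_mono) auto
      then show ?thesis using \<open>r j \<le> 0\<close> by (simp add: algebra_simps)
    next
      case False
      then have "?a > 0" "r j > 0" using sign_classes[OF j] by auto
      then have "1 * r j \<le> (2 * ?a - 1) * r j" by (intro mult_right_mono) auto
      then show ?thesis using \<open>r j > 0\<close> by simp
    qed
  qed
  finally show ?thesis unfolding q_exponent_eq[OF m] by simp
qed

text \<open>The signs of the \<open>kr_term\<close> factors multiply to
  \<open>(-1) ^ card J\<close>: this is where the alternating sum over \<open>J\<close> comes
  from.\<close>

lemma summand_eq_vec_coeff:
  assumes "q \<noteq> 0"
  shows "summand m q k r = (-1) ^ card J / q ^ (s * (s + 1)) * vec_coeff m q (pair_vec m k r)"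
proof -
  let ?a = "append_neg_sum m k"
  have "(\<Prod>j = 1..m. kr_term q (pair_vec m k r j)) = (\<Prod>j = 1..m. (if j \<in> J then -1 else 1) * q powi ((2 * ?a j - 1) * r j))"
  proof (intro prod.cong refl)
    fix j assume j: "j \<in> {1..m}"
    then show "kr_term q (pair_vec m k r j) = (if j \<in> J then -1 else 1) * q powi ((2 * ?a j - 1) * r j)"
      using sign_classes[OF j] by (simp add: pair_vec_def kr_term_def quadrant_sign_def not_le[symmetric])
  qed
  also have "\<dots> = (\<Prod>j = 1..m. if j \<in> J then -1 else 1) * q powi (\<Sum>j = 1..m. (2 * ?a j - 1) * r j)"
    using power_int_sum[OF assms, of "{1..m}" "\<lambda>j. (2 * ?a j - 1) * r j"] by (simp add: prod.distrib)
  also have "(\<Prod>j = 1..m. if j \<in> J then -1 else 1) = ((-1) ^ card J :: complex)"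
    using J by (simp add: prod.If_cases Int_absorb1 inf.absorb2)
  also have "q powi (\<Sum>j = 1..m. (2 * ?a j - 1) * r j) = q ^ (s * (s + 1)) * q powi q_exponent m k r"
  proof -
    have p: "q powi (X - int N) = q powi X / q ^ N" for X N
      using power_int_diff[of q X "int N"] assms by simp
    show ?thesis unfolding q_exponent_eq[OF m] p using assms by simp
  qed
  finally have kr: "(\<Prod>j = 1..m. kr_term q (pair_vec m k r j)) = (-1) ^ card J * (q ^ (s * (s + 1)) * q powi q_exponent m k r)" .
  have "(\<Prod>(i, j)\<in>{(i, j). 1 \<le> i \<and> i < j \<and> j \<le> m}. of_int ((fst (pair_vec m k r i) - fst (pair_vec m k r j))\<^sup>2)) =
      (\<Prod>(i, j)\<in>{(i, j). 1 \<le> i \<and> i < j \<and> j \<le> m}. complex_of_int ((r i - r j)\<^sup>2))"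
    by (intro prod.cong refl) (auto simp: pair_vec_def)
  moreover have "(-1) ^ card J * (-1) ^ card J = (1 :: complex)" by (simp flip: power_add)
  ultimately show ?thesis
    unfolding vec_coeff_def kr summand_def using assms by simp
qed

end

text \<open>\<open>J\<close> is recovered as the set of nonpositive coordinates, so the sums over
  \<open>J\<close>, \<open>k\<close> and \<open>r\<close> become one sum over the zero-sum vectors
  of pairs whose components agree in sign class.\<close>

lemma pair_vec_bij:
  assumes "m > 0"
  shows "bij_betw (\<lambda>(J, k, r). pair_vec m k r) (Sigma (Pow {1..m}) (\<lambda>J. k_range m J \<times> int_vectors_J m J))
     {P \<in> zero_sum_vecs m. \<forall>j\<in>{1..m}. fst (P j) \<le> 0 \<longleftrightarrow> snd (P j) \<le> 0}"
proof (rule bij_betwI[where g = "\<lambda>P. ({j \<in> {1..m}. fst (P j) \<le> 0}, (\<lambda>j\<in>{1..m-1}. snd (P j)), (\<lambda>j\<in>{1..m}. fst (P j)))"])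
  show "(\<lambda>(J, k, r). pair_vec m k r) \<in> Sigma (Pow {1..m}) (\<lambda>J. k_range m J \<times> int_vectors_J m J) \<rightarrow>
     {P \<in> zero_sum_vecs m. \<forall>j\<in>{1..m}. fst (P j) \<le> 0 \<longleftrightarrow> snd (P j) \<le> 0}"
  proof safe
    fix J k r assume k: "k \<in> k_range m J" and r: "r \<in> int_vectors_J m J"
    show "pair_vec m k r \<in> zero_sum_vecs m"
      using sum_append_neg_sum[OF assms, of k] by (auto simp: zero_sum_vecs_def pair_vec_def)
    fix j assume "j \<in> {1..m}"
    then show "fst (pair_vec m k r j) \<le> 0 \<Longrightarrow> snd (pair_vec m k r j) \<le> 0"
      and "snd (pair_vec m k r j) \<le> 0 \<Longrightarrow> fst (pair_vec m k r j) \<le> 0"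
      using k r by (auto simp: pair_vec_def k_range_def int_vectors_J_def)
  qed
  show "(\<lambda>P. ({j \<in> {1..m}. fst (P j) \<le> 0}, (\<lambda>j\<in>{1..m-1}. snd (P j)), (\<lambda>j\<in>{1..m}. fst (P j)))) \<in>
     {P \<in> zero_sum_vecs m. \<forall>j\<in>{1..m}. fst (P j) \<le> 0 \<longleftrightarrow> snd (P j) \<le> 0} \<rightarrow> Sigma (Pow {1..m}) (\<lambda>J. k_range m J \<times> int_vectors_J m J)"
  proof (rule Pi_I)
    fix P assume "P \<in> {P \<in> zero_sum_vecs m. \<forall>j\<in>{1..m}. fst (P j) \<le> 0 \<longleftrightarrow> snd (P j) \<le> 0}"
    then have P: "P \<in> zero_sum_vecs m" "\<And>j. j \<in> {1..m} \<Longrightarrow> fst (P j) \<le> 0 \<longleftrightarrow> snd (P j) \<le> 0" by auto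
    let ?J = "{j \<in> {1..m}. fst (P j) \<le> 0}" and ?k = "\<lambda>j\<in>{1..m-1}. snd (P j)"
    have "append_neg_sum m ?k \<in> int_vectors m"
      using assms by (auto simp: int_vectors_def append_neg_sum_def PiE_def extensional_def)
    moreover have "?J = {j \<in> {1..m}. append_neg_sum m ?k j \<le> 0}" using append_neg_sum_snd[OF assms P(1)] P(2) by auto
    ultimately have "?k \<in> k_range m ?J"
      by (auto simp: k_range_def int_vectors_J_def int_vectors_def)
    moreover have "(\<lambda>j\<in>{1..m}. fst (P j)) \<in> int_vectors_J m ?J" by (auto simp: int_vectors_J_def int_vectors_def)
    ultimately show "(?J, ?k, (\<lambda>j\<in>{1..m}. fst (P j))) \<in> Sigma (Pow {1..m}) (\<lambda>J. k_range m J \<times> int_vectors_J m J)" by auto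
  qed
  fix x assume "x \<in> Sigma (Pow {1..m}) (\<lambda>J. k_range m J \<times> int_vectors_J m J)"
  then obtain J k r where x: "x = (J, k, r)" "J \<subseteq> {1..m}" "k \<in> k_range m J" "r \<in> int_vectors_J m J" by auto
  have "{j \<in> {1..m}. fst (pair_vec m k r j) \<le> 0} = J"
    using x by (auto simp: pair_vec_def int_vectors_J_def)
  moreover have "(\<lambda>j\<in>{1..m}. fst (pair_vec m k r j)) = r"
  proof
    fix j show "(\<lambda>j\<in>{1..m}. fst (pair_vec m k r j)) j = r j"
      using x(4) by (auto simp: pair_vec_def int_vectors_J_def int_vectors_def PiE_def extensional_def)
  qed
  moreover have "(\<lambda>j\<in>{1..m-1}. snd (pair_vec m k r j)) = k"
  proof
    fix j show "(\<lambda>j\<in>{1..m-1}. snd (pair_vec m k r j)) j = k j"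
      using x(3) append_neg_sum_less[of j m k]
      by (auto simp: pair_vec_def k_range_def int_vectors_def PiE_def extensional_def)
  qed
  ultimately show "(\<lambda>P. ({j \<in> {1..m}. fst (P j) \<le> 0}, (\<lambda>j\<in>{1..m-1}. snd (P j)), (\<lambda>j\<in>{1..m}. fst (P j)))) ((\<lambda>(J, k, r). pair_vec m k r) x) = x"
    unfolding x(1) prod.case by (simp only:)
next
  fix P assume P: "P \<in> {P \<in> zero_sum_vecs m. \<forall>j\<in>{1..m}. fst (P j) \<le> 0 \<longleftrightarrow> snd (P j) \<le> 0}"
  have "pair_vec m (\<lambda>j\<in>{1..m-1}. snd (P j)) (\<lambda>j\<in>{1..m}. fst (P j)) = P"
  proof
    fix j show "pair_vec m (\<lambda>j\<in>{1..m-1}. snd (P j)) (\<lambda>j\<in>{1..m}. fst (P j)) j = P j"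
      using P append_neg_sum_snd[OF assms, of P j] by (auto simp: pair_vec_def zero_sum_vecs_def PiE_def extensional_def)
  qed
  then show "(\<lambda>(J, k, r). pair_vec m k r) (({j \<in> {1..m}. fst (P j) \<le> 0}, (\<lambda>j\<in>{1..m-1}. snd (P j)), (\<lambda>j\<in>{1..m}. fst (P j)))) = P"
    by simp
qed

lemma summand_summable_nonzero:
  assumes q: "q \<noteq> 0" "norm q < 1" and m: "m = 2 * s + 1" and J: "J \<subseteq> {1..m}"
  shows "(\<lambda>(k, r). norm (summand m q k r)) summable_on (k_range m J \<times> int_vectors_J m J)"
proof -
  let ?X = "k_range m J \<times> int_vectors_J m J"
  let ?h = "\<lambda>(k, r). pair_vec m k r"
  have m0: "m > 0" using m by simp
  note bij = pair_vec_bij[OF m0]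
  have inj: "inj_on ?h ?X"
  proof (rule inj_onI)
    fix x y assume "x \<in> ?X" "y \<in> ?X" "?h x = ?h y"
    then have "(J, x) = (J, y)"
      using J by (intro inj_onD[OF bij_betw_imp_inj_on[OF bij]]) auto
    then show "x = y" by simp
  qed
  have "?h ` ?X \<subseteq> zero_sum_vecs m"
  proof
    fix P assume "P \<in> ?h ` ?X"
    then obtain k r where "k \<in> k_range m J" "r \<in> int_vectors_J m J" "P = (\<lambda>(J, k, r). pair_vec m k r) (J, k, r)" by auto
    then show "P \<in> zero_sum_vecs m" using bij_betwE[OF bij] J by blast
  qed
  then have "(\<lambda>P. norm (vec_coeff m q P)) summable_on ?h ` ?X"
    using vec_coeff_infsum(1)[OF q m] summable_on_subset_banach by blast
  then have "((\<lambda>P. norm (vec_coeff m q P)) \<circ> ?h) summable_on ?X"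
    using summable_on_reindex[OF inj] by blast
  then have "(\<lambda>x. 1 / norm q ^ (s * (s + 1)) * ((\<lambda>P. norm (vec_coeff m q P)) \<circ> ?h) x) summable_on ?X"
    by (rule summable_on_cmult_right)
  then show ?thesis
  proof (rule summable_on_cong[THEN iffD1, rotated])
    fix x assume "x \<in> ?X"
    then obtain k r where x: "x = (k, r)" "k \<in> k_range m J" "r \<in> int_vectors_J m J" by auto
    show "1 / norm q ^ (s * (s + 1)) * ((\<lambda>P. norm (vec_coeff m q P)) \<circ> ?h) x = (case x of (k, r) \<Rightarrow> norm (summand m q k r))"
      unfolding x(1) prod.case o_def summand_eq_vec_coeff[OF m J x(2,3) q(1)]
      by (simp add: norm_mult norm_divide norm_power)
  qed
qed

lemma triangle_power_identity_nonzero: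
  assumes q: "q \<noteq> 0" "norm q < 1" and m: "m = 2 * s + 1"
  shows "triangle_series q ^ (2 * m\<^sup>2 - 2) =
           (-1) ^ (m * (m + 1) div 2) / (fact m * (\<Prod>i=1..m-1. fact i)\<^sup>2) * (1 - q ^ m) *
           (\<Sum>J\<in>Pow {1..m}. (-1) ^ card J *
              (\<Sum>\<^sub>\<infinity>k\<in>k_range m J. \<Sum>\<^sub>\<infinity>r\<in>int_vectors_J m J. summand m q k r))"
proof -
  have m0: "m > 0" using m by simp
  let ?X = "\<lambda>J. k_range m J \<times> int_vectors_J m J"
  let ?\<Xi> = "Sigma (Pow {1..m}) ?X"
  let ?h = "\<lambda>(J, k, r). pair_vec m k r"
  let ?W0 = "{P \<in> zero_sum_vecs m. \<forall>j\<in>{1..m}. fst (P j) \<le> 0 \<longleftrightarrow> snd (P j) \<le> 0}"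
  note bij = pair_vec_bij[OF m0]
  have sm0: "(\<lambda>P. vec_coeff m q P) summable_on ?W0"
  proof (rule summable_on_subset_banach)
    show "(\<lambda>P. vec_coeff m q P) summable_on zero_sum_vecs m"
      by (rule abs_summable_summable[OF vec_coeff_infsum(1)[OF q m]])
  qed auto
  have "(\<Sum>\<^sub>\<infinity>P\<in>zero_sum_vecs m. vec_coeff m q P) = (\<Sum>\<^sub>\<infinity>P\<in>?W0. vec_coeff m q P)"
  proof (rule infsum_cong_neutral)
    fix P assume "P \<in> zero_sum_vecs m - ?W0"
    then obtain j where j: "j \<in> {1..m}" "(fst (P j) \<le> 0) \<noteq> (snd (P j) \<le> 0)" by blast
    then have "kr_term q (P j) = 0" by (cases "P j") (auto simp: kr_term_def quadrant_sign_def)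
    then have "(\<Prod>j = 1..m. kr_term q (P j)) = 0" using j(1) by (intro prod_zero) auto
    then show "vec_coeff m q P = 0" by (simp add: vec_coeff_def)
  qed auto
  also have "\<dots> = (\<Sum>\<^sub>\<infinity>x\<in>?\<Xi>. vec_coeff m q (?h x))"
    by (rule infsum_reindex_bij_betw[OF bij, symmetric])
  also have "\<dots> = (\<Sum>\<^sub>\<infinity>J\<in>Pow {1..m}. \<Sum>\<^sub>\<infinity>x\<in>?X J. vec_coeff m q (?h (J, x)))"
    by (rule infsum_Sigma_banach[symmetric], rule summable_on_reindex_bij_betw[OF bij, THEN iffD2, OF sm0])
  also have "\<dots> = (\<Sum>J\<in>Pow {1..m}. \<Sum>\<^sub>\<infinity>x\<in>?X J. vec_coeff m q (?h (J, x)))"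
    by simp
  also have "\<dots> = (\<Sum>J\<in>Pow {1..m}. q ^ (s * (s + 1)) * ((-1) ^ card J *
              (\<Sum>\<^sub>\<infinity>k\<in>k_range m J. \<Sum>\<^sub>\<infinity>r\<in>int_vectors_J m J. summand m q k r)))"
  proof (rule sum.cong[OF refl])
    fix J assume "J \<in> Pow {1..m}"
    then have J: "J \<subseteq> {1..m}" by simp
    have "(\<Sum>\<^sub>\<infinity>x\<in>?X J. vec_coeff m q (?h (J, x))) = (\<Sum>\<^sub>\<infinity>x\<in>?X J. (q ^ (s * (s + 1)) * (-1) ^ card J) * (case x of (k, r) \<Rightarrow> summand m q k r))"
    proof (rule infsum_cong)
      fix x assume "x \<in> ?X J"
      then obtain k r where x: "x = (k, r)" "k \<in> k_range m J" "r \<in> int_vectors_J m J" by auto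
      have "(-1) ^ card J * (-1) ^ card J = (1 :: complex)" by (simp flip: power_add)
      then show "vec_coeff m q (?h (J, x)) = (q ^ (s * (s + 1)) * (-1) ^ card J) * (case x of (k, r) \<Rightarrow> summand m q k r)"
        unfolding x(1) prod.case summand_eq_vec_coeff[OF m J x(2,3) q(1)] using q(1) by simp
    qed
    also have "\<dots> = (q ^ (s * (s + 1)) * (-1) ^ card J) * (\<Sum>\<^sub>\<infinity>x\<in>?X J. case x of (k, r) \<Rightarrow> summand m q k r)"
      by (rule infsum_cmult_right')
    also have "(\<Sum>\<^sub>\<infinity>x\<in>?X J. case x of (k, r) \<Rightarrow> summand m q k r) = (\<Sum>\<^sub>\<infinity>k\<in>k_range m J. \<Sum>\<^sub>\<infinity>r\<in>int_vectors_J m J. summand m q k r)"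
    proof (rule infsum_Sigma'_banach[symmetric])
      have "(\<lambda>x. norm (case x of (k, r) \<Rightarrow> summand m q k r)) summable_on ?X J"
        using summand_summable_nonzero[OF q m J] by (simp add: case_prod_unfold)
      then show "(\<lambda>(k, r). summand m q k r) summable_on ?X J" by (rule abs_summable_summable)
    qed
    finally show "(\<Sum>\<^sub>\<infinity>x\<in>?X J. vec_coeff m q (?h (J, x))) = q ^ (s * (s + 1)) * ((-1) ^ card J *
              (\<Sum>\<^sub>\<infinity>k\<in>k_range m J. \<Sum>\<^sub>\<infinity>r\<in>int_vectors_J m J. summand m q k r))" by (simp only: mult.assoc)
  qed
  also have "\<dots> = q ^ (s * (s + 1)) * (\<Sum>J\<in>Pow {1..m}. (-1) ^ card J *
              (\<Sum>\<^sub>\<infinity>k\<in>k_range m J. \<Sum>\<^sub>\<infinity>r\<in>int_vectors_J m J. summand m q k r))" (is "_ = _ * ?S")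
    by (simp only: sum_distrib_left)
  finally have E: "q ^ (s * (s + 1)) * ?S = - (fact m * ((-1) ^ s * q ^ (s * (s + 1)) * (\<Prod>i=1..m-1. fact i)\<^sup>2 * triangle_series q ^ (2 * m\<^sup>2 - 2)) / (1 - q ^ m))"
    using vec_coeff_infsum(2)[OF q m] by simp
  define F where "F = (\<Prod>i=1..m-1. fact i :: complex)\<^sup>2"
  define T where "T = triangle_series q ^ (2 * m\<^sup>2 - 2)"
  have "F \<noteq> 0" by (simp add: F_def)
  have "norm (q ^ m) < 1" using q m0 by (simp add: norm_power power_less_one_iff)
  then have qm: "1 - q ^ m \<noteq> 0" by auto
  have "q ^ (s * (s + 1)) * ?S = q ^ (s * (s + 1)) * (- (fact m * ((-1) ^ s * F * T) / (1 - q ^ m)))"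
    unfolding E F_def[symmetric] T_def[symmetric] by (simp add: mult_ac)
  then have S: "?S = - (fact m * ((-1) ^ s * F * T) / (1 - q ^ m))"
    by (rule mult_left_cancel[OF power_not_zero[OF q(1)], THEN iffD1])
  \<comment> \<open>The prefactor has the sign \<open>-(-1)^s\<close>; its minus cancels the one
    that \<open>S\<close> inherits from the geometric series.\<close>
  have "m * (m + 1) div 2 = 2 * (s * (s + 1)) + (s + 1)"
    by (simp add: m algebra_simps)
  then have "(-1) ^ (m * (m + 1) div 2) = - ((-1 :: complex) ^ s)"
    by (simp add: power_add power_mult)
  moreover have "(-1) ^ s * (-1) ^ s = (1 :: complex)" by (simp flip: power_add)
  ultimately show ?thesis
    unfolding S F_def[symmetric] T_def[symmetric] using qm \<open>F \<noteq> 0\<close>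
    by (simp add: mult_ac)
qed

section \<open>The case q = 0 by continuity\<close>

lemma summand_near_0:
  assumes m: "m = 2 * s + 1" and J: "J \<subseteq> {1..m}" and kr: "k \<in> k_range m J" "r \<in> int_vectors_J m J"
    and q: "norm q \<le> 1/2"
  shows "norm (summand m q k r - summand m 0 k r) \<le> 2 * norm q * norm (summand m (1/2) k r)"
    and "norm (summand m 0 k r) \<le> norm (summand m (1/2) k r)"
proof -
  define V where "V = (\<Prod>(i, j)\<in>{(i, j). 1 \<le> i \<and> i < j \<and> j \<le> m}. complex_of_int ((r i - r j)\<^sup>2))"
  have sV: "summand m q k r = q powi q_exponent m k r * V" for q by (simp add: summand_def V_def)
  have "norm (summand m q k r - summand m 0 k r) \<le> 2 * norm q * norm (summand m (1/2) k r) \<and>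
      norm (summand m 0 k r) \<le> norm (summand m (1/2) k r)"
  proof (cases "V = 0")
    case True
    then show ?thesis by (simp add: sV)
  next
    case False
    then have "summand m (1/2) k r \<noteq> 0" by (simp add: sV)
    then have "q_exponent m k r \<ge> 0" by (rule q_exponent_nonneg[OF m J kr])
    then obtain e where e: "q_exponent m k r = int e" using nonneg_int_cases by blast
    \<comment> \<open>The point \<open>1/2\<close> supplies the majorant: for \<open>e > 0\<close>,
      \<open>norm q ^ e \<le> norm q * (1/2) ^ (e - 1)\<close>, whence the factor 2; for
      \<open>e = 0\<close> the difference vanishes because \<open>0 ^ 0 = 1\<close>.\<close>
    have "norm (q ^ e - 0 ^ e) \<le> 2 * norm q * (1/2) ^ e" "norm (0 ^ e :: complex) \<le> (1/2) ^ e"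
    proof -
      show "norm (q ^ e - 0 ^ e) \<le> 2 * norm q * (1/2) ^ e"
      proof (cases e)
        case (Suc d)
        have "norm q ^ d \<le> (1/2) ^ d" using q by (intro power_mono) auto
        then show ?thesis using Suc by (simp add: norm_mult norm_power mult_left_mono)
      qed simp
      show "norm (0 ^ e :: complex) \<le> (1/2) ^ e" by (cases e) auto
    qed
    then have "norm (q ^ e - 0 ^ e) * norm V \<le> 2 * norm q * (1/2) ^ e * norm V" "norm (0 ^ e :: complex) * norm V \<le> (1/2) ^ e * norm V"
      by (auto intro: mult_right_mono)
    then show ?thesis
      unfolding sV e power_int_of_nat left_diff_distrib[symmetric] norm_mult norm_power[of "1/2"] by (simp add: mult.assoc norm_divide)
  qed
  then show "norm (summand m q k r - summand m 0 k r) \<le> 2 * norm q * norm (summand m (1/2) k r)"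
    and "norm (summand m 0 k r) \<le> norm (summand m (1/2) k r)" by auto
qed

lemma summand_summable:
  assumes q: "norm q < 1" and m: "m = 2 * s + 1" and J: "J \<subseteq> {1..m}"
  shows "(\<lambda>(k, r). norm (summand m q k r)) summable_on (k_range m J \<times> int_vectors_J m J)"
proof (cases "q = 0")
  case True
  have "(\<lambda>(k, r). norm (summand m (1/2) k r)) summable_on (k_range m J \<times> int_vectors_J m J)"
    by (rule summand_summable_nonzero[OF _ _ m J]) (auto simp: norm_divide)
  then show ?thesis unfolding True
    by (rule summable_on_comparison_test) (use summand_near_0(2)[OF m J, of _ _ 0] in auto)
qed (rule summand_summable_nonzero[OF _ q m J])

lemma tendsto_summand_sum_0:
  assumes m: "m = 2 * s + 1" and J: "J \<subseteq> {1..m}"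
  shows "((\<lambda>q. \<Sum>\<^sub>\<infinity>k\<in>k_range m J. \<Sum>\<^sub>\<infinity>r\<in>int_vectors_J m J. summand m q k r) \<longlongrightarrow>
     (\<Sum>\<^sub>\<infinity>k\<in>k_range m J. \<Sum>\<^sub>\<infinity>r\<in>int_vectors_J m J. summand m 0 k r)) (at 0)"
proof -
  let ?X = "k_range m J \<times> int_vectors_J m J"
  define a where "a = (\<lambda>q. \<Sum>\<^sub>\<infinity>x\<in>?X. summand m q (fst x) (snd x))"
  have ns: "(\<lambda>x. norm (summand m q (fst x) (snd x))) summable_on ?X" if "norm q < 1" for q
    using summand_summable[OF that m J] by (simp add: case_prod_unfold)
  have sm: "(\<lambda>x. summand m q (fst x) (snd x)) summable_on ?X" if "norm q < 1" for q
    by (rule abs_summable_summable[OF ns[OF that]])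
  have it: "(\<Sum>\<^sub>\<infinity>k\<in>k_range m J. \<Sum>\<^sub>\<infinity>r\<in>int_vectors_J m J. summand m q k r) = a q" if "norm q < 1" for q
    using infsum_Sigma'_banach[of "summand m q" "k_range m J" "\<lambda>_. int_vectors_J m J"] sm[OF that]
    by (simp add: a_def case_prod_unfold)
  define B where "B = (\<Sum>\<^sub>\<infinity>x\<in>?X. norm (summand m (1/2) (fst x) (snd x)))"
  have bnd: "norm (a q - a 0) \<le> 2 * norm q * B" if q: "norm q \<le> 1/2" for q
  proof -
    have q1: "norm q < 1" using q by simp
    have nh: "norm (1/2 :: complex) < 1" by (simp add: norm_divide)
    have "norm (a q - a 0) \<le> (\<Sum>\<^sub>\<infinity>x\<in>?X. 2 * norm q * norm (summand m (1/2) (fst x) (snd x)))"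
    proof (rule norm_infsum_le)
      have "((\<lambda>x. summand m q (fst x) (snd x) + - summand m 0 (fst x) (snd x)) has_sum (a q + - a 0)) ?X"
        unfolding a_def
        by (intro has_sum_add has_sum_uminusI has_sum_infsum[OF sm[OF q1]] has_sum_infsum[OF sm[of 0]]) simp
      then show "((\<lambda>x. summand m q (fst x) (snd x) - summand m 0 (fst x) (snd x)) has_sum (a q - a 0)) ?X"
        by simp
      show "((\<lambda>x. 2 * norm q * norm (summand m (1/2) (fst x) (snd x))) has_sum
          (\<Sum>\<^sub>\<infinity>x\<in>?X. 2 * norm q * norm (summand m (1/2) (fst x) (snd x)))) ?X"
        by (intro has_sum_infsum summable_on_cmult_right ns nh)
      fix x assume "x \<in> ?X"
      then show "norm (summand m q (fst x) (snd x) - summand m 0 (fst x) (snd x)) \<le> 2 * norm q * norm (summand m (1/2) (fst x) (snd x))"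
        by (intro summand_near_0(1)[OF m J _ _ q]) auto
    qed
    also have "\<dots> = 2 * norm q * B" unfolding B_def by (rule infsum_cmult_right')
    finally show ?thesis .
  qed
  have "eventually (\<lambda>q. q \<in> ball 0 (1/2) - {0}) (at (0::complex))"
    by (rule eventually_at_in_open) auto
  then have "eventually (\<lambda>q. norm (a q - a 0) \<le> 2 * norm q * B) (at 0)"
    by eventually_elim (rule bnd, simp)
  moreover have "((\<lambda>q::complex. 2 * norm q * B) \<longlongrightarrow> 0) (at 0)"
    by (auto intro!: tendsto_eq_intros)
  ultimately have "((\<lambda>q. a q - a 0) \<longlongrightarrow> 0) (at 0)" by (rule Lim_null_comparison)
  then have "(a \<longlongrightarrow> a 0) (at 0)" by (rule Lim_null[THEN iffD2])
  moreover have "eventually (\<lambda>q. q \<in> ball 0 1 - {0}) (at (0::complex))"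
    by (rule eventually_at_in_open) auto
  then have "eventually (\<lambda>q. a q = (\<Sum>\<^sub>\<infinity>k\<in>k_range m J. \<Sum>\<^sub>\<infinity>r\<in>int_vectors_J m J. summand m q k r)) (at 0)"
    by eventually_elim (simp add: it)
  ultimately show ?thesis unfolding it[of 0, simplified] by (rule Lim_transform_eventually)
qed

lemma tendsto_triangle_series_0: "(triangle_series \<longlongrightarrow> triangle_series 0) (at 0)"
proof -
  have bnd: "norm (triangle_series q - triangle_series 0) \<le> 2 * norm q" if q: "norm q \<le> 1/2" for q
  proof -
    have q1: "norm q < 1" using q by simp
    have "(\<lambda>n. q ^ (n * (n + 1) div 2)) sums triangle_series q"
      unfolding triangle_series_def by (rule summable_sums[OF summable_triangle_series[OF q1]])
    moreover have t0: "triangle_series 0 = 1"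
    proof -
      have "(\<lambda>n. (0::complex) ^ (n * (n + 1) div 2)) = (\<lambda>n. if n = 0 then 1 else 0)"
      proof
        fix n :: nat
        have "n \<le> n * (n + 1) div 2" by (cases n) (auto simp: algebra_simps)
        then show "(0::complex) ^ (n * (n + 1) div 2) = (if n = 0 then 1 else 0)" by (auto simp: power_0_left)
      qed
      then show ?thesis unfolding triangle_series_def
        using sums_unique[OF sums_single[of 0 "\<lambda>_. 1::complex"]] by simp
    qed
    ultimately have "(\<lambda>n. q ^ (Suc n * (Suc n + 1) div 2)) sums (triangle_series q - 1)"
      using sums_Suc_iff[of "\<lambda>n. q ^ (n * (n + 1) div 2)" "triangle_series q - 1"] by simp
    then have s: "triangle_series q - 1 = (\<Sum>n. q ^ (Suc n * (Suc n + 1) div 2))" by (rule sums_unique)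
    have g: "summable (\<lambda>n. norm q * norm q ^ n)" using q1 by (intro summable_mult) simp
    have "norm (\<Sum>n. q ^ (Suc n * (Suc n + 1) div 2)) \<le> (\<Sum>n. norm q * norm q ^ n)"
    proof (rule norm_suminf_le[OF _ g])
      fix n :: nat
      have "Suc n \<le> Suc n * (Suc n + 1) div 2" by (simp add: algebra_simps)
      then have "norm q ^ (Suc n * (Suc n + 1) div 2) \<le> norm q ^ Suc n" using q1 by (intro power_decreasing) auto
      then show "norm (q ^ (Suc n * (Suc n + 1) div 2)) \<le> norm q * norm q ^ n" by (simp only: norm_power power_Suc)
    qed
    also have "\<dots> = norm q * (1 / (1 - norm q))"
      using q1 by (subst suminf_mult) (auto simp: suminf_geometric)
    also have "\<dots> \<le> norm q * 2" using q by (intro mult_left_mono) (auto simp: divide_simps)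
    finally show ?thesis unfolding t0 s by simp
  qed
  have "eventually (\<lambda>q. q \<in> ball 0 (1/2) - {0}) (at (0::complex))"
    by (rule eventually_at_in_open) auto
  then have "eventually (\<lambda>q. norm (triangle_series q - triangle_series 0) \<le> 2 * norm q) (at 0)"
    by eventually_elim (rule bnd, simp)
  moreover have "((\<lambda>q::complex. 2 * norm q) \<longlongrightarrow> 0) (at 0)"
    by (auto intro!: tendsto_eq_intros)
  ultimately have "((\<lambda>q. triangle_series q - triangle_series 0) \<longlongrightarrow> 0) (at 0)" by (rule Lim_null_comparison)
  then show ?thesis by (rule Lim_null[THEN iffD2])
qed

theorem theorem5p5:
  fixes m :: nat and q :: complex
  assumes "m > 1" and "odd m" and "norm q < 1"
  shows "(\<forall>J\<subseteq>{1..m}.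
            (\<lambda>(k, r). norm (summand m q k r)) summable_on (k_range m J \<times> int_vectors_J m J)) \<and>
         triangle_series q ^ (2 * m\<^sup>2 - 2) =
           (-1) ^ (m * (m + 1) div 2) / (fact m * (\<Prod>i=1..m-1. fact i)\<^sup>2) * (1 - q ^ m) *
           (\<Sum>J\<in>Pow {1..m}. (-1) ^ card J *
              (\<Sum>\<^sub>\<infinity>k\<in>k_range m J. \<Sum>\<^sub>\<infinity>r\<in>int_vectors_J m J. summand m q k r))"
proof -
  obtain s where m: "m = 2 * s + 1" using assms(2) by (auto elim: oddE)
  let ?R = "\<lambda>q. (-1) ^ (m * (m + 1) div 2) / (fact m * (\<Prod>i=1..m-1. fact i)\<^sup>2) * (1 - q ^ m) *
           (\<Sum>J\<in>Pow {1..m}. (-1) ^ card J *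
              (\<Sum>\<^sub>\<infinity>k\<in>k_range m J. \<Sum>\<^sub>\<infinity>r\<in>int_vectors_J m J. summand m q k r))"
  have "triangle_series q ^ (2 * m\<^sup>2 - 2) = ?R q"
  proof (cases "q = 0")
    case True
    have "((\<lambda>q. triangle_series q ^ (2 * m\<^sup>2 - 2)) \<longlongrightarrow> triangle_series 0 ^ (2 * m\<^sup>2 - 2)) (at 0)"
      by (intro tendsto_power tendsto_triangle_series_0)
    moreover have "eventually (\<lambda>q. q \<in> ball 0 1 - {0}) (at (0::complex))"
      by (rule eventually_at_in_open) auto
    then have "eventually (\<lambda>q. triangle_series q ^ (2 * m\<^sup>2 - 2) = ?R q) (at 0)"
      by eventually_elim (rule triangle_power_identity_nonzero[OF _ _ m], auto)
    ultimately have "(?R \<longlongrightarrow> triangle_series 0 ^ (2 * m\<^sup>2 - 2)) (at 0)"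
      by (rule Lim_transform_eventually)
    moreover have "(?R \<longlongrightarrow> ?R 0) (at 0)"
      by (intro tendsto_mult tendsto_sum tendsto_const tendsto_diff tendsto_power tendsto_ident_at
          tendsto_summand_sum_0[OF m]) auto
    ultimately have "triangle_series 0 ^ (2 * m\<^sup>2 - 2) = ?R 0"
      by (rule tendsto_unique[OF at_neq_bot])
    then show ?thesis unfolding True .
  qed (rule triangle_power_identity_nonzero[OF _ assms(3) m])
  then show ?thesis using summand_summable[OF assms(3) m] by blast
qed

end
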